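(* (a) If $X$ and $P$ are finite, then the word problem for $M(X,P)$ is decidable. (b) If $X$ and $P$ are finite and $H$ is a finitely generated closed inverse submonoid of $M(X,P)$ (i.e. $H=N^\omega$ for the inverse submonoid $N$ generated by a finite subset of $M(X,P)$), then the associated $\Delta$-complex $\mathcal C_H$ (the unique connected $\Delta$-complex labeled over $B(X,P)$, with a $0$-cell $v$ such that $L(\mathcal C_H,v)=H$) is finite, and it can be effectively constructed from a finite generating set of $H$.
   Context: A $\Delta$-complex is a CW-complex in which each $k$-cell $c$ has a distinguished characteristic map $\sigma_c\colon\Delta^k=[v_0,\dots,v_k]\to\mathcal C$ whose restriction to each $(k-1)$-face (identified order-preservingly with $\Delta^{k-1}$) is the distinguished characteristic map of a $(k-1)$-cell; the root of $c$ is $\sigma_c(v_0)$; a $1$-cell $e$ goes from $\sigma_e(v_0)$ to $\sigma_e(v_1)$. An immersion is a continuous map that is a local homeomorphism onto its image and commutes with characteristic maps (each $k$-cell $d$ maps onto a $k$-cell with $f\circ\sigma_d=\sigma_{f(d)}$). $B(X,P)$ is a finite-dimensional $\Delta$-complex with one $0$-cell, $1$-cells indexed by $X$, $k$-cells ($2\le k\le n$) indexed by $P_k$, index sets pairwise disjoint, $P=\bigcup P_k$. A complex is labeled over $B(X,P)$ via an immersion to $B(X,P)$, and $\ell(c)$ is the index of the image cell. Boundary labels: for a $k$-cell $c$ ($k\ge2$) with characteristic map $\sigma$, $c_i$ is the $(k-1)$-cell with characteristic map $\sigma$ restricted to the face omitting $v_i$, $e(c)=\sigma([v_0,v_1])$;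 $bl(c)=\ell(\sigma[v_0,v_1])\ell(\sigma[v_1,v_2])\ell(\sigma[v_0,v_2])^{-1}$ if $k=2$, $bl(c)=\ell(c_k)\cdots\ell(c_1)\ell(e(c))\ell(c_0)\ell(e(c))^{-1}$ if $k\ge3$; $bl(\rho)$ is that of the cell of $B(X,P)$ labeled $\rho$. $M(X,P)$ is the inverse monoid presented by generators $X\cup P$ and relations $\rho^2=\rho$, $\rho=\rho\,bl(\rho)$ for $\rho\in P$ (the word problem asks to decide whether two words over $X\cup X^{-1}\cup P$ represent the same element). $M(X,P)$ acts on the right by partial injections on the $0$-cells of a labeled complex: $v\cdot x=w$ iff there is a $1$-cell labeled $x\in X$ from $v$ to $w$, $v\cdot x^{-1}=w$ iff there is one from $w$ to $v$, $v\cdot\rho=v$ iff $v$ is the root of a cell labeled $\rho\in P$; the loop monoid is $L(\mathcal C,v)=\{m: v\cdot m=v\}$. Natural partial order $a\le b$ iff $a=eb$ with $e$ idempotent; $N^\omega=\{m: m\ge n, n\in N\}$; closed means $N=N^\omega$. *)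

theory Defs
  imports Main "HOL-Library.Nat_Bijection"
begin

section \<open>Computability: total recursive functions (Kleene)\<close>

text \<open>tot_rec n f: f is a total recursive function of arity n (only its values on
argument lists of length n matter). Closure of zero, successor, projections under
composition, primitive recursion and regular (total) minimisation.\<close>

inductive tot_rec :: "nat \<Rightarrow> (nat list \<Rightarrow> nat) \<Rightarrow> bool" where
  rz: "tot_rec n (\<lambda>_. 0)"
| rs: "tot_rec 1 (\<lambda>xs. Suc (hd xs))"
| rp: "i < n \<Longrightarrow> tot_rec n (\<lambda>xs. xs ! i)"
| rc: "tot_rec m f \<Longrightarrow> length gs = m \<Longrightarrow> (\<forall>g\<in>set gs. tot_rec n g)
       \<Longrightarrow> tot_rec n (\<lambda>xs. f (map (\<lambda>g. g xs) gs))"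
| rpr: "tot_rec n f \<Longrightarrow> tot_rec (Suc (Suc n)) g
       \<Longrightarrow> tot_rec (Suc n) (\<lambda>xs. rec_nat (f (tl xs)) (\<lambda>k r. g (r # k # tl xs)) (hd xs))"
| rmu: "tot_rec (Suc n) g \<Longrightarrow> (\<forall>xs. length xs = n \<longrightarrow> (\<exists>y. g (y # xs) = 0))
       \<Longrightarrow> tot_rec n (\<lambda>xs. LEAST y. g (y # xs) = 0)"

definition computable1 :: "(nat \<Rightarrow> nat) \<Rightarrow> bool" where
  "computable1 f \<longleftrightarrow> (\<exists>g. tot_rec 1 g \<and> (\<forall>x. g [x] = f x))"

section \<open>Delta-complexes as semi-simplicial data\<close>

text \<open>cface D i c is the (k-1)-cell whose characteristic map is that of the k-cell c
restricted to the face omitting v_i.\<close>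

record 'c dcx =
  cells :: "'c set"
  cdim  :: "'c \<Rightarrow> nat"
  cface :: "nat \<Rightarrow> 'c \<Rightarrow> 'c"

definition delta_complex :: "'c dcx \<Rightarrow> bool" where
  "delta_complex D \<longleftrightarrow>
     (\<forall>c\<in>cells D. 0 < cdim D c \<longrightarrow> (\<forall>i \<le> cdim D c.
         cface D i c \<in> cells D \<and> cdim D (cface D i c) = cdim D c - 1)) \<and>
     (\<forall>c\<in>cells D. 2 \<le> cdim D c \<longrightarrow> (\<forall>i j. i < j \<and> j \<le> cdim D c \<longrightarrow>
         cface D i (cface D j c) = cface D (j - 1) (cface D i c)))"

definition zcells :: "'c dcx \<Rightarrow> 'c set" where
  "zcells D = {c \<in> cells D. cdim D c = 0}"

text \<open>vtx D n c j: the 0-cell sigma_c(v_j) of an n-cell c.\<close>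
fun vtx :: "'c dcx \<Rightarrow> nat \<Rightarrow> 'c \<Rightarrow> nat \<Rightarrow> 'c" where
  "vtx D 0 c j = c"
| "vtx D (Suc n) c j =
     (if j \<le> n then vtx D n (cface D (Suc n) c) j else vtx D n (cface D 0 c) (j - 1))"

definition vertex :: "'c dcx \<Rightarrow> 'c \<Rightarrow> nat \<Rightarrow> 'c" where
  "vertex D c j = vtx D (cdim D c) c j"

definition root :: "'c dcx \<Rightarrow> 'c \<Rightarrow> 'c" where
  "root D c = vertex D c 0"

text \<open>edge01 D n c: the 1-cell sigma_c([v_0,v_1]) of an (n+1)-cell c.\<close>
fun edge01 :: "'c dcx \<Rightarrow> nat \<Rightarrow> 'c \<Rightarrow> 'c" where
  "edge01 D 0 c = c"
| "edge01 D (Suc n) c = edge01 D n (cface D (Suc (Suc n)) c)"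

definition ecell :: "'c dcx \<Rightarrow> 'c \<Rightarrow> 'c" where
  "ecell D c = edge01 D (cdim D c - 1) c"

text \<open>Connectedness (of the CW complex) = connectedness of its 1-skeleton.\<close>
definition dconnected :: "'c dcx \<Rightarrow> bool" where
  "dconnected D \<longleftrightarrow> zcells D \<noteq> {} \<and>
     (\<forall>a\<in>zcells D. \<forall>b\<in>zcells D. (a, b) \<in>
        ({(u, w). \<exists>e\<in>cells D. cdim D e = 1 \<and>
            ((cface D 1 e = u \<and> cface D 0 e = w) \<or> (cface D 1 e = w \<and> cface D 0 e = u))})\<^sup>*)"

section \<open>The complex B(X,P)\<close>

definition B_complex :: "'a dcx \<Rightarrow> bool" where
  "B_complex B \<longleftrightarrow> delta_complex B \<and> card (zcells B) = 1 \<and>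
     (\<exists>n. \<forall>c\<in>cells B. cdim B c \<le> n)"

definition Xs :: "'a dcx \<Rightarrow> 'a set" where
  "Xs B = {c \<in> cells B. cdim B c = 1}"

definition Ps :: "'a dcx \<Rightarrow> 'a set" where
  "Ps B = {c \<in> cells B. 2 \<le> cdim B c}"

section \<open>Labeled complexes (immersions into B)\<close>

definition labeled :: "'a dcx \<Rightarrow> 'c dcx \<Rightarrow> ('c \<Rightarrow> 'a) \<Rightarrow> bool" where
  "labeled B C lab \<longleftrightarrow> delta_complex C \<and>
     (\<forall>c\<in>cells C. lab c \<in> cells B \<and> cdim B (lab c) = cdim C c \<and>
        (0 < cdim C c \<longrightarrow> (\<forall>i \<le> cdim C c. lab (cface C i c) = cface B i (lab c)))) \<and>
     \<comment> \<open>local injectivity: no two distinct cells with the same label share a vertex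
         in the same position\<close>
     (\<forall>c\<in>cells C. \<forall>d\<in>cells C. cdim C c = cdim C d \<and> lab c = lab d \<and>
        (\<exists>j \<le> cdim C c. vertex C c j = vertex C d j) \<longrightarrow> c = d)"

section \<open>Words and the inverse monoid M(X,P)\<close>

datatype 'a letter = Gen 'a | InvGen 'a

fun linv :: "'a letter \<Rightarrow> 'a letter" where
  "linv (Gen a) = InvGen a"
| "linv (InvGen a) = Gen a"

definition winv :: "'a letter list \<Rightarrow> 'a letter list" where
  "winv w = rev (map linv w)"

text \<open>Boundary label of a cell rho of B (k = dim rho >= 2).\<close>
definition bl :: "'a dcx \<Rightarrow> 'a \<Rightarrow> 'a letter list" where
  "bl B \<rho> = (if cdim B \<rho> = 2
     then [Gen (cface B 2 \<rho>), Gen (cface B 0 \<rho>), InvGen (cface B 1 \<rho>)]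
     else map (\<lambda>i. Gen (cface B i \<rho>)) (rev [1..<Suc (cdim B \<rho>)]) @
          [Gen (ecell B \<rho>), Gen (cface B 0 \<rho>), InvGen (ecell B \<rho>)])"

text \<open>The congruence on the free involutive monoid presenting the inverse monoid
M(X,P) = Inv< X \<union> P | rho^2 = rho, rho = rho bl(rho) >: generated by the Vagner
relations and the defining relations.\<close>
inductive eqM :: "'a dcx \<Rightarrow> 'a letter list \<Rightarrow> 'a letter list \<Rightarrow> bool" for B where
  refl: "eqM B u u"
| sym: "eqM B u v \<Longrightarrow> eqM B v u"
| trans: "eqM B u v \<Longrightarrow> eqM B v w \<Longrightarrow> eqM B u w"
| ctx: "eqM B u v \<Longrightarrow> eqM B (p @ u @ q) (p @ v @ q)"
| vag1: "eqM B (w @ winv w @ w) w"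
| vag2: "eqM B (w @ winv w @ z @ winv z) (z @ winv z @ w @ winv w)"
| idem: "\<rho> \<in> Ps B \<Longrightarrow> eqM B [Gen \<rho>, Gen \<rho>] [Gen \<rho>]"
| brel: "\<rho> \<in> Ps B \<Longrightarrow> eqM B [Gen \<rho>] (Gen \<rho> # bl B \<rho>)"

text \<open>Words over X \<union> X^-1 \<union> P.\<close>
definition allowed :: "'a dcx \<Rightarrow> 'a letter list \<Rightarrow> bool" where
  "allowed B w \<longleftrightarrow> (\<forall>l\<in>set w. case l of Gen a \<Rightarrow> a \<in> Xs B \<union> Ps B | InvGen a \<Rightarrow> a \<in> Xs B)"

text \<open>Inverse submonoid generated by (the elements represented by) the words ws,
as a set of words (saturated under eqM).\<close>
inductive_set gen_sub :: "'a dcx \<Rightarrow> 'a letter list list \<Rightarrow> 'a letter list set" for B ws where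
  one: "[] \<in> gen_sub B ws"
| gen: "w \<in> set ws \<Longrightarrow> w \<in> gen_sub B ws"
| inv: "u \<in> gen_sub B ws \<Longrightarrow> winv u \<in> gen_sub B ws"
| mult: "u \<in> gen_sub B ws \<Longrightarrow> v \<in> gen_sub B ws \<Longrightarrow> u @ v \<in> gen_sub B ws"
| sat: "u \<in> gen_sub B ws \<Longrightarrow> eqM B u v \<Longrightarrow> v \<in> gen_sub B ws"

definition idempotentM :: "'a dcx \<Rightarrow> 'a letter list \<Rightarrow> bool" where
  "idempotentM B e \<longleftrightarrow> eqM B (e @ e) e"

text \<open>Natural partial order: a \<le> b iff a = e b for an idempotent e.\<close>
definition leqM :: "'a dcx \<Rightarrow> 'a letter list \<Rightarrow> 'a letter list \<Rightarrow> bool" where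
  "leqM B a b \<longleftrightarrow> (\<exists>e. idempotentM B e \<and> eqM B a (e @ b))"

definition omega_closure :: "'a dcx \<Rightarrow> 'a letter list set \<Rightarrow> 'a letter list set" where
  "omega_closure B N = {m. \<exists>n\<in>N. leqM B n m}"

section \<open>Action of M(X,P) on the 0-cells of a labeled complex; loop monoid\<close>

definition step :: "'c dcx \<Rightarrow> ('c \<Rightarrow> 'a) \<Rightarrow> 'c \<Rightarrow> 'a letter \<Rightarrow> 'c \<Rightarrow> bool" where
  "step C lab v l w \<longleftrightarrow> (case l of
      Gen a \<Rightarrow> (\<exists>e\<in>cells C. cdim C e = 1 \<and> lab e = a \<and> cface C 1 e = v \<and> cface C 0 e = w)
               \<or> (\<exists>c\<in>cells C. 2 \<le> cdim C c \<and> lab c = a \<and> root C c = v \<and> w = v)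
    | InvGen a \<Rightarrow> (\<exists>e\<in>cells C. cdim C e = 1 \<and> lab e = a \<and> cface C 1 e = w \<and> cface C 0 e = v)
               \<or> (\<exists>c\<in>cells C. 2 \<le> cdim C c \<and> lab c = a \<and> root C c = v \<and> w = v))"

inductive acts :: "'c dcx \<Rightarrow> ('c \<Rightarrow> 'a) \<Rightarrow> 'c \<Rightarrow> 'a letter list \<Rightarrow> 'c \<Rightarrow> bool" for C lab where
  nil: "v \<in> zcells C \<Longrightarrow> acts C lab v [] v"
| cons: "step C lab v l w \<Longrightarrow> acts C lab w ls u \<Longrightarrow> acts C lab v (l # ls) u"

text \<open>Loop monoid L(C,v), represented by the words over X \<union> X^-1 \<union> P fixing v.\<close>
definition loop_words :: "'a dcx \<Rightarrow> 'c dcx \<Rightarrow> ('c \<Rightarrow> 'a) \<Rightarrow> 'c \<Rightarrow> 'a letter list set" where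
  "loop_words B C lab v = {u. allowed B u \<and> acts C lab v u v}"

section \<open>Encodings as natural numbers\<close>

definition code_letter :: "('a \<Rightarrow> nat) \<Rightarrow> 'a letter \<Rightarrow> nat" where
  "code_letter enc l = (case l of Gen a \<Rightarrow> 2 * enc a | InvGen a \<Rightarrow> 2 * enc a + 1)"

definition code_word :: "('a \<Rightarrow> nat) \<Rightarrow> 'a letter list \<Rightarrow> nat" where
  "code_word enc w = list_encode (map (code_letter enc) w)"

definition code_words :: "('a \<Rightarrow> nat) \<Rightarrow> 'a letter list list \<Rightarrow> nat" where
  "code_words enc ws = list_encode (map (code_word enc) ws)"

text \<open>A finite labeled complex is given by a base 0-cell index and a list of cells;
cell i is (dimension, code of its label, list of indices of its faces 0..dim).\<close>
definition code_cx :: "nat \<Rightarrow> (nat \<times> nat \<times> nat list) list \<Rightarrow> nat" where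
  "code_cx w0 cl = prod_encode (w0, list_encode
      (map (\<lambda>(d, l, fs). prod_encode (d, prod_encode (l, list_encode fs))) cl))"

definition cx_of :: "(nat \<times> nat \<times> nat list) list \<Rightarrow> nat dcx" where
  "cx_of cl = \<lparr> cells = {..<length cl}, cdim = (\<lambda>i. fst (cl ! i)),
                cface = (\<lambda>k i. snd (snd (cl ! i)) ! k) \<rparr>"

definition lab_of :: "'a dcx \<Rightarrow> ('a \<Rightarrow> nat) \<Rightarrow> (nat \<times> nat \<times> nat list) list \<Rightarrow> nat \<Rightarrow> 'a" where
  "lab_of B enc cl i = the_inv_into (cells B) enc (fst (snd (cl ! i)))"

end

(*
  For a closed inverse submonoid H = N^omega, the complex C_H is built directly from right cosets:
  its 0-cells are the classes of words p with p p^-1 in H, where p ~ q iff p q^-1 is in H, and a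
  cell with label a is attached at the class of p iff p a is again such a word.

  Finiteness: in any connected labeled complex with loop monoid H, the cells traversed by the
  generators of N and their iterated faces form a subcomplex with the same loop monoid, and hence
  everything; so the number of cells is bounded by an explicit function of the generators.

  Decidability then needs no rewriting or folding. C_H maps to every labeled complex in which the
  generators are loops, so it is found as the first coded complex that maps to all such complexes
  below the size bound. Two words are equal in M(X,P) iff they act in the same way on all labeled
  complexes below the bound, because u <= v can be read off from the coset complex of the
  submonoid generated by u u^-1.
*)
theory Submission
  imports Defs
begin

section \<open>Total recursive functions on encoded data\<close>

text \<open>Equality in M(X,P) and membership in H are given by derivations, which by themselves
  offer at best a semi-decision. The action on a finite complex is decidable and invariant under
  derivations, so all tests are tests of actions. Two inclusions identify the complex found by the
  search. Its base point is fixed by the generators, hence by all of H. It also maps to the coset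
  complex, whose loops are exactly H and whose code lies below the bound, so it has no other loops.
  Maps of 0-cells that respect labeled steps suffice for this. That cells can be attached to cosets
  rests on the form of the boundary labels: by rho = rho bl(rho), the word bl(rho) can be read
  wherever rho can, and it mentions every face of the cell and the edge leading to the root of the
  face omitting v_0. The size bound is \<open>Suc (m * Suc m) * (n + 2) ^ n\<close>: the base point,
  at most m + 1 cells for each of at most m words of length at most m, then n rounds in which each
  cell is kept and contributes at most n + 1 faces.\<close>

definition recf :: "nat \<Rightarrow> (nat list \<Rightarrow> nat) \<Rightarrow> bool" where
  "recf n f \<longleftrightarrow> (\<exists>g. tot_rec n g \<and> (\<forall>xs. length xs = n \<longrightarrow> g xs = f xs))"

lemma recfI: "tot_rec n g \<Longrightarrow> (\<And>xs. length xs = n \<Longrightarrow> g xs = f xs) \<Longrightarrow> recf n f"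
  unfolding recf_def by blast

text \<open>This closure is the purpose of \<open>recf\<close>: the rules of \<open>tot_rec\<close>
  produce particular functions on lists of all lengths, and agreement on lists of length
  \<open>n\<close> alone does not carry \<open>tot_rec\<close> over.\<close>

lemma recf_cong: "recf n f \<Longrightarrow> (\<And>xs. length xs = n \<Longrightarrow> f xs = g xs) \<Longrightarrow> recf n g"
proof -
  assume "recf n f" and fg: "\<And>xs. length xs = n \<Longrightarrow> f xs = g xs"
  from \<open>recf n f\<close> obtain h where h: "tot_rec n h" "\<And>xs. length xs = n \<Longrightarrow> h xs = f xs"
    unfolding recf_def by blast
  show ?thesis
  proof (rule recfI[OF h(1)])
    fix xs :: "nat list" assume "length xs = n"
    from h(2)[OF this] fg[OF this] show "h xs = g xs" by (rule HOL.trans)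
  qed
qed

lemma recf_nth: "i < n \<Longrightarrow> recf n (\<lambda>xs. xs ! i)"
  by (rule recfI[OF rp]) simp_all

lemma recf_comp:
  assumes "recf (length hs) f" and "\<forall>h\<in>set hs. recf n h"
  shows "recf n (\<lambda>xs. f (map (\<lambda>h. h xs) hs))"
proof -
  obtain f' where f': "tot_rec (length hs) f'" "\<And>xs. length xs = length hs \<Longrightarrow> f' xs = f xs"
    using assms(1) unfolding recf_def by blast
  obtain c where c: "\<forall>h\<in>set hs. tot_rec n (c h) \<and> (\<forall>xs. length xs = n \<longrightarrow> c h xs = h xs)"
    using bchoice[OF assms(2)[unfolded recf_def]] by blast
  have "tot_rec n (\<lambda>xs. f' (map (\<lambda>g. g xs) (map c hs)))"
    by (rule rc[OF f'(1)]) (use c in auto)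
  moreover have "f' (map (\<lambda>g. g xs) (map c hs)) = f (map (\<lambda>h. h xs) hs)" if "length xs = n" for xs
  proof -
    have "map (\<lambda>g. g xs) (map c hs) = map (\<lambda>h. h xs) hs" using c that by simp
    then show ?thesis using f'(2)[of "map (\<lambda>h. h xs) hs"] by (simp only: length_map)
  qed
  ultimately show ?thesis by (rule recfI)
qed

lemma recf_comp1: "recf 1 (\<lambda>xs. F (xs ! 0)) \<Longrightarrow> recf n a \<Longrightarrow> recf n (\<lambda>xs. F (a xs))"
  using recf_comp[of "[a]" "\<lambda>xs. F (xs ! 0)" n] by simp

lemma recf_comp2:
  "recf 2 (\<lambda>xs. F (xs ! 0) (xs ! 1)) \<Longrightarrow> recf n a \<Longrightarrow> recf n b \<Longrightarrow> recf n (\<lambda>xs. F (a xs) (b xs))"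
  using recf_comp[of "[a, b]" "\<lambda>xs. F (xs ! 0) (xs ! 1)" n] by (simp add: numeral_2_eq_2)

lemma recf_rec:
  assumes "recf n f" and "recf (Suc (Suc n)) g"
  shows "recf (Suc n) (\<lambda>xs. rec_nat (f (tl xs)) (\<lambda>k r. g (r # k # tl xs)) (hd xs))"
proof -
  obtain f' where f': "tot_rec n f'" "\<And>xs. length xs = n \<Longrightarrow> f' xs = f xs"
    using assms(1) unfolding recf_def by blast
  obtain g' where g': "tot_rec (Suc (Suc n)) g'" "\<And>xs. length xs = Suc (Suc n) \<Longrightarrow> g' xs = g xs"
    using assms(2) unfolding recf_def by blast
  have "rec_nat (f' (tl xs)) (\<lambda>k r. g' (r # k # tl xs)) m =
      rec_nat (f (tl xs)) (\<lambda>k r. g (r # k # tl xs)) m" if "length xs = Suc n" for xs m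
    by (induction m) (use that f' g' in auto)
  then show ?thesis by (intro recfI[OF rpr[OF f'(1) g'(1)]]) auto
qed

lemma recf_Least:
  assumes "recf (Suc n) g" and ex: "\<And>xs. length xs = n \<Longrightarrow> \<exists>y. g (y # xs) = 0"
  shows "recf n (\<lambda>xs. LEAST y. g (y # xs) = 0)"
proof -
  obtain g' where g': "tot_rec (Suc n) g'" "\<And>xs. length xs = Suc n \<Longrightarrow> g' xs = g xs"
    using assms(1) unfolding recf_def by blast
  show ?thesis
    by (rule recfI[OF rmu[OF g'(1)]]) (use g' ex in auto)
qed

lemma recf_const0: "recf n (\<lambda>_. 0)"
  by (rule recfI[OF rz]) simp

lemma recf_Suc: "recf n a \<Longrightarrow> recf n (\<lambda>xs. Suc (a xs))"
proof (rule recf_comp1[of Suc])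
  show "recf 1 (\<lambda>xs. Suc (xs ! 0))" by (rule recfI[OF rs], simp, subst hd_conv_nth) auto
qed

lemma recf_add: "recf n a \<Longrightarrow> recf n b \<Longrightarrow> recf n (\<lambda>xs. a xs + b xs)"
proof (rule recf_comp2[of "(+)"])
  have eq: "rec_nat y (\<lambda>k r. Suc r) x = x + y" for x y :: nat by (induction x) auto
  have "recf (Suc 1) (\<lambda>xs. rec_nat (tl xs ! 0) (\<lambda>k r. Suc ((r # k # tl xs) ! 0)) (hd xs))"
    by (rule recf_rec[of 1 "\<lambda>ys. ys ! 0" "\<lambda>ys. Suc (ys ! 0)"]) (intro recf_nth recf_Suc; simp)+
  then show "recf 2 (\<lambda>xs. xs ! 0 + xs ! 1)"
    unfolding numeral_2_eq_2 One_nat_def by (rule recf_cong) (auto simp: eq length_Suc_conv)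
qed

lemma recf_pred: "recf n a \<Longrightarrow> recf n (\<lambda>xs. a xs - 1)"
proof (rule recf_comp1[of "\<lambda>x. x - 1"])
  have eq: "rec_nat 0 (\<lambda>k r. k) x = x - 1" for x :: nat by (cases x) auto
  have "recf (Suc 0) (\<lambda>xs. rec_nat 0 (\<lambda>k r. (r # k # tl xs) ! 1) (hd xs))"
    by (rule recf_rec[of 0 "\<lambda>_. 0" "\<lambda>ys. ys ! 1"]) (intro recf_nth recf_const0; simp)+
  then show "recf 1 (\<lambda>xs. xs ! 0 - 1)"
    unfolding One_nat_def by (rule recf_cong) (auto simp: eq length_Suc_conv)
qed

lemma recf_diff: "recf n a \<Longrightarrow> recf n b \<Longrightarrow> recf n (\<lambda>xs. a xs - b xs)"
proof -
  have eq: "rec_nat y (\<lambda>k r. r - 1) x = y - x" for x y :: nat by (induction x) auto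
  \<comment> \<open>Recursion runs on the head of the argument list, so the subtrahend takes the
    first place; the order is swapped back at the end.\<close>
  have "recf (Suc 1) (\<lambda>xs. rec_nat (tl xs ! 0) (\<lambda>k r. (r # k # tl xs) ! 0 - 1) (hd xs))"
    by (rule recf_rec[of 1 "\<lambda>ys. ys ! 0" "\<lambda>ys. ys ! 0 - 1"]) (intro recf_nth recf_pred; simp)+
  then have *: "recf 2 (\<lambda>xs. xs ! 1 - xs ! 0)"
    unfolding numeral_2_eq_2 One_nat_def by (rule recf_cong) (auto simp: eq[simplified] length_Suc_conv)
  show "recf n a \<Longrightarrow> recf n b \<Longrightarrow> recf n (\<lambda>xs. a xs - b xs)"
    using recf_comp2[of "\<lambda>x y. y - x", OF *] by blast
qed

lemma recf_triangle: "recf n a \<Longrightarrow> recf n (\<lambda>xs. triangle (a xs))"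
proof (rule recf_comp1[of triangle])
  have eq: "rec_nat 0 (\<lambda>k r. r + Suc k) x = triangle x" for x by (induction x) auto
  have "recf (Suc 0) (\<lambda>xs. rec_nat 0
      (\<lambda>k r. (r # k # tl xs) ! 0 + Suc ((r # k # tl xs) ! 1)) (hd xs))"
    by (rule recf_rec[of 0 "\<lambda>_. 0" "\<lambda>ys. ys ! 0 + Suc (ys ! 1)"])
      (intro recf_nth recf_const0 recf_add recf_Suc; simp)+
  then show "recf 1 (\<lambda>xs. triangle (xs ! 0))"
    unfolding One_nat_def by (rule recf_cong) (auto simp: eq[simplified] length_Suc_conv)
qed

section \<open>Inverting the Cantor pairing\<close>

definition pfst :: "nat \<Rightarrow> nat" where "pfst z = fst (prod_decode z)"
definition psnd :: "nat \<Rightarrow> nat" where "psnd z = snd (prod_decode z)"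

lemma pfst_encode [simp]: "pfst (prod_encode (a, b)) = a"
  and psnd_encode [simp]: "psnd (prod_encode (a, b)) = b"
  and prod_encode_pfst_psnd [simp]: "prod_encode (pfst z, psnd z) = z"
  by (simp_all add: pfst_def psnd_def)

lemma triangle_mono: "m \<le> n \<Longrightarrow> triangle m \<le> triangle n"
  by (induction n) (auto simp: le_Suc_eq)

text \<open>The index of the diagonal containing \<open>z\<close>: as
  \<open>prod_encode (a, b) = triangle (a + b) + a\<close>, it is the least \<open>s\<close> with
  \<open>z < triangle (Suc s)\<close>. The inequality is written as a vanishing difference to fit
  the minimisation scheme.\<close>

definition tri_index :: "nat \<Rightarrow> nat" where
  "tri_index z = (LEAST s. Suc z - triangle (Suc s) = 0)"

lemma tri_index_eq: "tri_index z = pfst z + psnd z"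
proof -
  define a b where "a = pfst z" and "b = psnd z"
  have z: "z = triangle (a + b) + a"
    using prod_encode_pfst_psnd[of z] unfolding a_def b_def prod_encode_def by simp
  have "(LEAST s. Suc z - triangle (Suc s) = 0) = a + b"
  proof (rule Least_equality)
    show "Suc z - triangle (Suc (a + b)) = 0" unfolding z by simp
  next
    fix s assume s: "Suc z - triangle (Suc s) = 0"
    show "a + b \<le> s"
    proof (rule ccontr)
      assume "\<not> a + b \<le> s"
      then have "triangle (Suc s) \<le> triangle (a + b)" by (intro triangle_mono) simp
      then show False using s unfolding z by simp
    qed
  qed
  then show ?thesis unfolding tri_index_def a_def b_def .
qed

lemma recf_tri_index: "recf n a \<Longrightarrow> recf n (\<lambda>xs. tri_index (a xs))"
proof (rule recf_comp1[of tri_index])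
  have "recf 1 (\<lambda>xs. LEAST y. (\<lambda>ys. Suc (ys ! 1) - triangle (Suc (ys ! 0))) (y # xs) = 0)"
  proof (rule recf_Least)
    show "recf (Suc 1) (\<lambda>ys. Suc (ys ! 1) - triangle (Suc (ys ! 0)))"
      by (intro recf_diff recf_Suc recf_triangle recf_nth) auto
    have "\<exists>y. Suc z - triangle (Suc y) = 0" for z
      by (rule exI[of _ z]) (simp add: triangle_def)
    then show "\<exists>y. Suc ((y # xs) ! 1) - triangle (Suc ((y # xs) ! 0)) = 0" for xs
      by auto
  qed
  then show "recf 1 (\<lambda>xs. tri_index (xs ! 0))" unfolding tri_index_def by simp
qed

lemma recf_pfst: "recf n a \<Longrightarrow> recf n (\<lambda>xs. pfst (a xs))"
  and recf_psnd: "recf n a \<Longrightarrow> recf n (\<lambda>xs. psnd (a xs))"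
proof -
  have 1: "pfst z = z - triangle (tri_index z)" for z
    using prod_encode_pfst_psnd[of z] unfolding tri_index_eq prod_encode_def by simp
  have 2: "psnd z = tri_index z - pfst z" for z unfolding tri_index_eq by simp
  show *: "recf n (\<lambda>xs. pfst (a xs))" if "recf n a" unfolding 1
    by (intro recf_diff recf_triangle recf_tri_index that)
  show "recf n (\<lambda>xs. psnd (a xs))" if "recf n a" unfolding 2
    by (intro recf_diff recf_tri_index that *)
qed

lemma recf_prod_encode: "recf n a \<Longrightarrow> recf n b \<Longrightarrow> recf n (\<lambda>xs. prod_encode (a xs, b xs))"
  unfolding prod_encode_def by (auto intro!: recf_add recf_triangle)

section \<open>Unary computable functions, with nested pairs for several arguments\<close>

lemma computable1_iff: "computable1 f \<longleftrightarrow> recf 1 (\<lambda>xs. f (xs ! 0))"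
  unfolding computable1_def recf_def by (auto simp: length_Suc_conv)

named_theorems comp_intro

lemma comp_id [comp_intro]: "computable1 (\<lambda>e. e)"
  unfolding computable1_iff by (rule recf_nth) simp

lemma comp_const [comp_intro]: "computable1 (\<lambda>e. c)"
proof -
  have "recf 1 (\<lambda>_. c)" by (induction c) (auto intro: recf_const0 recf_Suc)
  then show ?thesis unfolding computable1_iff .
qed

lemma comp_comp: "computable1 f \<Longrightarrow> computable1 g \<Longrightarrow> computable1 (\<lambda>e. f (g e))"
  unfolding computable1_iff by (rule recf_comp1)

lemma comp_Suc [comp_intro]: "computable1 f \<Longrightarrow> computable1 (\<lambda>e. Suc (f e))"
  unfolding computable1_iff by (rule recf_Suc)

lemma comp_pfst [comp_intro]: "computable1 f \<Longrightarrow> computable1 (\<lambda>e. pfst (f e))"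
  unfolding computable1_iff by (rule recf_pfst)

lemma comp_psnd [comp_intro]: "computable1 f \<Longrightarrow> computable1 (\<lambda>e. psnd (f e))"
  unfolding computable1_iff by (rule recf_psnd)

lemma comp_add [comp_intro]: "computable1 f \<Longrightarrow> computable1 g \<Longrightarrow> computable1 (\<lambda>e. f e + g e)"
  unfolding computable1_iff by (rule recf_add)

lemma comp_diff [comp_intro]: "computable1 f \<Longrightarrow> computable1 g \<Longrightarrow> computable1 (\<lambda>e. f e - g e)"
  unfolding computable1_iff by (rule recf_diff)

lemma comp_prod_encode [comp_intro]:
  "computable1 f \<Longrightarrow> computable1 g \<Longrightarrow> computable1 (\<lambda>e. prod_encode (f e, g e))"
  unfolding computable1_iff by (rule recf_prod_encode)

text \<open>The step function of three arguments is presented as a unary function of a nested pair,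
  with \<open>e\<close> carried along as a parameter. In this shape the introduction rules can prove
  computability by the syntax of a term alone.\<close>

lemma comp_rec [comp_intro]:
  assumes "computable1 f" and "computable1 (\<lambda>e. g (pfst e) (pfst (psnd e)) (psnd (psnd e)))"
    and "computable1 h"
  shows "computable1 (\<lambda>e. rec_nat (f e) (\<lambda>k r. g k r e) (h e))"
proof -
  have "recf (Suc 1) (\<lambda>xs. rec_nat ((\<lambda>ys. f (ys ! 0)) (tl xs))
     (\<lambda>k r. (\<lambda>ys. (\<lambda>e. g (pfst e) (pfst (psnd e)) (psnd (psnd e)))
         (prod_encode (ys ! 1, prod_encode (ys ! 0, ys ! 2)))) (r # k # tl xs)) (hd xs))"
    by (rule recf_rec[of 1 "\<lambda>ys. f (ys ! 0)" "\<lambda>ys. (\<lambda>e. g (pfst e) (pfst (psnd e)) (psnd (psnd e)))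
         (prod_encode (ys ! 1, prod_encode (ys ! 0, ys ! 2)))"],
        rule assms(1)[unfolded computable1_iff], rule recf_comp1[OF assms(2)[unfolded computable1_iff]])
      (intro recf_prod_encode recf_nth; simp)
  then have "recf 2 (\<lambda>xs. rec_nat (f (xs ! 1)) (\<lambda>k r. g k r (xs ! 1)) (xs ! 0))"
    unfolding numeral_2_eq_2 One_nat_def by (rule recf_cong) (auto simp: length_Suc_conv)
  from recf_comp2[of "\<lambda>x y. rec_nat (f y) (\<lambda>k r. g k r y) x", OF this
      assms(3)[unfolded computable1_iff] recf_nth[of 0 1]]
  show ?thesis unfolding computable1_iff by simp
qed

lemma comp_mult [comp_intro]:
  assumes "computable1 f" and "computable1 g"
  shows "computable1 (\<lambda>e. f e * g e)"
proof -
  have eq: "rec_nat 0 (\<lambda>k r. r + y) x = x * y" for x y :: nat by (induction x) auto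
  have "computable1 (\<lambda>e. rec_nat 0 (\<lambda>k r. r + g e) (f e))"
    by (intro comp_intro assms comp_comp[of g])
  then show ?thesis unfolding eq .
qed

section \<open>Decidable predicates, bounded quantifiers and search\<close>

definition dec :: "(nat \<Rightarrow> bool) \<Rightarrow> bool" where
  "dec P \<longleftrightarrow> computable1 (\<lambda>e. of_bool (P e))"

named_theorems dec_intro

lemma comp_of_bool: "dec P \<Longrightarrow> computable1 (\<lambda>e. of_bool (P e))"
  unfolding dec_def .

lemma comp_if [comp_intro]:
  assumes "dec P" and "computable1 f" and "computable1 g"
  shows "computable1 (\<lambda>e. if P e then f e else g e)"
proof -
  have "computable1 (\<lambda>e. of_bool (P e) * f e + (1 - of_bool (P e)) * g e)"
    by (intro comp_intro assms comp_of_bool)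
  moreover have "(\<lambda>e. of_bool (P e) * f e + (1 - of_bool (P e)) * g e) =
      (\<lambda>e. if P e then f e else g e)" by auto
  ultimately show ?thesis by simp
qed

lemma dec_const [dec_intro]: "dec (\<lambda>e. b)"
  unfolding dec_def by (rule comp_const)

lemma dec_not [dec_intro]: "dec P \<Longrightarrow> dec (\<lambda>e. \<not> P e)"
proof -
  assume "dec P"
  then have "computable1 (\<lambda>e. if P e then 0 else 1)" by (intro comp_intro)
  moreover have "(\<lambda>e. if P e then 0 else 1) = (\<lambda>e. of_bool (\<not> P e) :: nat)" by auto
  ultimately show ?thesis unfolding dec_def by simp
qed

lemma dec_conj [dec_intro]: "dec P \<Longrightarrow> dec Q \<Longrightarrow> dec (\<lambda>e. P e \<and> Q e)"
proof -
  assume "dec P" "dec Q"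
  then have "computable1 (\<lambda>e. of_bool (P e) * of_bool (Q e))" by (intro comp_intro comp_of_bool)
  then show ?thesis unfolding dec_def by (simp add: of_bool_conj)
qed

lemma dec_disj [dec_intro]: "dec P \<Longrightarrow> dec Q \<Longrightarrow> dec (\<lambda>e. P e \<or> Q e)"
  using dec_not[OF dec_conj[OF dec_not[of P] dec_not[of Q]]] by simp

lemma dec_imp [dec_intro]: "dec P \<Longrightarrow> dec Q \<Longrightarrow> dec (\<lambda>e. P e \<longrightarrow> Q e)"
  unfolding imp_conv_disj by (intro dec_intro)

lemma dec_iff [dec_intro]: "dec P \<Longrightarrow> dec Q \<Longrightarrow> dec (\<lambda>e. P e \<longleftrightarrow> Q e)"
proof -
  assume "dec P" "dec Q"
  then have "dec (\<lambda>e. (P e \<longrightarrow> Q e) \<and> (Q e \<longrightarrow> P e))" by (intro dec_intro)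
  moreover have "(\<lambda>e. (P e \<longrightarrow> Q e) \<and> (Q e \<longrightarrow> P e)) = (\<lambda>e. P e \<longleftrightarrow> Q e)" by auto
  ultimately show ?thesis by simp
qed

lemma dec_le [dec_intro]: "computable1 f \<Longrightarrow> computable1 g \<Longrightarrow> dec (\<lambda>e. f e \<le> g e)"
proof -
  assume "computable1 f" "computable1 g"
  then have "computable1 (\<lambda>e. 1 - (f e - g e))" by (intro comp_intro)
  moreover have "(\<lambda>e. 1 - (f e - g e)) = (\<lambda>e. of_bool (f e \<le> g e))" by auto
  ultimately show ?thesis unfolding dec_def by simp
qed

lemma dec_less [dec_intro]: "computable1 f \<Longrightarrow> computable1 g \<Longrightarrow> dec (\<lambda>e. f e < g e)"
  using dec_not[OF dec_le[of g f]] by (simp add: not_le)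

lemma dec_eq [dec_intro]: "computable1 f \<Longrightarrow> computable1 g \<Longrightarrow> dec (\<lambda>e. f e = g e)"
  using dec_conj[OF dec_le[of f g] dec_le[of g f]] by (simp add: eq_iff)

lemma dec_comp: "dec P \<Longrightarrow> computable1 g \<Longrightarrow> dec (\<lambda>e. P (g e))"
  unfolding dec_def by (rule comp_comp)

lemma dec_bex_less [dec_intro]:
  assumes "dec (\<lambda>e. P (pfst e) (psnd e))" and "computable1 h"
  shows "dec (\<lambda>e. \<exists>y<h e. P y e)"
proof -
  have eq: "rec_nat 0 (\<lambda>k r. if P k e then 1 else r) n = (of_bool (\<exists>y<n. P y e) :: nat)" for n e
    by (induction n) (auto simp: less_Suc_eq)
  \<comment> \<open>\<open>comp_rec\<close> passes the body a triple of counter, previous value and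
    parameter; this projection drops the previous value, which \<open>P\<close> does not
    see.\<close>
  have "computable1 (\<lambda>e. prod_encode (pfst e, psnd (psnd e)))" by (intro comp_intro)
  from dec_comp[OF assms(1) this]
  have "computable1 (\<lambda>e. rec_nat 0 (\<lambda>k r. if P k e then 1 else r) (h e))"
    by (intro comp_intro assms(2)) simp
  then show ?thesis unfolding eq dec_def .
qed

lemma dec_ball_less [dec_intro]:
  assumes "dec (\<lambda>e. P (pfst e) (psnd e))" and "computable1 h"
  shows "dec (\<lambda>e. \<forall>y<h e. P y e)"
  using dec_not[OF dec_bex_less[OF dec_not[OF assms(1)] assms(2)]] by simp

lemma dec_bex_le [dec_intro]:
  assumes "dec (\<lambda>e. P (pfst e) (psnd e))" and "computable1 h"
  shows "dec (\<lambda>e. \<exists>y\<le>h e. P y e)"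
  using dec_bex_less[OF assms(1) comp_Suc[OF assms(2)]] by (simp add: less_Suc_eq_le)

lemma dec_ball_le [dec_intro]:
  assumes "dec (\<lambda>e. P (pfst e) (psnd e))" and "computable1 h"
  shows "dec (\<lambda>e. \<forall>y\<le>h e. P y e)"
  using dec_ball_less[OF assms(1) comp_Suc[OF assms(2)]] by (simp add: less_Suc_eq_le)

lemma comp_Least:
  assumes "dec (\<lambda>e. P (pfst e) (psnd e))" and ex: "\<And>e. \<exists>y. P y e"
  shows "computable1 (\<lambda>e. LEAST y. P y e)"
proof -
  have 1: "recf 1 (\<lambda>xs. of_bool (\<not> P (pfst (xs ! 0)) (psnd (xs ! 0))))"
    using dec_not[OF assms(1)] unfolding dec_def computable1_iff .
  have "recf (Suc 1) (\<lambda>xs. of_bool (\<not> P (pfst (prod_encode (xs ! 0, xs ! 1)))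
       (psnd (prod_encode (xs ! 0, xs ! 1)))))"
    by (rule recf_comp1[OF 1]) (intro recf_prod_encode recf_nth; simp)
  then have "recf (Suc 1) (\<lambda>xs. of_bool (\<not> P (xs ! 0) (xs ! 1)))" by simp
  from recf_Least[OF this] have "recf 1 (\<lambda>xs. LEAST y. P y (xs ! 0))"
    using ex by simp
  then show ?thesis unfolding computable1_iff .
qed

text \<open>Finite tables are computable by hard-wiring their values. This is how the cells,
  dimensions and faces of a finite \<open>B\<close> enter the algorithms under an arbitrary
  injective numbering.\<close>

lemma comp_finite_support:
  assumes "finite A" and "\<And>x. x \<notin> A \<Longrightarrow> f x = 0"
  shows "computable1 f"
  using assms
proof (induction A arbitrary: f rule: finite_induct)
  case empty
  then have "f = (\<lambda>_. 0)" by auto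
  then show ?case using comp_const[of 0] by simp
next
  case (insert a A)
  have "computable1 (f(a := 0))" by (rule insert.IH) (use insert.prems in auto)
  then have "computable1 (\<lambda>e. if e = a then f a else (f(a := 0)) e)"
    by (intro comp_intro dec_intro)
  moreover have "(\<lambda>e. if e = a then f a else (f(a := 0)) e) = f" by auto
  ultimately show ?case by simp
qed

lemma dec_finite:
  assumes "finite A" shows "dec (\<lambda>e. e \<in> A)"
  unfolding dec_def by (rule comp_finite_support[OF assms]) auto

section \<open>Lists as numbers\<close>

definition ltl :: "nat \<Rightarrow> nat" where "ltl c = psnd (c - 1)"
definition lnth :: "nat \<Rightarrow> nat \<Rightarrow> nat" where "lnth c i = pfst ((ltl ^^ i) c - 1)"
definition llen :: "nat \<Rightarrow> nat" where "llen c = length (list_decode c)"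

text \<open>A nonempty list is coded as the successor of a pair, which explains the
  \<open>- 1\<close> in \<open>ltl\<close>. Since \<open>ltl\<close> fixes 0, the code of the empty
  list, iterating beyond the end is harmless.\<close>

lemma ltl_pow: "(ltl ^^ i) (list_encode xs) = list_encode (drop i xs)"
proof (induction i arbitrary: xs)
  case (Suc i)
  have "psnd 0 = 0" using psnd_encode[of 0 0] by (simp add: prod_encode_def)
  then have "ltl (list_encode xs) = list_encode (tl xs)"
    by (cases xs) (auto simp: ltl_def)
  then show ?case using Suc[of "tl xs"] by (simp add: funpow_Suc_right drop_Suc del: funpow.simps)
qed simp

lemma lnth_encode: "i < length xs \<Longrightarrow> lnth (list_encode xs) i = xs ! i"
  by (simp add: lnth_def ltl_pow Cons_nth_drop_Suc[symmetric])

lemma lnth_decode: "i < llen c \<Longrightarrow> lnth c i = list_decode c ! i"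
  using lnth_encode[of i "list_decode c"] by (simp add: llen_def)

lemma llen_encode [simp]: "llen (list_encode xs) = length xs"
  by (simp add: llen_def)

lemma comp_lnth [comp_intro]:
  assumes "computable1 f" and "computable1 g"
  shows "computable1 (\<lambda>e. lnth (f e) (g e))"
proof -
  have eq: "rec_nat c (\<lambda>k r. ltl r) i = (ltl ^^ i) c" for c i by (induction i) auto
  have "computable1 (\<lambda>e. pfst (rec_nat (f e) (\<lambda>k r. ltl r) (g e) - 1))"
    unfolding ltl_def by (intro comp_intro assms)
  then show ?thesis unfolding eq lnth_def .
qed

lemma comp_llen [comp_intro]:
  assumes "computable1 f" shows "computable1 (\<lambda>e. llen (f e))"
proof -
  have eq: "rec_nat c (\<lambda>k r. ltl r) i = (ltl ^^ i) c" for c i by (induction i) auto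
  \<comment> \<open>Only the empty list has code 0, so the length is the least number of tails that
    leads to 0 and can be found by minimisation.\<close>
  have zero: "(ltl ^^ n) c = 0 \<longleftrightarrow> llen c \<le> n" for c n
  proof -
    have "list_encode xs = 0 \<longleftrightarrow> xs = []" for xs by (cases xs) auto
    then show ?thesis using ltl_pow[of n "list_decode c"] by (simp add: llen_def)
  qed
  have "computable1 (\<lambda>c. LEAST n. rec_nat c (\<lambda>k r. ltl r) n = 0)"
  proof (rule comp_Least)
    show "dec (\<lambda>e. rec_nat (psnd e) (\<lambda>k. ltl) (pfst e) = 0)"
      unfolding ltl_def by (intro comp_intro dec_intro)
    show "\<exists>n. rec_nat c (\<lambda>k. ltl) n = 0" for c unfolding eq zero by blast
  qed
  moreover have "(LEAST n. rec_nat c (\<lambda>k r. ltl r) n = 0) = llen c" for c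
    unfolding eq zero by (rule Least_equality) auto
  ultimately have "computable1 llen" by simp
  from comp_comp[OF this assms] show ?thesis .
qed

lemma prod_encode_mono: "a \<le> a' \<Longrightarrow> b \<le> b' \<Longrightarrow> prod_encode (a, b) \<le> prod_encode (a', b')"
  unfolding prod_encode_def by (auto intro!: add_mono triangle_mono)

text \<open>A computable ceiling for the codes of all lists of bounded length with bounded entries.
  It turns quantifiers over paths, maps and complexes into bounded quantifiers over numbers.\<close>

definition lrep :: "nat \<Rightarrow> nat \<Rightarrow> nat" where "lrep n m = list_encode (replicate n m)"

lemma comp_lrep [comp_intro]:
  assumes "computable1 f" and "computable1 g"
  shows "computable1 (\<lambda>e. lrep (f e) (g e))"
proof -
  have eq: "rec_nat 0 (\<lambda>k r. Suc (prod_encode (m, r))) n = lrep n m" for m n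
    by (induction n) (auto simp: lrep_def)
  have "computable1 (\<lambda>e. rec_nat 0 (\<lambda>k r. Suc (prod_encode (g e, r))) (f e))"
    by (intro comp_intro assms comp_comp[OF assms(2)])
  then show ?thesis unfolding eq .
qed

lemma list_encode_le_lrep:
  "length xs \<le> n \<Longrightarrow> (\<And>x. x \<in> set xs \<Longrightarrow> x \<le> m) \<Longrightarrow> list_encode xs \<le> lrep n m"
proof (induction xs arbitrary: n)
  case (Cons x xs)
  then obtain k where k: "n = Suc k" "length xs \<le> k" by (cases n) auto
  have "list_encode xs \<le> lrep k m" using Cons k by auto
  then show ?case using Cons.prems(2)[of x] prod_encode_mono[of x m "list_encode xs" "lrep k m"]
    unfolding k(1) by (simp add: lrep_def)
qed simp

text \<open>Because of this, the code of an input can itself serve as the bound on the number and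
  the lengths of the words that it encodes.\<close>

lemma length_le_list_encode: "length xs \<le> list_encode xs"
proof (induction xs)
  case (Cons x xs)
  then show ?case using le_prod_encode_2[of "list_encode xs" x] by simp
qed simp

lemma elem_le_list_encode: "x \<in> set xs \<Longrightarrow> x \<le> list_encode xs"
proof (induction xs)
  case (Cons y xs)
  then show ?case using le_prod_encode_2[of "list_encode xs" y] le_prod_encode_1[of y "list_encode xs"]
    by auto
qed simp

section \<open>The inverse monoid as words up to congruence\<close>

lemma winv_append [simp]: "winv (u @ v) = winv v @ winv u"
  by (simp add: winv_def)

lemma winv_Nil [simp]: "winv [] = []"
  by (simp add: winv_def)

lemma winv_Cons [simp]: "winv (l # u) = winv u @ [linv l]"
  by (simp add: winv_def)

lemma linv_linv [simp]: "linv (linv l) = l"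
  by (cases l) auto

lemma winv_winv [simp]: "winv (winv u) = u"
  by (induction u) auto

lemma eqM_append: "eqM B u u' \<Longrightarrow> eqM B v v' \<Longrightarrow> eqM B (u @ v) (u' @ v')"
  using eqM.ctx[of B u u' "[]" v] eqM.ctx[of B v v' u' "[]"] eqM.trans by fastforce

lemma eqM_left: "eqM B v v' \<Longrightarrow> eqM B (u @ v) (u @ v')"
  by (rule eqM_append[OF eqM.refl])

lemma eqM_right: "eqM B u u' \<Longrightarrow> eqM B (u @ v) (u' @ v)"
  by (rule eqM_append[OF _ eqM.refl])

lemma eqM_trans [trans]: "eqM B u v \<Longrightarrow> eqM B v w \<Longrightarrow> eqM B u w"
  by (rule eqM.trans)

lemma idem_uu: "idempotentM B (u @ winv u)"
  unfolding idempotentM_def using eqM_right[OF eqM.vag1[of B u], of "winv u"] by simp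

lemma idem_uu': "idempotentM B (winv u @ u)"
  using idem_uu[of B "winv u"] by simp

text \<open>The Vagner relations commute only words of the form \<open>w @ winv w\<close>.
  Self-inverseness brings every idempotent into this form, and commutation of all idempotents
  follows.\<close>

lemma idem_eq_winv:
  assumes "idempotentM B e" shows "eqM B e (winv e)"
proof -
  let ?i = "winv e"
  have ee: "eqM B (e @ e) e" using assms unfolding idempotentM_def .
  \<comment> \<open>Commuting \<open>?i @ e\<close> with \<open>e @ ?i\<close> inside
    \<open>?i @ e @ e @ ?i\<close> gives that \<open>?i\<close> equals
    \<open>e @ ?i @ ?i @ e\<close>. The latter absorbs a further \<open>e\<close> on the left, so
    \<open>?i\<close> equals \<open>e @ ?i\<close>, and then \<open>?i @ ?i\<close> collapses by
    \<open>v\<close>.\<close>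
  have ii: "eqM B (?i @ ?i) ?i"
  proof -
    have v: "eqM B (?i @ e @ ?i) ?i" using eqM.vag1[of B ?i] by simp
    have "eqM B (?i @ e @ ?i) (?i @ (e @ e) @ ?i)"
      by (intro eqM_left eqM_right eqM.sym[OF ee])
    also have "eqM B \<dots> ((?i @ winv ?i) @ (e @ ?i))" by (simp add: eqM.refl)
    also have "eqM B \<dots> ((e @ ?i) @ (?i @ e))" using eqM.vag2[of B ?i e] by simp
    finally have 1: "eqM B ?i (e @ (?i @ ?i) @ e)" using eqM_trans[OF eqM.sym[OF v]] by simp
    have "eqM B (e @ (?i @ ?i) @ e) (e @ e @ (?i @ ?i) @ e)"
      using eqM_right[OF eqM.sym[OF ee], of "?i @ ?i @ e"] by simp
    then have 3: "eqM B ?i (e @ ?i)"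
      using eqM_trans[OF 1] eqM_left[OF eqM.sym[OF 1], of e] eqM_trans by fastforce
    have "eqM B (?i @ ?i) (?i @ (e @ ?i))" by (rule eqM_left[OF 3])
    also have "eqM B \<dots> ?i" by (rule v)
    finally show ?thesis .
  qed
  have v: "eqM B (e @ ?i @ e) e" by (rule eqM.vag1)
  have "eqM B e (e @ (?i @ ?i) @ e)"
    using eqM_trans[OF eqM.sym[OF v] eqM_left[OF eqM_right[OF eqM.sym[OF ii], of e], of e]] .
  also have "eqM B \<dots> ((e @ ?i) @ (?i @ winv ?i))" by (simp add: eqM.refl)
  also have "eqM B \<dots> ((?i @ winv ?i) @ (e @ ?i))" using eqM.vag2[of B e ?i] by simp
  also have "eqM B \<dots> (?i @ (e @ e) @ ?i)" by (simp add: eqM.refl)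
  also have "eqM B \<dots> (?i @ e @ ?i)" by (intro eqM_left eqM_right ee)
  also have "eqM B \<dots> ?i" using eqM.vag1[of B ?i] by simp
  finally show "eqM B e ?i" .
qed

lemma idem_eq_uu: "idempotentM B e \<Longrightarrow> eqM B e (e @ winv e)"
  using eqM_left[OF idem_eq_winv, of B e e] unfolding idempotentM_def
  by (blast intro: eqM.sym eqM.trans)

lemma idem_commute:
  assumes "idempotentM B e" "idempotentM B f"
  shows "eqM B (e @ f) (f @ e)"
proof -
  have e: "eqM B e (e @ winv e)" and f: "eqM B f (f @ winv f)"
    using assms by (auto intro: idem_eq_uu)
  have "eqM B (e @ f) ((e @ winv e) @ (f @ winv f))" by (rule eqM_append[OF e f])
  also have "eqM B \<dots> ((f @ winv f) @ (e @ winv e))" using eqM.vag2[of B e f] by simp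
  also have "eqM B \<dots> (f @ e)" by (rule eqM_append[OF eqM.sym[OF f] eqM.sym[OF e]])
  finally show ?thesis .
qed

lemma idem_append:
  assumes "idempotentM B e" "idempotentM B f" shows "idempotentM B (e @ f)"
proof -
  have "eqM B ((e @ f) @ (e @ f)) (e @ (f @ e) @ f)" by (simp add: eqM.refl)
  also have "eqM B \<dots> (e @ (e @ f) @ f)" by (intro eqM_left eqM_right idem_commute assms)
  also have "eqM B \<dots> ((e @ e) @ (f @ f))" by (simp add: eqM.refl)
  also have "eqM B \<dots> (e @ f)" using assms unfolding idempotentM_def by (rule eqM_append)
  finally show ?thesis unfolding idempotentM_def .
qed

text \<open>Commuting \<open>e\<close> with the idempotent \<open>winv a @ a\<close> is what lets
  \<open>e\<close> pass to the left of \<open>a\<close>, as a conjugate.\<close>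

lemma idem_conj:
  assumes e: "idempotentM B e" shows "idempotentM B (a @ e @ winv a)"
    and "eqM B (a @ e) ((a @ e @ winv a) @ a)"
proof -
  have c: "eqM B (e @ (winv a @ a)) ((winv a @ a) @ e)"
    by (rule idem_commute[OF e idem_uu'])
  have "eqM B (a @ e) ((a @ winv a @ a) @ e)"
    by (rule eqM_right[OF eqM.sym[OF eqM.vag1]])
  also have "eqM B \<dots> (a @ ((winv a @ a) @ e))" by (simp add: eqM.refl)
  also have "eqM B \<dots> (a @ (e @ (winv a @ a)))" by (rule eqM_left[OF eqM.sym[OF c]])
  finally show 1: "eqM B (a @ e) ((a @ e @ winv a) @ a)" by simp
  have "eqM B ((a @ e @ winv a) @ (a @ e @ winv a)) (((a @ e @ winv a) @ a) @ (e @ winv a))"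
    by (simp add: eqM.refl)
  also have "eqM B \<dots> ((a @ e) @ (e @ winv a))" by (rule eqM_right[OF eqM.sym[OF 1]])
  also have "eqM B \<dots> (a @ (e @ e) @ winv a)" by (simp add: eqM.refl)
  also have "eqM B \<dots> (a @ e @ winv a)"
    using e unfolding idempotentM_def by (intro eqM_left eqM_right)
  finally show "idempotentM B (a @ e @ winv a)" unfolding idempotentM_def .
qed

section \<open>The natural partial order\<close>

lemma idem_Nil: "idempotentM B []"
  by (simp add: idempotentM_def eqM.refl)

lemma leqM_of_eqM: "eqM B u v \<Longrightarrow> leqM B u v"
  unfolding leqM_def using idem_Nil by fastforce

lemma leqM_trans [trans]:
  assumes "leqM B a b" "leqM B b c" shows "leqM B a c"
proof -
  obtain e f where e: "idempotentM B e" "eqM B a (e @ b)"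
    and f: "idempotentM B f" "eqM B b (f @ c)"
    using assms unfolding leqM_def by blast
  have "eqM B a ((e @ f) @ c)" using eqM_trans[OF e(2) eqM_left[OF f(2)]] by simp
  then show ?thesis unfolding leqM_def using idem_append[OF e(1) f(1)] by blast
qed

text \<open>Conjugation carries the idempotent to the front of the word, where the definition of the
  order wants it. Deleting idempotents upward is the basic move in all later computations with
  cosets.\<close>

lemma leqM_delete:
  assumes "idempotentM B e" shows "leqM B (a @ e @ b) (a @ b)"
proof -
  have "eqM B (a @ e @ b) ((a @ e @ winv a) @ (a @ b))"
    using eqM_right[OF idem_conj(2)[OF assms, of a], of b] by simp
  then show ?thesis unfolding leqM_def using idem_conj(1)[OF assms] by blast
qed

lemma leqM_append:
  assumes "leqM B a b" "leqM B c d" shows "leqM B (a @ c) (b @ d)"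
proof -
  obtain e f where e: "idempotentM B e" "eqM B a (e @ b)"
    and f: "idempotentM B f" "eqM B c (f @ d)"
    using assms unfolding leqM_def by blast
  have "leqM B (a @ c) ([] @ e @ (b @ f @ d))"
    using leqM_of_eqM[OF eqM_append[OF e(2) f(2)]] by simp
  also have "leqM B \<dots> ([] @ b @ f @ d)" by (rule leqM_delete[OF e(1)])
  also have "leqM B \<dots> (b @ d)" using leqM_delete[OF f(1)] by simp
  finally show ?thesis .
qed

text \<open>Commutation of idempotents reduces both \<open>y\<close> and \<open>z\<close> to
  \<open>z @ x @ y\<close>.\<close>

lemma inverse_unique:
  assumes x1: "eqM B (x @ y @ x) x" and y: "eqM B (y @ x @ y) y"
    and x2: "eqM B (x @ z @ x) x" and z: "eqM B (z @ x @ z) z"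
  shows "eqM B y z"
proof -
  have "idempotentM B (x @ y)" "idempotentM B (y @ x)" "idempotentM B (x @ z)" "idempotentM B (z @ x)"
    using eqM_right[OF x1, of y] eqM_right[OF y, of x] eqM_right[OF x2, of z] eqM_right[OF z, of x]
    unfolding idempotentM_def by auto
  then have c1: "eqM B ((y @ x) @ (z @ x)) ((z @ x) @ (y @ x))"
    and c2: "eqM B ((x @ y) @ (x @ z)) ((x @ z) @ (x @ y))"
    using idem_commute by blast+
  have "eqM B y (y @ x @ y)" by (rule eqM.sym[OF y])
  also have "eqM B \<dots> (y @ (x @ z @ x) @ y)" by (intro eqM_left eqM_right eqM.sym[OF x2])
  also have "eqM B \<dots> (((y @ x) @ (z @ x)) @ y)" by (simp add: eqM.refl)
  also have "eqM B \<dots> (((z @ x) @ (y @ x)) @ y)" by (rule eqM_right[OF c1])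
  also have "eqM B \<dots> (z @ x @ (y @ x @ y))" by (simp add: eqM.refl)
  also have "eqM B \<dots> (z @ x @ y)" by (intro eqM_left y)
  finally have 1: "eqM B y (z @ x @ y)" .
  have "eqM B (z @ x @ y) ((z @ x @ z) @ x @ y)" by (rule eqM_right[OF eqM.sym[OF z]])
  also have "eqM B \<dots> (z @ ((x @ z) @ (x @ y)))" by (simp add: eqM.refl)
  also have "eqM B \<dots> (z @ ((x @ y) @ (x @ z)))" by (rule eqM_left[OF eqM.sym[OF c2]])
  also have "eqM B \<dots> (z @ (x @ y @ x) @ z)" by (simp add: eqM.refl)
  also have "eqM B \<dots> (z @ x @ z)" by (intro eqM_left eqM_right x1)
  also have "eqM B \<dots> z" by (rule z)
  finally show ?thesis by (rule eqM_trans[OF 1])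
qed

text \<open>The presentation has no closure rule for inversion. Compatibility follows from
  uniqueness of inverses: both \<open>winv u\<close> and \<open>winv v\<close> are inverses of
  \<open>u\<close>.\<close>

lemma eqM_winv: assumes "eqM B u v" shows "eqM B (winv u) (winv v)"
proof (rule inverse_unique[of B u])
  show "eqM B (u @ winv u @ u) u" "eqM B (winv u @ u @ winv u) (winv u)"
    using eqM.vag1[of B u] eqM.vag1[of B "winv u"] by auto
  have "eqM B (u @ winv v @ u) (v @ winv v @ v)" by (intro eqM_append assms eqM.refl)
  then show "eqM B (u @ winv v @ u) u" using eqM.vag1 eqM.sym[OF assms] eqM_trans by blast
  have "eqM B (winv v @ u @ winv v) (winv v @ v @ winv v)" by (intro eqM_append assms eqM.refl)
  then show "eqM B (winv v @ u @ winv v) (winv v)"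
    using eqM.vag1[of B "winv v"] by (auto intro: eqM_trans)
qed

lemma leqM_winv:
  assumes "leqM B a b" shows "leqM B (winv a) (winv b)"
proof -
  obtain e where e: "idempotentM B e" "eqM B a (e @ b)"
    using assms unfolding leqM_def by blast
  have "idempotentM B (winv e)"
    using e(1) eqM_winv[of B "e @ e" e] unfolding idempotentM_def by simp
  from leqM_delete[OF this, of "winv b" "[]"]
  have "leqM B (winv (e @ b)) (winv b)" by simp
  with leqM_of_eqM[OF eqM_winv[OF e(2)]] show ?thesis by (rule leqM_trans)
qed

text \<open>With u = e v and v = f u one has e u = u, and therefore u = e f u = f e u = f u =
  v.\<close>

lemma leqM_antisym:
  assumes "leqM B u v" "leqM B v u" shows "eqM B u v"
proof -
  obtain e f where e: "idempotentM B e" "eqM B u (e @ v)"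
    and f: "idempotentM B f" "eqM B v (f @ u)"
    using assms unfolding leqM_def by blast
  have "eqM B (f @ u) ((f @ f) @ u)"
    using f(1) unfolding idempotentM_def by (intro eqM_right eqM.sym[of B "f @ f"])
  then have fv: "eqM B v (f @ v)"
    using eqM_trans[OF f(2)] eqM_left[OF eqM.sym[OF f(2)], of f] eqM_trans by fastforce
  have "eqM B (e @ e @ v) (e @ v)"
    using eqM_right[of B "e @ e" e v] e(1) unfolding idempotentM_def by simp
  then have eu: "eqM B (e @ u) u"
    using eqM_trans[OF eqM_left[OF e(2), of e]] eqM.sym[OF e(2)] eqM_trans by blast
  have "eqM B u (e @ f @ u)" using eqM_trans[OF e(2) eqM_left[OF f(2)]] .
  also have "eqM B \<dots> ((f @ e) @ u)"
    using eqM_right[OF idem_commute[OF e(1) f(1)], of u] by simp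
  also have "eqM B \<dots> (f @ u)" using eqM_left[OF eu, of f] by simp
  also have "eqM B \<dots> v" by (rule eqM.sym[OF f(2)])
  finally show ?thesis .
qed

text \<open>Saturation under \<^const>\<open>eqM\<close> is the special case \<open>e = []\<close> of upward closure.\<close>

locale closed_submonoid =
  fixes B :: "'a dcx" and H :: "'a letter list set"
  assumes one: "[] \<in> H"
    and mult: "u \<in> H \<Longrightarrow> v \<in> H \<Longrightarrow> u @ v \<in> H"
    and inverse: "u \<in> H \<Longrightarrow> winv u \<in> H"
    and up: "u \<in> H \<Longrightarrow> leqM B u v \<Longrightarrow> v \<in> H"
begin

lemma subst: "a @ u @ b \<in> H \<Longrightarrow> eqM B u v \<Longrightarrow> a @ v @ b \<in> H"
  using up leqM_of_eqM eqM.ctx by blast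

lemma delete: "a @ e @ b \<in> H \<Longrightarrow> idempotentM B e \<Longrightarrow> a @ b \<in> H"
  using up leqM_delete by blast

end

lemma closed_submonoid_omega: "closed_submonoid B (omega_closure B (gen_sub B ws))"
proof
  show "[] \<in> omega_closure B (gen_sub B ws)"
    unfolding omega_closure_def using gen_sub.one leqM_of_eqM[OF eqM.refl] by blast
  show "u @ v \<in> omega_closure B (gen_sub B ws)"
    if "u \<in> omega_closure B (gen_sub B ws)" "v \<in> omega_closure B (gen_sub B ws)" for u v
    using that unfolding omega_closure_def by (blast intro: gen_sub.mult leqM_append)
  show "winv u \<in> omega_closure B (gen_sub B ws)"
    if "u \<in> omega_closure B (gen_sub B ws)" for u
    using that unfolding omega_closure_def by (blast intro: gen_sub.inv leqM_winv)
  show "v \<in> omega_closure B (gen_sub B ws)"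
    if "u \<in> omega_closure B (gen_sub B ws)" "leqM B u v" for u v
    using that unfolding omega_closure_def by (blast intro: leqM_trans)
qed

lemma generator_in_omega: "w \<in> set ws \<Longrightarrow> w \<in> omega_closure B (gen_sub B ws)"
  unfolding omega_closure_def using gen_sub.gen leqM_of_eqM[OF eqM.refl] by blast

text \<open>Up to \<open>eqM\<close> this submonoid contains only the identity and the idempotent
  itself, and an idempotent lies below the identity.\<close>

lemma gen_sub_idempotent_ge:
  assumes "n \<in> gen_sub B [u @ winv u]" shows "leqM B (u @ winv u) n"
  using assms
proof (induction rule: gen_sub.induct)
  case one
  show ?case using leqM_delete[OF idem_uu, of B "[]" u "[]"] by simp
next
  case (gen w)
  then show ?case by (auto intro: leqM_of_eqM eqM.refl)
next
  case (inv n)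
  show ?case using leqM_winv[OF inv.IH] by simp
next
  case (mult n m)
  have "leqM B (u @ winv u) ((u @ winv u) @ (u @ winv u))"
    using idem_uu[of B u] unfolding idempotentM_def by (intro leqM_of_eqM eqM.sym[of B "(u @ winv u) @ u @ winv u"])
  then show ?case using leqM_append[OF mult.IH] by (rule leqM_trans)
next
  case (sat n m)
  then show ?case using leqM_of_eqM leqM_trans by blast
qed

text \<open>Multiply \<open>u @ winv u\<close> below \<open>v @ winv u\<close> by \<open>u\<close>
  on the right: the left side returns to \<open>u\<close>, and on the right side the idempotent
  \<open>winv u @ u\<close> can be deleted. Thus the order becomes a membership question about a
  closed submonoid with one generator, which a coset complex can answer.\<close>

lemma leqM_if_omega:
  assumes "v @ winv u \<in> omega_closure B (gen_sub B [u @ winv u])"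
  shows "leqM B u v"
proof -
  have "leqM B (u @ winv u) (v @ winv u)"
    using assms gen_sub_idempotent_ge leqM_trans unfolding omega_closure_def by blast
  then have "leqM B ((u @ winv u) @ u) ((v @ winv u) @ u)"
    by (rule leqM_append) (rule leqM_of_eqM[OF eqM.refl])
  moreover have "leqM B u ((u @ winv u) @ u)"
    using leqM_of_eqM[OF eqM.sym[OF eqM.vag1[of B u]]] by simp
  moreover have "leqM B ((v @ winv u) @ u) v"
    using leqM_delete[OF idem_uu'[of B u], of v "[]"] by simp
  ultimately show ?thesis by (blast intro: leqM_trans)
qed

section \<open>Actions on labeled complexes\<close>

lemma face_cell:
  assumes "delta_complex D" "c \<in> cells D" "0 < cdim D c" "i \<le> cdim D c"
  shows "cface D i c \<in> cells D" "cdim D (cface D i c) = cdim D c - 1"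
  using assms unfolding delta_complex_def by auto

lemma face_face:
  assumes "delta_complex D" "c \<in> cells D" "2 \<le> cdim D c" "i < j" "j \<le> cdim D c"
  shows "cface D i (cface D j c) = cface D (j - 1) (cface D i c)"
  using assms unfolding delta_complex_def by auto

lemma root_rec: "root D c = (if cdim D c = 0 then c else vtx D (cdim D c - 1) (cface D (cdim D c) c) 0)"
  unfolding root_def vertex_def by (cases "cdim D c") auto

lemma root_last_face:
  assumes "delta_complex D" "c \<in> cells D" "0 < cdim D c"
  shows "root D (cface D (cdim D c) c) = root D c"
  using assms face_cell(2)[OF assms, of "cdim D c"] by (simp add: root_rec[of D c]) (simp add: root_def vertex_def)

text \<open>\<open>root\<close> descends along last faces only. For any other face with
  \<open>1 \<le> i\<close>, the simplicial identity exchanges it with the last face, which reduces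
  the claim to a cell of lower dimension.\<close>

lemma root_face:
  assumes "delta_complex D" "c \<in> cells D" "1 \<le> i" "i \<le> cdim D c"
  shows "root D (cface D i c) = root D c"
  using assms
proof (induction "cdim D c" arbitrary: c i)
  case (Suc n)
  note D = Suc.prems(1)
  have k: "cdim D c = Suc n" using Suc.hyps by simp
  show ?case
  proof (cases "i = Suc n")
    case True
    then show ?thesis using root_last_face[OF D, of c] Suc.prems k by simp
  next
    case False
    then have n: "i \<le> n" "1 \<le> n" using Suc.prems k by auto
    have ci: "cface D i c \<in> cells D" "cdim D (cface D i c) = n"
      using face_cell[OF D Suc.prems(2), of i] Suc.prems k by auto
    have cn: "cface D (Suc n) c \<in> cells D" "cdim D (cface D (Suc n) c) = n"
      using face_cell[OF D Suc.prems(2), of "Suc n"] Suc.prems k by auto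
    have "root D (cface D i c) = root D (cface D n (cface D i c))"
      using root_last_face[OF D ci(1)] ci n by simp
    also have "\<dots> = root D (cface D i (cface D (Suc n) c))"
      using face_face[OF D Suc.prems(2), of i "Suc n"] n k by simp
    also have "\<dots> = root D (cface D (Suc n) c)"
      using Suc.hyps(1)[of "cface D (Suc n) c" i] cn n Suc.prems by simp
    also have "\<dots> = root D c" using root_last_face[OF D, of c] Suc.prems k by simp
    finally show ?thesis .
  qed
qed auto

lemma root_zcell:
  assumes "delta_complex D" "c \<in> cells D" shows "root D c \<in> zcells D"
  using assms
proof (induction "cdim D c" arbitrary: c)
  case 0
  then show ?case by (simp add: root_rec zcells_def)
next
  case (Suc n)
  then show ?case using root_last_face[of D c] face_cell[of D c "cdim D c"] by (metis diff_Suc_1 le_refl zero_less_Suc)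
qed

lemma ecell_last_face:
  assumes "delta_complex D" "c \<in> cells D" "2 \<le> cdim D c"
  shows "ecell D (cface D (cdim D c) c) = ecell D c"
proof -
  obtain n where "cdim D c = Suc (Suc n)" using assms(3) by (metis Suc_le_D Suc_le_mono numeral_2_eq_2)
  then show ?thesis using face_cell(2)[OF assms(1,2), of "cdim D c"] by (simp add: ecell_def)
qed

lemma ecell_face:
  assumes "delta_complex D" "c \<in> cells D" "2 \<le> i" "i \<le> cdim D c"
  shows "ecell D (cface D i c) = ecell D c"
  using assms
proof (induction "cdim D c" arbitrary: c i)
  case (Suc n)
  note D = Suc.prems(1)
  have k: "cdim D c = Suc n" using Suc.hyps by simp
  show ?case
  proof (cases "i = Suc n")
    case True
    then show ?thesis using ecell_last_face[OF D, of c] Suc.prems k by simp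
  next
    case False
    then have n: "i \<le> n" "2 \<le> n" using Suc.prems k by auto
    have ci: "cface D i c \<in> cells D" "cdim D (cface D i c) = n"
      using face_cell[OF D Suc.prems(2), of i] Suc.prems k by auto
    have cn: "cface D (Suc n) c \<in> cells D" "cdim D (cface D (Suc n) c) = n"
      using face_cell[OF D Suc.prems(2), of "Suc n"] Suc.prems k by auto
    have "ecell D (cface D i c) = ecell D (cface D n (cface D i c))"
      using ecell_last_face[OF D ci(1)] ci n by simp
    also have "\<dots> = ecell D (cface D i (cface D (Suc n) c))"
      using face_face[OF D Suc.prems(2), of i "Suc n"] n k by simp
    also have "\<dots> = ecell D (cface D (Suc n) c)"
      using Suc.hyps(1)[of "cface D (Suc n) c" i] cn n Suc.prems by simp
    also have "\<dots> = ecell D c" using ecell_last_face[OF D, of c] Suc.prems k n by simp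
    finally show ?thesis .
  qed
qed auto

lemma ecell_dim1: "cdim D c = 1 \<Longrightarrow> ecell D c = c"
  by (simp add: ecell_def)

lemma root_dim1: "cdim D c = 1 \<Longrightarrow> root D c = cface D 1 c"
  by (simp add: root_rec)

lemma root_dim0: "cdim D c = 0 \<Longrightarrow> root D c = c"
  by (simp add: root_rec)

text \<open>The edge [v_0,v_1] survives the omission of the last vertex of a cell of dimension at
  least 2, so induction descends along last faces. Its end v_1 is the first vertex of the face
  omitting v_0, and that root is also kept when a last vertex is dropped.\<close>

lemma ecell_props:
  assumes "delta_complex D" "c \<in> cells D" "1 \<le> cdim D c"
  shows "ecell D c \<in> cells D" "cdim D (ecell D c) = 1"
    "cface D 1 (ecell D c) = root D c" "cface D 0 (ecell D c) = root D (cface D 0 c)"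
proof -
  have "ecell D c \<in> cells D \<and> cdim D (ecell D c) = 1 \<and> cface D 1 (ecell D c) = root D c
     \<and> cface D 0 (ecell D c) = root D (cface D 0 c)"
    using assms
  proof (induction "cdim D c" arbitrary: c)
    case (Suc n)
    note D = Suc.prems(1)
    have k: "cdim D c = Suc n" using Suc.hyps by simp
    show ?case
    proof (cases "n = 0")
      case True
      have "cdim D (cface D 0 c) = 0" using face_cell[OF D Suc.prems(2), of 0] k True by simp
      then show ?thesis using True k Suc.prems by (simp add: ecell_dim1 root_dim1 root_dim0)
    next
      case False
      have cn: "cface D (Suc n) c \<in> cells D" "cdim D (cface D (Suc n) c) = n"
        using face_cell[OF D Suc.prems(2), of "Suc n"] k by auto
      have c0: "cface D 0 c \<in> cells D" "cdim D (cface D 0 c) = n"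
        using face_cell[OF D Suc.prems(2), of 0] k by auto
      have "cface D 0 (cface D (Suc n) c) = cface D n (cface D 0 c)"
        using face_face[OF D Suc.prems(2), of 0 "Suc n"] False k by simp
      moreover have "root D (cface D n (cface D 0 c)) = root D (cface D 0 c)"
        using root_last_face[OF D c0(1)] c0 False by simp
      ultimately show ?thesis
        using Suc.hyps(1)[of "cface D (Suc n) c"] cn False D ecell_last_face[OF D Suc.prems(2)]
          root_last_face[OF D Suc.prems(2)] k by simp
    qed
  qed auto
  then show "ecell D c \<in> cells D" "cdim D (ecell D c) = 1"
    "cface D 1 (ecell D c) = root D c" "cface D 0 (ecell D c) = root D (cface D 0 c)" by auto
qed

text \<open>In contrast to \<^const>\<open>allowed\<close>, letters \<open>\<rho>\<^sup>-\<^sup>1\<close> with \<open>\<rho> \<in> P\<close> are admitted, so that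
  \<^const>\<open>winv\<close> preserves the property.\<close>

definition good :: "'a dcx \<Rightarrow> 'a letter list \<Rightarrow> bool" where
  "good B w \<longleftrightarrow> (\<forall>l\<in>set w. case l of Gen a \<Rightarrow> a \<in> Xs B \<union> Ps B | InvGen a \<Rightarrow> a \<in> Xs B \<union> Ps B)"

lemma good_Nil [simp]: "good B []"
  and good_append [simp]: "good B (u @ v) \<longleftrightarrow> good B u \<and> good B v"
  and good_Cons: "good B (l # v) \<longleftrightarrow> good B [l] \<and> good B v"
  and good_Gen [simp]: "good B [Gen a] \<longleftrightarrow> a \<in> Xs B \<union> Ps B"
  and good_InvGen [simp]: "good B [InvGen a] \<longleftrightarrow> a \<in> Xs B \<union> Ps B"
  by (auto simp: good_def)

lemma good_linv [simp]: "good B [linv l] \<longleftrightarrow> good B [l]"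
  by (cases l) auto

lemma good_winv [simp]: "good B (winv u) \<longleftrightarrow> good B u"
proof (induction u)
  case (Cons l u)
  then show ?case using good_Cons[of B l u] by auto
qed simp

lemma allowed_good: "allowed B w \<Longrightarrow> good B w"
  unfolding allowed_def good_def by (auto split: letter.splits)

section \<open>The action on the 0-cells of a labeled complex\<close>

locale labeled_complex =
  fixes B :: "'a dcx" and C :: "'c dcx" and lab :: "'c \<Rightarrow> 'a"
  assumes lc: "labeled B C lab"
begin

lemma delta: "delta_complex C"
  using lc unfolding labeled_def by simp

lemma lab_cell: "c \<in> cells C \<Longrightarrow> lab c \<in> cells B"
  and lab_dim: "c \<in> cells C \<Longrightarrow> cdim B (lab c) = cdim C c"
  and lab_face: "c \<in> cells C \<Longrightarrow> 0 < cdim C c \<Longrightarrow> i \<le> cdim C c \<Longrightarrow>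
     lab (cface C i c) = cface B i (lab c)"
  using lc unfolding labeled_def by auto

lemma local_inj:
  "c \<in> cells C \<Longrightarrow> d \<in> cells C \<Longrightarrow> lab c = lab d \<Longrightarrow> j \<le> cdim C c \<Longrightarrow>
     vertex C c j = vertex C d j \<Longrightarrow> c = d"
  using lc lab_dim[of c] lab_dim[of d] unfolding labeled_def by metis

lemma root_inj: "c \<in> cells C \<Longrightarrow> d \<in> cells C \<Longrightarrow> lab c = lab d \<Longrightarrow> root C c = root C d \<Longrightarrow> c = d"
  using local_inj[of c d 0] unfolding root_def by simp

lemma end_inj:
  assumes "c \<in> cells C" "d \<in> cells C" "lab c = lab d" "cdim C c = 1" "cface C 0 c = cface C 0 d"
  shows "c = d"
proof (rule local_inj[of c d 1])
  have "cdim C d = 1" using lab_dim[OF assms(1)] lab_dim[OF assms(2)] assms by simp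
  then show "vertex C c 1 = vertex C d 1" using assms by (simp add: vertex_def)
qed (use assms in auto)

lemma lab_ecell:
  assumes "c \<in> cells C" "1 \<le> cdim C c" shows "lab (ecell C c) = ecell B (lab c)"
  using assms
proof (induction "cdim C c" arbitrary: c)
  case (Suc n)
  have k: "cdim C c = Suc n" using Suc.hyps by simp
  show ?case
  proof (cases "n = 0")
    case True
    then show ?thesis using k lab_dim[OF Suc.prems(1)] by (simp add: ecell_dim1)
  next
    case False
    then obtain m where m: "n = Suc m" by (cases n) auto
    have cn: "cface C (Suc n) c \<in> cells C" "cdim C (cface C (Suc n) c) = n"
      using face_cell[OF delta Suc.prems(1), of "Suc n"] k by auto
    have "ecell C c = ecell C (cface C (Suc n) c)"
      using ecell_last_face[OF delta Suc.prems(1)] k False by simp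
    then have "lab (ecell C c) = ecell B (lab (cface C (Suc n) c))"
      using Suc.hyps(1)[of "cface C (Suc n) c"] cn False by simp
    also have "\<dots> = ecell B (cface B (Suc n) (lab c))"
      using lab_face[OF Suc.prems(1)] k by simp
    also have "\<dots> = ecell B (lab c)"
      using lab_dim[OF Suc.prems(1)] lab_dim[OF cn(1)] lab_face[OF Suc.prems(1), of "Suc n"] cn k m
      by (simp add: ecell_def)
    finally show ?thesis .
  qed
qed auto

lemma step_linv: "step C lab v (linv l) w \<longleftrightarrow> step C lab w l v"
  by (cases l) (auto simp: step_def)

lemma step_Gen_cases:
  assumes "step C lab v (Gen a) w"
  obtains (edge) e where "e \<in> cells C" "cdim C e = 1" "lab e = a" "cface C 1 e = v" "cface C 0 e = w"
    | (cell) c where "c \<in> cells C" "2 \<le> cdim C c" "lab c = a" "root C c = v" "w = v"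
  using assms by (auto simp: step_def)

lemma step_cells:
  assumes "step C lab v l w" shows "v \<in> zcells C" "w \<in> zcells C"
proof -
  have 1: "v \<in> zcells C \<and> w \<in> zcells C" if "step C lab v (Gen a) w" for v a w
    using that
  proof (cases rule: step_Gen_cases)
    case (edge e)
    then show ?thesis using face_cell[OF delta, of e 0] face_cell[OF delta, of e 1] by (auto simp: zcells_def)
  next
    case (cell c)
    then show ?thesis using root_zcell[OF delta] by auto
  qed
  have "v \<in> zcells C \<and> w \<in> zcells C"
  proof (cases l)
    case (Gen a)
    then show ?thesis using assms 1 by simp
  next
    case (InvGen a)
    then show ?thesis using assms 1[of w a v] step_linv[of v "Gen a" w] by simp
  qed
  then show "v \<in> zcells C" "w \<in> zcells C" by auto
qed

text \<open>Two edges with the same label and start coincide by local injectivity. An edge and a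
  cell of higher dimension never compete, because the label determines the dimension.\<close>

lemma step_det_Gen:
  assumes 1: "step C lab v (Gen a) w" and 2: "step C lab v (Gen a) w'" shows "w = w'"
  using 1
proof (cases rule: step_Gen_cases)
  case e: (edge e)
  from 2 show ?thesis
  proof (cases rule: step_Gen_cases)
    case (edge e')
    then have "e = e'" using root_inj[of e e'] e by (metis root_dim1)
    then show ?thesis using e edge by metis
  next
    case (cell c)
    then show ?thesis using e lab_dim[of e] lab_dim[of c] by simp
  qed
next
  case c: (cell c)
  from 2 show ?thesis
  proof (cases rule: step_Gen_cases)
    case (edge e)
    then show ?thesis using c lab_dim[of e] lab_dim[of c] by simp
  qed (use c in simp)
qed

lemma step_inj_Gen:
  assumes 1: "step C lab v (Gen a) w" and 2: "step C lab v' (Gen a) w" shows "v = v'"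
  using 1
proof (cases rule: step_Gen_cases)
  case e: (edge e)
  from 2 show ?thesis
  proof (cases rule: step_Gen_cases)
    case (edge e')
    then have "e = e'" using end_inj[of e e'] e by metis
    then show ?thesis using e edge by metis
  next
    case (cell c)
    then show ?thesis using e lab_dim[of e] lab_dim[of c] by simp
  qed
next
  case c: (cell c)
  from 2 show ?thesis
  proof (cases rule: step_Gen_cases)
    case (edge e)
    then show ?thesis using c lab_dim[of e] lab_dim[of c] by simp
  qed (use c in simp)
qed

lemma step_det: "step C lab v l w \<Longrightarrow> step C lab v l w' \<Longrightarrow> w = w'"
proof (cases l)
  case (InvGen a)
  assume "step C lab v l w" "step C lab v l w'"
  then show ?thesis using step_inj_Gen[of w a v w'] step_linv[of v "Gen a"] InvGen by simp
qed (use step_det_Gen in blast)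

lemma acts_cells: "acts C lab v u w \<Longrightarrow> v \<in> zcells C \<and> w \<in> zcells C"
  by (induction rule: acts.induct) (auto dest: step_cells)

lemma acts_Nil [simp]: "acts C lab v [] w \<longleftrightarrow> v = w \<and> v \<in> zcells C"
  by (auto intro: acts.nil elim: acts.cases)

lemma acts_Cons: "acts C lab v (l # u) w \<longleftrightarrow> (\<exists>x. step C lab v l x \<and> acts C lab x u w)"
  by (auto intro: acts.cons elim: acts.cases)

lemma acts_single [simp]: "acts C lab v [l] w \<longleftrightarrow> step C lab v l w"
  by (auto simp: acts_Cons dest: step_cells)

lemma acts_append: "acts C lab v (p @ q) w \<longleftrightarrow> (\<exists>x. acts C lab v p x \<and> acts C lab x q w)"
  by (induction p arbitrary: v) (auto simp: acts_Cons dest: acts_cells)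

lemma acts_winv: "acts C lab v (winv u) w \<longleftrightarrow> acts C lab w u v"
  by (induction u arbitrary: v w) (auto simp: acts_Cons acts_append step_linv dest: step_cells)

lemma acts_det: "acts C lab v u w \<Longrightarrow> acts C lab v u w' \<Longrightarrow> w = w'"
  by (induction u arbitrary: v) (auto simp: acts_Cons dest: step_det)

lemma acts_inj: "acts C lab v u w \<Longrightarrow> acts C lab v' u w \<Longrightarrow> v = v'"
  using acts_det[of w "winv u" v v'] by (simp add: acts_winv)

text \<open>\<open>u @ winv u\<close> acts as the identity on the domain of \<open>u\<close>. In
  this form both Vagner relations become trivial for the action.\<close>

lemma acts_uu_append:
  "acts C lab v (u @ winv u @ q) w \<longleftrightarrow> (\<exists>x. acts C lab v u x) \<and> acts C lab v q w"
  unfolding acts_append acts_winv using acts_inj by blast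

lemma acts_uu: "acts C lab v (u @ winv u) w \<longleftrightarrow> (\<exists>x. acts C lab v u x) \<and> v = w"
  using acts_uu_append[of v u "[]" w] acts_cells by auto

lemma acts_good: "acts C lab v u w \<Longrightarrow> good B u"
proof (induction rule: acts.induct)
  case (cons v l w u)
  have "good B [l]" using cons.hyps(1) lab_dim lab_cell
    by (cases l) (force simp: step_def Xs_def Ps_def)+
  then show ?case using cons.IH by (subst good_Cons) simp
qed simp

lemma step_edge:
  assumes "e \<in> cells C" "cdim C e = 1"
  shows "step C lab (cface C 1 e) (Gen (lab e)) (cface C 0 e)"
    "step C lab (cface C 0 e) (InvGen (lab e)) (cface C 1 e)"
  using assms by (auto simp: step_def)

lemma step_root:
  "c \<in> cells C \<Longrightarrow> 2 \<le> cdim C c \<Longrightarrow> step C lab (root C c) (Gen (lab c)) (root C c)"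
  by (auto simp: step_def)

lemma acts_loops: "v \<in> zcells C \<Longrightarrow> (\<And>l. l \<in> set u \<Longrightarrow> step C lab v l v) \<Longrightarrow> acts C lab v u v"
  by (induction u) (auto simp: acts_Cons)

text \<open>In dimension 2 the word runs once around the triangle. In higher dimension the faces
  omitting v_i with i at least 1 share the root and act there as loops, after which the word walks
  along [v_0,v_1], reads the remaining face at its own root v_1, and walks back.\<close>

lemma acts_bl:
  assumes c: "c \<in> cells C" "2 \<le> cdim C c"
  shows "acts C lab (root C c) (bl B (lab c)) (root C c)"
proof -
  have dim: "cdim B (lab c) = cdim C c" using lab_dim c by simp
  have f: "cface C i c \<in> cells C" "cdim C (cface C i c) = cdim C c - 1"
    "lab (cface C i c) = cface B i (lab c)" if "i \<le> cdim C c" for i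
    using face_cell[OF delta c(1), of i] lab_face[OF c(1), of i] c that by auto
  show ?thesis
  proof (cases "cdim C c = 2")
    case True
    have f1: "cdim C (cface C i c) = 1" if "i \<le> 2" for i using f(2) True that by simp
    have r: "root C c = cface C 1 (cface C 2 c)"
      using root_last_face[OF delta c(1)] f1[of 2] True by (simp add: root_dim1)
    have "cface C 0 (cface C 2 c) = cface C 1 (cface C 0 c)"
      "cface C 0 (cface C 1 c) = cface C 0 (cface C 0 c)"
      "cface C 1 (cface C 2 c) = cface C 1 (cface C 1 c)"
      using face_face[OF delta c, of 0 2] face_face[OF delta c, of 0 1] face_face[OF delta c, of 1 2] True by auto
    then show ?thesis
      using step_edge(1)[of "cface C 2 c"] step_edge(1)[of "cface C 0 c"] step_edge(2)[of "cface C 1 c"]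
        f(1)[of 2] f(1)[of 0] f(1)[of 1] f1[of 2] f1[of 0] f1[of 1] True dim r
        f(3)[of 2] f(3)[of 0] f(3)[of 1]
      by (auto simp: bl_def acts_Cons intro!: exI root_zcell[OF delta c(1)] dest: step_cells)
  next
    case False
    then have k: "3 \<le> cdim C c" using c by simp
    define e where "e = ecell C c"
    have e: "e \<in> cells C" "cdim C e = 1" "cface C 1 e = root C c" "cface C 0 e = root C (cface C 0 c)"
      "lab e = ecell B (lab c)"
      using ecell_props[OF delta c(1)] lab_ecell[OF c(1)] c unfolding e_def by auto
    have "acts C lab (root C c) (map (\<lambda>i. Gen (cface B i (lab c))) (rev [1..<Suc (cdim B (lab c))])) (root C c)"
    proof (rule acts_loops)
      show "root C c \<in> zcells C" by (rule root_zcell[OF delta c(1)])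
      fix l assume "l \<in> set (map (\<lambda>i. Gen (cface B i (lab c))) (rev [1..<Suc (cdim B (lab c))]))"
      then obtain i where i: "1 \<le> i" "i \<le> cdim C c" and l: "l = Gen (cface B i (lab c))"
        using dim by auto
      show "step C lab (root C c) l (root C c)"
        using step_root[of "cface C i c"] f[OF i(2)] root_face[OF delta c(1) i] k l by simp
    qed
    moreover have "acts C lab (root C c) [Gen (ecell B (lab c)), Gen (cface B 0 (lab c)), InvGen (ecell B (lab c))] (root C c)"
      using step_edge[OF e(1,2)] step_root[of "cface C 0 c"] f[of 0] k e
      by (auto simp: acts_Cons intro!: exI root_zcell[OF delta c(1)] dest: step_cells)
    ultimately show ?thesis using False dim by (auto simp: bl_def acts_append)
  qed
qed

lemma Ps_step: "\<rho> \<in> Ps B \<Longrightarrow> step C lab v (Gen \<rho>) w \<Longrightarrow> v = w"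
  using lab_dim by (force simp: step_def Ps_def)

text \<open>The action factors through M(X,P): the Vagner relations hold for partial injections, and
  the defining relations hold because cells in \<open>Ps B\<close> act as partial identities and
  their boundary labels are loops at the root.\<close>

lemma acts_eqM: "eqM B u v \<Longrightarrow> acts C lab a u b \<longleftrightarrow> acts C lab a v b"
proof (induction arbitrary: a b rule: eqM.induct)
  case (ctx u v p q)
  then show ?case by (simp add: acts_append)
next
  case (vag1 w)
  show ?case unfolding acts_uu_append by blast
next
  case (vag2 w z)
  show ?case unfolding acts_uu_append acts_uu by blast
next
  case (idem \<rho>)
  then show ?case using Ps_step[OF idem] by (auto simp: acts_Cons dest: step_cells)
next
  case (brel \<rho>)
  \<comment> \<open>A step labeled \<open>\<rho>\<close> at \<open>v\<close> comes from a cell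
    rooted at \<open>v\<close>, so appending \<open>bl B \<rho>\<close> changes neither the domain
    nor the value.\<close>
  have "acts C lab v (bl B \<rho>) v" if "step C lab v (Gen \<rho>) v" for v
    using that brel acts_bl lab_dim by (force simp: step_def Ps_def)
  then show ?case using Ps_step[OF brel] acts_det by (auto simp: acts_Cons dest: acts_cells) metis+
qed auto

text \<open>An idempotent moving \<open>v\<close> to \<open>w\<close> must fix \<open>w\<close>, and
  injectivity then identifies \<open>v\<close> with \<open>w\<close>.\<close>

lemma acts_idempotent: "idempotentM B e \<Longrightarrow> acts C lab v e w \<Longrightarrow> v = w"
proof -
  assume e: "idempotentM B e" and vw: "acts C lab v e w"
  then have "acts C lab v (e @ e) w" using acts_eqM[of "e @ e" e] unfolding idempotentM_def by simp
  then obtain x where "acts C lab v e x" "acts C lab x e w" by (auto simp: acts_append)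
  then show "v = w" using vw acts_det acts_inj by blast
qed

lemma acts_leqM: "leqM B u v \<Longrightarrow> acts C lab a u b \<Longrightarrow> acts C lab a v b"
proof -
  assume "leqM B u v" and ab: "acts C lab a u b"
  then obtain e where e: "idempotentM B e" "eqM B u (e @ v)" unfolding leqM_def by blast
  then have "acts C lab a (e @ v) b" using acts_eqM ab by blast
  then show "acts C lab a v b" using acts_idempotent[OF e(1)] by (auto simp: acts_append)
qed

lemma acts_gen_sub:
  assumes "v \<in> zcells C" "\<And>w. w \<in> set ws \<Longrightarrow> acts C lab v w v" "n \<in> gen_sub B ws"
  shows "acts C lab v n v"
  using assms(3)
  by (induction rule: gen_sub.induct) (use assms(1,2) acts_eqM in \<open>auto simp: acts_winv acts_append\<close>)

text \<open>Once the generators fix a 0-cell, all of H does. Applied to subcomplexes this yields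
  finiteness, and applied to arbitrary labeled complexes it makes the coset complex initial among
  those in which the generators are loops.\<close>

lemma acts_omega:
  assumes "v \<in> zcells C" "\<And>w. w \<in> set ws \<Longrightarrow> acts C lab v w v" "m \<in> omega_closure B (gen_sub B ws)"
  shows "acts C lab v m v"
  using assms acts_gen_sub[OF assms(1,2)] acts_leqM unfolding omega_closure_def by blast

end

section \<open>The coset complex of a closed inverse submonoid\<close>

lemma Xs_Ps_iff: "a \<in> Xs B \<union> Ps B \<longleftrightarrow> a \<in> cells B \<and> 0 < cdim B a"
  by (auto simp: Xs_def Ps_def)

lemma good_bl:
  assumes D: "delta_complex B" and \<rho>: "\<rho> \<in> Ps B" shows "good B (bl B \<rho>)"
proof -
  have r: "\<rho> \<in> cells B" "2 \<le> cdim B \<rho>" using \<rho> by (auto simp: Ps_def)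
  have f: "cface B i \<rho> \<in> Xs B \<union> Ps B" if "i \<le> cdim B \<rho>" for i
    using face_cell[OF D r(1), of i] r that unfolding Xs_Ps_iff by auto
  have e: "ecell B \<rho> \<in> Xs B \<union> Ps B"
    using ecell_props[OF D r(1)] r unfolding Xs_Ps_iff by auto
  have "\<forall>l\<in>set (bl B \<rho>). \<exists>a\<in>Xs B \<union> Ps B. l = Gen a \<or> l = InvGen a"
  proof (cases "cdim B \<rho> = 2")
    case True
    then show ?thesis using f[of 0] f[of 1] f[of 2] by (simp add: bl_def)
  next
    case False
    then have "set (bl B \<rho>) \<subseteq> (\<lambda>i. Gen (cface B i \<rho>)) ` {..cdim B \<rho>} \<union> {Gen (ecell B \<rho>), InvGen (ecell B \<rho>)}"
      by (auto simp: bl_def)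
    then show ?thesis using f e by blast
  qed
  then show ?thesis unfolding good_def by force
qed

locale coset_complex = closed_submonoid B H for B :: "'a dcx" and H +
  assumes Bc: "B_complex B"
begin

lemma Bdelta: "delta_complex B"
  using Bc unfolding B_complex_def by simp

definition eqv :: "'a letter list \<Rightarrow> 'a letter list \<Rightarrow> bool" where
  "eqv p q \<longleftrightarrow> p @ winv q \<in> H"

definition vert :: "'a letter list \<Rightarrow> bool" where
  "vert p \<longleftrightarrow> good B p \<and> eqv p p"

definition cls :: "'a letter list \<Rightarrow> 'a letter list set" where
  "cls p = {q. good B q \<and> eqv p q}"

text \<open>The end of the edge labeled \<open>x\<close> that starts at a coset, defined on the
  whole class so that taking a face involves no choice of representative.\<close>

definition move :: "'a letter list set \<Rightarrow> 'a \<Rightarrow> 'a letter list set" where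
  "move K x = {r. \<exists>p\<in>K. r \<in> cls (p @ [Gen x])}"

text \<open>The label of a 0-cell is not a letter of any word, so at dimension 0 there is nothing to
  read.\<close>

definition readable :: "'a letter list \<Rightarrow> 'a \<Rightarrow> bool" where
  "readable p a \<longleftrightarrow> cdim B a = 0 \<or> vert (p @ [Gen a])"

text \<open>A cell is recorded as the class of its root together with its label. Only the face omitting
  \<open>v\<^sub>0\<close> has a different root, namely the end point of the edge \<open>[v\<^sub>0, v\<^sub>1]\<close>.\<close>

definition CC :: "('a letter list set \<times> 'a) dcx" where
  "CC = \<lparr>cells = {(cls p, a) |p a. vert p \<and> a \<in> cells B \<and> readable p a},
     cdim = (\<lambda>c. cdim B (snd c)),
     cface = (\<lambda>i c. if i = 0 then (move (fst c) (ecell B (snd c)), cface B 0 (snd c))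
                else (fst c, cface B i (snd c)))\<rparr>"

section \<open>Calculus of right cosets\<close>

lemma eqv_sym: "eqv p q \<Longrightarrow> eqv q p"
  unfolding eqv_def using inverse by fastforce

lemma eqv_trans: "eqv p q \<Longrightarrow> eqv q r \<Longrightarrow> eqv p r"
  unfolding eqv_def using mult[of "p @ winv q" "q @ winv r"] delete[OF _ idem_uu', of p q "winv r"] by simp

lemma vert_eqv: "good B p \<Longrightarrow> eqv p q \<Longrightarrow> vert p"
  unfolding vert_def using eqv_sym eqv_trans by blast

lemma vert_good: "vert p \<Longrightarrow> good B p"
  and vert_refl: "vert p \<Longrightarrow> eqv p p"
  unfolding vert_def by auto

lemma vert_prefix: "vert (p @ q) \<Longrightarrow> vert p"
  unfolding vert_def eqv_def using delete[OF _ idem_uu, of p q "winv p"] by simp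

text \<open>Multiplying \<open>p @ w @ winv w @ winv p\<close> by \<open>p @ winv q\<close> and
  deleting the idempotent \<open>winv p @ p\<close> leaves the required element of \<open>H\<close>.
  The hypothesis \<open>vert\<close> provides the first factor: cosets can be extended only along
  words that are defined on them.\<close>

lemma eqv_right: "vert (p @ w) \<Longrightarrow> eqv p q \<Longrightarrow> eqv (p @ w) (q @ w)"
  unfolding vert_def eqv_def
  using mult[of "(p @ w) @ winv (p @ w)" "p @ winv q"]
    delete[OF _ idem_uu', of "p @ w @ winv w" p "winv q"] by simp

lemma eqv_cancel: "eqv (p @ w) (q @ w) \<Longrightarrow> eqv p q"
  unfolding eqv_def using delete[OF _ idem_uu, of p w "winv q"] by simp

lemma vert_eqv_right: "vert (p @ w) \<Longrightarrow> eqv p q \<Longrightarrow> good B q \<Longrightarrow> vert (q @ w)"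
  using eqv_right[of p w q] eqv_sym vert_eqv[of "q @ w" "p @ w"] vert_good[of "p @ w"] by simp

lemma cls_eq_iff: "vert p \<Longrightarrow> vert q \<Longrightarrow> cls p = cls q \<longleftrightarrow> eqv p q"
  unfolding cls_def vert_def using eqv_sym eqv_trans by blast

lemma move_cls:
  assumes "vert (p @ [Gen x])" shows "move (cls p) x = cls (p @ [Gen x])"
proof
  show "move (cls p) x \<subseteq> cls (p @ [Gen x])"
    unfolding move_def cls_def using eqv_right[OF assms] eqv_trans by blast
  have "p \<in> cls p" using vert_prefix[OF assms] unfolding vert_def cls_def by simp
  then show "cls (p @ [Gen x]) \<subseteq> move (cls p) x" unfolding move_def by blast
qed

lemma vert_Nil: "vert []"
  unfolding vert_def eqv_def using one by simp

lemma idem_Ps: "\<rho> \<in> Ps B \<Longrightarrow> idempotentM B [Gen \<rho>]" "\<rho> \<in> Ps B \<Longrightarrow> idempotentM B [InvGen \<rho>]"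
  using eqM.idem[of \<rho> B] eqM_winv[OF eqM.idem[of \<rho> B]] unfolding idempotentM_def by auto

lemma delete_Ps:
  assumes "\<forall>l\<in>set Q. \<exists>\<rho>\<in>Ps B. l = Gen \<rho> \<or> l = InvGen \<rho>" "a @ Q @ b \<in> H"
  shows "a @ b \<in> H"
  using assms
proof (induction Q)
  case (Cons l Q)
  then have "idempotentM B [l]" using idem_Ps by auto
  then have "a @ Q @ b \<in> H" using delete[of a "[l]" "Q @ b"] Cons.prems(2) by simp
  then show ?case using Cons by simp
qed simp

text \<open>\<open>Q\<close> occurs twice in the product of the word with its inverse, the second
  time inverted; both occurrences consist of idempotent letters and can be deleted.\<close>

lemma vert_delete_Ps:
  assumes Q: "\<forall>l\<in>set Q. \<exists>\<rho>\<in>Ps B. l = Gen \<rho>" and v: "vert (p @ Q @ w)"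
  shows "vert (p @ w)"
proof -
  have "p @ Q @ (w @ winv w @ winv Q @ winv p) \<in> H"
    using v unfolding vert_def eqv_def by simp
  then have "(p @ w @ winv w) @ winv Q @ winv p \<in> H"
    using delete_Ps[of Q p] Q by fastforce
  moreover have "\<forall>l\<in>set (winv Q). \<exists>\<rho>\<in>Ps B. l = Gen \<rho> \<or> l = InvGen \<rho>"
    using Q unfolding winv_def by fastforce
  ultimately have "(p @ w @ winv w) @ winv p \<in> H" using delete_Ps by blast
  then show ?thesis using v unfolding vert_def eqv_def by simp
qed

text \<open>Here the defining relation enters: \<open>[Gen \<rho>]\<close> inside a member of
  \<open>H\<close> may be replaced by \<open>Gen \<rho> # bl B \<rho>\<close>, and deleting the
  idempotent letter then leaves the boundary word. Hence both \<open>\<rho>\<close> and its boundary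
  label are loops at the coset of \<open>p\<close>.\<close>

lemma P_vert:
  assumes \<rho>: "\<rho> \<in> Ps B" and v: "vert (p @ [Gen \<rho>])"
  shows "eqv (p @ [Gen \<rho>]) p" "eqv (p @ bl B \<rho>) p" "vert (p @ bl B \<rho>)"
proof -
  have "(p @ [Gen \<rho>]) @ [InvGen \<rho>] @ winv p \<in> H" using v unfolding vert_def eqv_def by simp
  then have 1: "p @ [Gen \<rho>] @ winv p \<in> H" using delete[OF _ idem_Ps(2)[OF \<rho>]] by fastforce
  then show "eqv (p @ [Gen \<rho>]) p" unfolding eqv_def by simp
  have "p @ [Gen \<rho>] @ (bl B \<rho> @ winv p) \<in> H" using subst[OF 1 eqM.brel[OF \<rho>]] by simp
  then show 2: "eqv (p @ bl B \<rho>) p"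
    unfolding eqv_def using delete[OF _ idem_Ps(1)[OF \<rho>]] by fastforce
  show "vert (p @ bl B \<rho>)"
    using vert_eqv[OF _ 2] good_bl[OF Bdelta \<rho>] vert_good[OF v] by simp
qed

text \<open>A cell can be attached only if its faces can. By \<open>P_vert\<close> the boundary
  label is readable at \<open>p\<close>, so its prefixes are too, and idempotent letters in front of
  a given face may be dropped. Dimension 2 is separate because there the faces are edges, which move
  the coset.\<close>

lemma vert_faces:
  assumes a: "a \<in> cells B" "1 \<le> cdim B a" and v: "vert (p @ [Gen a])"
  shows "vert (p @ [Gen (ecell B a)])"
    and "1 \<le> i \<Longrightarrow> i \<le> cdim B a \<Longrightarrow> readable p (cface B i a)"
    and "2 \<le> cdim B a \<Longrightarrow> vert (p @ [Gen (ecell B a), Gen (cface B 0 a)])"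
    and "cdim B a = 2 \<Longrightarrow> eqv (p @ [Gen (cface B 2 a), Gen (cface B 0 a)]) (p @ [Gen (cface B 1 a)])"
proof -
  consider (1) "cdim B a = 1" | (2) "cdim B a = 2" | (3) "3 \<le> cdim B a" using a(2) by linarith
  then have "vert (p @ [Gen (ecell B a)]) \<and> (1 \<le> i \<longrightarrow> i \<le> cdim B a \<longrightarrow> readable p (cface B i a))
     \<and> (2 \<le> cdim B a \<longrightarrow> vert (p @ [Gen (ecell B a), Gen (cface B 0 a)]))
     \<and> (cdim B a = 2 \<longrightarrow> eqv (p @ [Gen (cface B 2 a), Gen (cface B 0 a)]) (p @ [Gen (cface B 1 a)]))"
  proof cases
    case 1
    then show ?thesis using v face_cell[OF Bdelta a(1), of 1] by (auto simp: ecell_dim1 readable_def le_Suc_eq)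
  next
    case 2
    then have \<rho>: "a \<in> Ps B" using a by (simp add: Ps_def)
    let ?x = "cface B 2 a" and ?y = "cface B 0 a" and ?z = "cface B 1 a"
    have bl: "bl B a = [Gen ?x, Gen ?y, InvGen ?z]" using 2 by (simp add: bl_def)
    have e: "ecell B a = ?x"
      using 2 ecell_last_face[OF Bdelta a(1)] face_cell(2)[OF Bdelta a(1), of 2] by (simp add: ecell_dim1)
    have eq: "eqv (p @ [Gen ?x, Gen ?y]) (p @ [Gen ?z])"
      using P_vert(2)[OF \<rho> v] unfolding bl eqv_def by simp
    have v3: "vert (p @ [Gen ?x, Gen ?y, InvGen ?z])" using P_vert(3)[OF \<rho> v] unfolding bl .
    have xy: "vert (p @ [Gen ?x, Gen ?y])" using vert_prefix[of "p @ [Gen ?x, Gen ?y]" "[InvGen ?z]"] v3 by simp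
    have x: "vert (p @ [Gen ?x])" using vert_prefix[of "p @ [Gen ?x]" "[Gen ?y]"] xy by simp
    \<comment> \<open>The boundary word contains \<open>?z\<close> only inverted and at the far end
      of the path. Its readability at \<open>p\<close> comes from the fact that it leads to the same
      coset as the other two edges.\<close>
    have "good B [InvGen ?z]" using vert_good[OF v3] by (simp add: good_def)
    then have z: "vert (p @ [Gen ?z])"
      using vert_eqv[OF _ eqv_sym[OF eq]] vert_good[OF x] by simp
    have "readable p (cface B i a)" if "1 \<le> i" "i \<le> 2"
    proof -
      have "i = 1 \<or> i = 2" using that by auto
      then show ?thesis using x z by (auto simp: readable_def)
    qed
    then show ?thesis using e eq xy x 2 by simp
  next
    case 3
    then have \<rho>: "a \<in> Ps B" using a by (simp add: Ps_def)
    have f: "cface B i a \<in> Ps B" if "i \<le> cdim B a" for i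
      using face_cell[OF Bdelta a(1), of i] 3 that by (auto simp: Ps_def)
    define Q where "Q = map (\<lambda>i. Gen (cface B i a)) (rev [1..<Suc (cdim B a)])"
    define r where "r = [Gen (ecell B a), Gen (cface B 0 a), InvGen (ecell B a)]"
    have "bl B a = Q @ r" using 3 unfolding bl_def Q_def r_def by simp
    then have v: "vert (p @ Q @ r)" using P_vert(3)[OF \<rho> v] by simp
    have Q: "\<forall>l\<in>set Q. \<exists>\<rho>\<in>Ps B. l = Gen \<rho>" unfolding Q_def using f by auto
    have vr: "vert (p @ r)" by (rule vert_delete_Ps[OF Q v])
    have "readable p (cface B i a)" if "1 \<le> i" "i \<le> cdim B a"
    proof -
      have "Gen (cface B i a) \<in> set Q" unfolding Q_def using that by (auto simp del: upt_Suc)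
      then obtain Q1 Q2 where Q12: "Q = Q1 @ [Gen (cface B i a)] @ Q2"
        using split_list by fastforce
      \<comment> \<open>Stop reading right after the face in question, then discard the faces read
        before it.\<close>
      have "vert (p @ Q1 @ [Gen (cface B i a)])"
        using vert_prefix[of "p @ Q1 @ [Gen (cface B i a)]" "Q2 @ r"] v Q12 by simp
      then have "vert (p @ [Gen (cface B i a)])" using vert_delete_Ps[of Q1] Q Q12 by auto
      then show ?thesis by (simp add: readable_def)
    qed
    moreover have "vert (p @ [Gen (ecell B a), Gen (cface B 0 a)])"
      using vert_prefix[of "p @ [Gen (ecell B a), Gen (cface B 0 a)]" "[InvGen (ecell B a)]"] vr
      unfolding r_def by simp
    moreover from this have "vert (p @ [Gen (ecell B a)])"
      using vert_prefix[of "p @ [Gen (ecell B a)]" "[Gen (cface B 0 a)]"] by simp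
    ultimately show ?thesis using 3 by simp
  qed
  then show "vert (p @ [Gen (ecell B a)])"
    and "1 \<le> i \<Longrightarrow> i \<le> cdim B a \<Longrightarrow> readable p (cface B i a)"
    and "2 \<le> cdim B a \<Longrightarrow> vert (p @ [Gen (ecell B a), Gen (cface B 0 a)])"
    and "cdim B a = 2 \<Longrightarrow> eqv (p @ [Gen (cface B 2 a), Gen (cface B 0 a)]) (p @ [Gen (cface B 1 a)])"
    by auto
qed

text \<open>The edge path \<open>v\<^sub>0 v\<^sub>1 v\<^sub>2\<close> acts as the edge \<open>v\<^sub>0 v\<^sub>2\<close>: this holds in the face
  \<open>[v\<^sub>0, v\<^sub>1, v\<^sub>2]\<close>, to which one descends by omitting the last vertex.\<close>

lemma triangle_eqv:
  assumes "a \<in> cells B" "2 \<le> cdim B a" "vert (p @ [Gen a])"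
  shows "eqv (p @ [Gen (ecell B a), Gen (ecell B (cface B 0 a))]) (p @ [Gen (ecell B (cface B 1 a))])"
  using assms
proof (induction "cdim B a" arbitrary: a)
  case (Suc n)
  have k: "cdim B a = Suc n" using Suc.hyps by simp
  note D = Bdelta
  have f: "cface B i a \<in> cells B" "cdim B (cface B i a) = n" if "i \<le> Suc n" for i
    using face_cell[OF D Suc.prems(1), of i] k that by auto
  show ?case
  proof (cases "n = 1")
    case True
    have "ecell B a = cface B 2 a"
      using True k ecell_last_face[OF D Suc.prems(1)] f(2)[of 2] by (simp add: ecell_dim1 numeral_2_eq_2)
    then show ?thesis using vert_faces(4)[OF Suc.prems(1) _ Suc.prems(3)] True k f(2)[of 0] f(2)[of 1]
      by (simp add: ecell_dim1)
  next
    case False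
    then have n: "2 \<le> n" using Suc.prems k by simp
    define b where "b = cface B (Suc n) a"
    have b: "b \<in> cells B" "cdim B b = n" unfolding b_def using f by auto
    have "vert (p @ [Gen b])"
      using vert_faces(2)[OF Suc.prems(1) _ Suc.prems(3), of "Suc n"] k b n
      unfolding readable_def b_def by simp
    then have "eqv (p @ [Gen (ecell B b), Gen (ecell B (cface B 0 b))]) (p @ [Gen (ecell B (cface B 1 b))])"
      using Suc.hyps(1)[of b] b n by simp
    moreover have "ecell B b = ecell B a"
      unfolding b_def using ecell_last_face[OF D Suc.prems(1)] n k by simp
    moreover have "ecell B (cface B i b) = ecell B (cface B i a)" if "i \<le> 1" for i
    proof -
      have "cface B i b = cface B n (cface B i a)"
        unfolding b_def using face_face[OF D Suc.prems(1), of i "Suc n"] that n k by simp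
      then show ?thesis using ecell_last_face[OF D f(1)[of i]] f(2)[of i] n that by simp
    qed
    ultimately show ?thesis by simp
  qed
qed simp

section \<open>The coset complex is a labeled complex\<close>

lemma CC_simps [simp]: "cdim CC (K, a) = cdim B a" "0 < i \<Longrightarrow> cface CC i (K, a) = (K, cface B i a)"
  by (auto simp: CC_def)

lemma CC_face0: "vert (p @ [Gen (ecell B a)]) \<Longrightarrow>
    cface CC 0 (cls p, a) = (cls (p @ [Gen (ecell B a)]), cface B 0 a)"
  by (auto simp: CC_def move_cls)

lemma CC_cellI: "vert p \<Longrightarrow> a \<in> cells B \<Longrightarrow> readable p a \<Longrightarrow> (cls p, a) \<in> cells CC"
  by (auto simp: CC_def)

lemma CC_cellE:
  assumes "c \<in> cells CC"
  obtains p a where "c = (cls p, a)" "vert p" "a \<in> cells B" "readable p a"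
  using assms by (auto simp: CC_def)

lemma CC_face:
  assumes p: "vert p" "a \<in> cells B" "readable p a" and k: "0 < cdim B a" "i \<le> cdim B a"
  shows "cface CC i (cls p, a) \<in> cells CC"
proof -
  have v: "vert (p @ [Gen a])" using p k by (simp add: readable_def)
  note f = vert_faces[OF p(2) _ v] and c = face_cell[OF Bdelta p(2) k]
  show ?thesis
  proof (cases "i = 0")
    case True
    have "readable (p @ [Gen (ecell B a)]) (cface B 0 a)"
      using f(3) k c(2) True by (cases "cdim B a = 1") (auto simp: readable_def)
    then show ?thesis using True f(1) k c CC_face0[of p a] by (auto intro!: CC_cellI)
  next
    case False
    then show ?thesis using f(2)[of i] k c p by (auto intro!: CC_cellI)
  qed
qed

text \<open>The labels obey the simplicial identities of \<open>B\<close>, so only the cosets have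
  to be compared, and they change only under the face omitting v_0. For j at least 2 the edge
  [v_0,v_1] is the same before and after; for i = 0, j = 1 the two sides reach v_2 by different
  paths, which \<open>triangle_eqv\<close> identifies.\<close>

lemma CC_delta: "delta_complex CC"
  unfolding delta_complex_def
proof (intro conjI ballI impI allI; (elim conjE)?)
  fix c i assume c: "c \<in> cells CC" "0 < cdim CC c" "i \<le> cdim CC c"
  show "cface CC i c \<in> cells CC"
    using c CC_face by (elim CC_cellE) simp
  show "cdim CC (cface CC i c) = cdim CC c - 1"
    using c face_cell(2)[OF Bdelta] by (auto simp: CC_def)
next
  fix c i j assume c: "c \<in> cells CC" and k: "2 \<le> cdim CC c" and ij: "i < j" "j \<le> cdim CC c"
  obtain p a where p: "c = (cls p, a)" "vert p" "a \<in> cells B" "readable p a"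
    using c by (rule CC_cellE)
  have k: "2 \<le> cdim B a" "j \<le> cdim B a" using k ij p(1) by auto
  have v: "vert (p @ [Gen a])" using p k by (simp add: readable_def)
  note f = vert_faces[OF p(3) _ v] and ff = face_face[OF Bdelta p(3) k(1) ij(1) k(2)]
  have j: "vert (p @ [Gen (cface B j a)])"
    using f(2)[of j] k ij face_cell(2)[OF Bdelta p(3), of j] by (simp add: readable_def)
  have cj: "cface B j a \<in> cells B" "1 \<le> cdim B (cface B j a)"
    using face_cell[OF Bdelta p(3), of j] k by auto
  show "cface CC i (cface CC j c) = cface CC (j - 1) (cface CC i c)"
  proof (cases "i = 0")
    case False
    then show ?thesis using ff ij p(1) by simp
  next
    case i: True
    have e: "vert (p @ [Gen (ecell B a)])" using f(1) k by simp
    have ej: "vert (p @ [Gen (ecell B (cface B j a))])" using vert_faces(1)[OF cj j] .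
    have L: "cface CC i (cface CC j c) = (cls (p @ [Gen (ecell B (cface B j a))]), cface B 0 (cface B j a))"
      using CC_face0[OF ej] ij i p(1) by simp
    have R: "cface CC i c = (cls (p @ [Gen (ecell B a)]), cface B 0 a)"
      using CC_face0[OF e] i p(1) by simp
    show ?thesis
    proof (cases "j = 1")
      case True
      have c0: "cface B 0 a \<in> cells B" "1 \<le> cdim B (cface B 0 a)"
        using face_cell[OF Bdelta p(3), of 0] k by auto
      have e0: "vert ((p @ [Gen (ecell B a)]) @ [Gen (ecell B (cface B 0 a))])"
        using vert_faces(1)[OF c0, of "p @ [Gen (ecell B a)]"] f(3) k by simp
      have "eqv (p @ [Gen (ecell B a), Gen (ecell B (cface B 0 a))]) (p @ [Gen (ecell B (cface B 1 a))])"
        using triangle_eqv[OF p(3) k(1) v] .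
      then have "cls ((p @ [Gen (ecell B a)]) @ [Gen (ecell B (cface B 0 a))]) = cls (p @ [Gen (ecell B (cface B j a))])"
        using cls_eq_iff[OF e0 ej] True by simp
      then show ?thesis using L R CC_face0[OF e0] True ff i by simp
    next
      case False
      then have "ecell B (cface B j a) = ecell B a"
        using ecell_face[OF Bdelta p(3), of j] ij k by simp
      then show ?thesis using L R False ff i ij by simp
    qed
  qed
qed

text \<open>Descend to a face that contains the shared vertex. Faces other than the one omitting v_0
  keep the coset; for that one, the cosets agree after the edge [v_0,v_1] has been read, and this
  edge can be cancelled.\<close>

lemma CC_vtx_inj:
  assumes "vert p" "vert q" "a \<in> cells B" "readable p a" "readable q a" "j \<le> cdim B a"
    and "vtx CC (cdim B a) (cls p, a) j = vtx CC (cdim B a) (cls q, a) j"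
  shows "eqv p q"
  using assms
proof (induction "cdim B a" arbitrary: a p q j)
  case 0
  then show ?case using cls_eq_iff by simp
next
  case (Suc n)
  have k: "cdim B a = Suc n" using Suc.hyps by simp
  have f: "cface B i a \<in> cells B" "cdim B (cface B i a) = n" if "i \<le> Suc n" for i
    using face_cell[OF Bdelta Suc.prems(3), of i] k that by auto
  have v: "vert (p @ [Gen a])" "vert (q @ [Gen a])"
    using Suc.prems k by (auto simp: readable_def)
  note fp = vert_faces[OF Suc.prems(3) _ v(1)] and fq = vert_faces[OF Suc.prems(3) _ v(2)]
  show ?case
  proof (cases "j \<le> n")
    case True
    then have "vtx CC n (cls p, cface B (Suc n) a) j = vtx CC n (cls q, cface B (Suc n) a) j"
      using Suc.prems(7) k by simp
    then show ?thesis using Suc.hyps(1)[of "cface B (Suc n) a" p q j] f[of "Suc n"] Suc.prems True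
        fp(2)[of "Suc n"] fq(2)[of "Suc n"] k by simp
  next
    case False
    have e: "vert (p @ [Gen (ecell B a)])" "vert (q @ [Gen (ecell B a)])" using fp(1) fq(1) k by auto
    have "readable (p @ [Gen (ecell B a)]) (cface B 0 a)" "readable (q @ [Gen (ecell B a)]) (cface B 0 a)"
      using fp(3) fq(3) f(2)[of 0] k by (cases "n = 0"; auto simp: readable_def)+
    then have "eqv (p @ [Gen (ecell B a)]) (q @ [Gen (ecell B a)])"
      using Suc.hyps(1)[of "cface B 0 a" _ _ "j - 1"] f[of 0] Suc.prems False e k
        CC_face0[OF e(1)] CC_face0[OF e(2)] by simp
    then show ?thesis by (rule eqv_cancel)
  qed
qed

lemma CC_labeled: "labeled B CC snd"
  unfolding labeled_def
proof (intro conjI ballI impI allI; (elim conjE)?)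
  show "delta_complex CC" by (rule CC_delta)
next
  fix c d assume cd: "c \<in> cells CC" "d \<in> cells CC" "snd c = snd d"
    and j: "\<exists>j\<le>cdim CC c. vertex CC c j = vertex CC d j"
  obtain p a where p: "c = (cls p, a)" "vert p" "a \<in> cells B" "readable p a"
    using cd(1) by (rule CC_cellE)
  obtain q b where q: "d = (cls q, b)" "vert q" "b \<in> cells B" "readable q b"
    using cd(2) by (rule CC_cellE)
  show "c = d"
    using j CC_vtx_inj[of p q a] p q cd(3) cls_eq_iff[of p q] by (auto simp: vertex_def)
qed (auto simp: CC_def)

sublocale CC: labeled_complex B CC snd
  by unfold_locales (rule CC_labeled)

section \<open>Action and loops in the coset complex\<close>

definition b0 :: 'a where "b0 = (THE b. b \<in> zcells B)"

lemma zcells_B: "zcells B = {b0}"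
proof -
  have "card (zcells B) = 1" using Bc unfolding B_complex_def by simp
  then obtain b where "zcells B = {b}" using card_1_singletonE by metis
  then show ?thesis unfolding b0_def by simp
qed

lemma b0_cell: "b0 \<in> cells B" "cdim B b0 = 0"
  using zcells_B by (auto simp: zcells_def)

lemma b0_unique: "b \<in> cells B \<Longrightarrow> cdim B b = 0 \<Longrightarrow> b = b0"
  using zcells_B by (auto simp: zcells_def)

lemma CC_zcells: "zcells CC = {(cls p, b0) |p. vert p}"
proof -
  have "c \<in> zcells CC \<longleftrightarrow> (\<exists>p. c = (cls p, b0) \<and> vert p)" for c
  proof
    assume "c \<in> zcells CC"
    then have c: "c \<in> cells CC" "cdim CC c = 0" by (auto simp: zcells_def)
    then obtain p a where "c = (cls p, a)" "vert p" "a \<in> cells B" by (elim CC_cellE)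
    then show "\<exists>p. c = (cls p, b0) \<and> vert p" using c b0_unique by auto
  next
    assume "\<exists>p. c = (cls p, b0) \<and> vert p"
    then show "c \<in> zcells CC" using b0_cell by (auto simp: zcells_def readable_def intro!: CC_cellI)
  qed
  then show ?thesis by blast
qed

text \<open>Position 0 is followed through last faces only, and these leave the coset
  unchanged.\<close>

lemma CC_root:
  assumes "vert p" "a \<in> cells B" "readable p a" shows "root CC (cls p, a) = (cls p, b0)"
proof -
  have "fst (vtx CC n (K, b) 0) = K" for n K b
    by (induction n arbitrary: b) auto
  then have "fst (root CC (cls p, a)) = cls p" unfolding root_def vertex_def by simp
  moreover have "root CC (cls p, a) \<in> zcells CC"
    by (rule root_zcell[OF CC_delta CC_cellI[OF assms]])
  ultimately show ?thesis unfolding CC_zcells by auto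
qed

text \<open>The cell behind a step may be recorded by another representative of the coset, and
  readability is transported along \<open>eqv\<close>. For labels in \<open>Ps B\<close> the step is
  a loop, in accordance with \<open>P_vert\<close>.\<close>

lemma CC_step_Gen:
  assumes p: "vert p" and q: "vert q" and a: "a \<in> Xs B \<union> Ps B"
  shows "step CC snd (cls p, b0) (Gen a) (cls q, b0) \<longleftrightarrow> vert (p @ [Gen a]) \<and> eqv (p @ [Gen a]) q"
proof (cases "a \<in> Xs B")
  case True
  then have a: "a \<in> cells B" "cdim B a = 1" by (auto simp: Xs_def)
  have b: "cface B 1 a = b0" "cface B 0 a = b0"
    using face_cell[OF Bdelta a(1), of 1] face_cell[OF Bdelta a(1), of 0] a
    by (simp_all add: b0_unique)
  have "step CC snd (cls p, b0) (Gen a) (cls q, b0) \<longleftrightarrow>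
      (cls p, a) \<in> cells CC \<and> cface CC 0 (cls p, a) = (cls q, b0)"
    unfolding step_def using a b by auto
  also have "\<dots> \<longleftrightarrow> vert (p @ [Gen a]) \<and> eqv (p @ [Gen a]) q"
  proof
    assume L: "(cls p, a) \<in> cells CC \<and> cface CC 0 (cls p, a) = (cls q, b0)"
    then obtain p' where p': "cls p = cls p'" "vert p'" "readable p' a"
      by (auto elim!: CC_cellE)
    then have "vert (p @ [Gen a])"
      using cls_eq_iff[of p p'] p a vert_eqv_right[of p' "[Gen a]" p] vert_good eqv_sym
      by (auto simp: readable_def)
    then show "vert (p @ [Gen a]) \<and> eqv (p @ [Gen a]) q"
      using L CC_face0[of p a] cls_eq_iff[OF _ q] a by (simp add: ecell_dim1)
  next
    assume R: "vert (p @ [Gen a]) \<and> eqv (p @ [Gen a]) q"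
    then show "(cls p, a) \<in> cells CC \<and> cface CC 0 (cls p, a) = (cls q, b0)"
      using CC_cellI[OF p a(1)] CC_face0[of p a] cls_eq_iff[OF _ q] a b
      by (simp add: ecell_dim1 readable_def)
  qed
  finally show ?thesis .
next
  case False
  then have P: "a \<in> Ps B" and a: "a \<in> cells B" "2 \<le> cdim B a" using a by (auto simp: Ps_def)
  have "step CC snd (cls p, b0) (Gen a) (cls q, b0) \<longleftrightarrow>
      (\<exists>r. vert r \<and> readable r a \<and> cls r = cls p \<and> cls q = cls p)"
  proof
    assume "step CC snd (cls p, b0) (Gen a) (cls q, b0)"
    then obtain c where c: "c \<in> cells CC" "snd c = a" "root CC c = (cls p, b0)" "cls q = cls p"
    proof (cases rule: CC.step_Gen_cases)
      case (edge e)
      then show ?thesis using a CC.lab_dim[of e] by simp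
    qed auto
    from c(1) obtain r b where r: "c = (cls r, b)" "vert r" "b \<in> cells B" "readable r b" by (rule CC_cellE)
    then show "\<exists>r. vert r \<and> readable r a \<and> cls r = cls p \<and> cls q = cls p"
      using CC_root[OF r(2-4)] c by auto
  next
    assume "\<exists>r. vert r \<and> readable r a \<and> cls r = cls p \<and> cls q = cls p"
    then obtain r where r: "vert r" "readable r a" "cls r = cls p" "cls q = cls p" by blast
    show "step CC snd (cls p, b0) (Gen a) (cls q, b0)"
      using CC.step_root[OF CC_cellI[OF r(1) a(1) r(2)]] CC_root[OF r(1) a(1) r(2)] a r by simp
  qed
  also have "\<dots> \<longleftrightarrow> vert (p @ [Gen a]) \<and> eqv (p @ [Gen a]) q"
  proof
    assume "\<exists>r. vert r \<and> readable r a \<and> cls r = cls p \<and> cls q = cls p"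
    then obtain r where r: "vert r" "vert (r @ [Gen a])" "cls r = cls p" "cls q = cls p"
      using a by (auto simp: readable_def)
    then have "vert (p @ [Gen a])"
      using cls_eq_iff[of r p] p vert_eqv_right[of r "[Gen a]" p] vert_good by auto
    then show "vert (p @ [Gen a]) \<and> eqv (p @ [Gen a]) q"
      using P_vert(1)[OF P] r cls_eq_iff[OF p q] eqv_trans by metis
  next
    assume R: "vert (p @ [Gen a]) \<and> eqv (p @ [Gen a]) q"
    then have "eqv p q" using P_vert(1)[OF P] eqv_sym eqv_trans by blast
    then show "\<exists>r. vert r \<and> readable r a \<and> cls r = cls p \<and> cls q = cls p"
      using R p q cls_eq_iff[OF p q] by (auto simp: readable_def)
  qed
  finally show ?thesis .
qed

text \<open>For an inverse letter the step is reversed, and the two conditions match because reading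
  \<open>a\<close> from \<open>q\<close> to \<open>p\<close> and reading its inverse from
  \<open>p\<close> to \<open>q\<close> put the same word, up to inversion, into
  \<open>H\<close>.\<close>

lemma CC_step:
  assumes p: "vert p" and q: "vert q" and l: "good B [l]"
  shows "step CC snd (cls p, b0) l (cls q, b0) \<longleftrightarrow> vert (p @ [l]) \<and> eqv (p @ [l]) q"
proof (cases l)
  case (Gen a)
  then show ?thesis using CC_step_Gen[OF p q] l by simp
next
  case (InvGen a)
  have "step CC snd (cls p, b0) l (cls q, b0) \<longleftrightarrow> vert (q @ [Gen a]) \<and> eqv (q @ [Gen a]) p"
    using CC_step_Gen[OF q p, of a] CC.step_linv[of "(cls p, b0)" "Gen a" "(cls q, b0)"] l
    unfolding InvGen by simp
  also have "\<dots> \<longleftrightarrow> eqv (q @ [Gen a]) p"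
    using vert_eqv[of "q @ [Gen a]" p] vert_good[OF q] l InvGen by auto
  also have "\<dots> \<longleftrightarrow> eqv p (q @ [Gen a])" using eqv_sym by blast
  also have "\<dots> \<longleftrightarrow> eqv (p @ [l]) q" unfolding eqv_def InvGen by simp
  also have "\<dots> \<longleftrightarrow> vert (p @ [l]) \<and> eqv (p @ [l]) q"
    using vert_eqv[of "p @ [l]" q] vert_good[OF p] l by auto
  finally show ?thesis .
qed

lemma CC_acts:
  assumes "vert p" "vert q" "good B u"
  shows "acts CC snd (cls p, b0) u (cls q, b0) \<longleftrightarrow> vert (p @ u) \<and> eqv (p @ u) q"
  using assms
proof (induction u arbitrary: p)
  case Nil
  have "(cls p, b0) \<in> zcells CC" unfolding CC_zcells using Nil by blast
  then show ?case using cls_eq_iff[OF Nil(1,2)] Nil(1) by simp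
next
  case (Cons l u)
  have l: "good B [l]" "good B u" using Cons.prems(3) good_Cons[of B l u] by auto
  have "acts CC snd (cls p, b0) (l # u) (cls q, b0) \<longleftrightarrow>
      (\<exists>r. vert r \<and> step CC snd (cls p, b0) l (cls r, b0) \<and> acts CC snd (cls r, b0) u (cls q, b0))"
    unfolding CC.acts_Cons
  proof
    assume "\<exists>x. step CC snd (cls p, b0) l x \<and> acts CC snd x u (cls q, b0)"
    then obtain x where x: "step CC snd (cls p, b0) l x" "acts CC snd x u (cls q, b0)" by blast
    from CC.step_cells(2)[OF x(1)] obtain r where "x = (cls r, b0)" "vert r"
      unfolding CC_zcells by blast
    then show "\<exists>r. vert r \<and> step CC snd (cls p, b0) l (cls r, b0) \<and> acts CC snd (cls r, b0) u (cls q, b0)"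
      using x by blast
  qed blast
  also have "\<dots> \<longleftrightarrow> (\<exists>r. vert r \<and> vert (p @ [l]) \<and> eqv (p @ [l]) r \<and> vert (r @ u) \<and> eqv (r @ u) q)"
    using CC_step[OF Cons.prems(1) _ l(1)] Cons.IH[OF _ Cons.prems(2) l(2)] by blast
  also have "\<dots> \<longleftrightarrow> vert (p @ l # u) \<and> eqv (p @ l # u) q"
  proof
    assume "\<exists>r. vert r \<and> vert (p @ [l]) \<and> eqv (p @ [l]) r \<and> vert (r @ u) \<and> eqv (r @ u) q"
    then obtain r where r: "vert r" "vert (p @ [l])" "eqv (p @ [l]) r" "vert (r @ u)" "eqv (r @ u) q" by blast
    have "eqv (r @ u) ((p @ [l]) @ u)" by (rule eqv_right[OF r(4) eqv_sym[OF r(3)]])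
    then have "eqv ((p @ [l]) @ u) q" using r(5) eqv_sym eqv_trans by blast
    then show "vert (p @ l # u) \<and> eqv (p @ l # u) q"
      using vert_eqv[of "(p @ [l]) @ u" q] vert_good[OF r(2)] l(2) good_Cons[of B l u] by simp
  next
    assume R: "vert (p @ l # u) \<and> eqv (p @ l # u) q"
    then have "vert (p @ [l])" using vert_prefix[of "p @ [l]" u] by simp
    then show "\<exists>r. vert r \<and> vert (p @ [l]) \<and> eqv (p @ [l]) r \<and> vert (r @ u) \<and> eqv (r @ u) q"
      using R vert_refl by (intro exI[of _ "p @ [l]"]) simp
  qed
  finally show ?case .
qed

lemma CC_loop: "good B u \<Longrightarrow> acts CC snd (cls [], b0) u (cls [], b0) \<longleftrightarrow> u \<in> H"
  using CC_acts[OF vert_Nil vert_Nil, of u] vert_eqv[of u "[]"] by (auto simp: eqv_def)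

lemma CC_base: "(cls [], b0) \<in> zcells CC"
  unfolding CC_zcells using vert_Nil by auto

lemma CC_reach: "vert p \<Longrightarrow> acts CC snd (cls [], b0) p (cls p, b0)"
  using CC_acts[OF vert_Nil, of p p] vert_good vert_refl by simp

end

section \<open>Connectedness in terms of words\<close>

definition adj :: "'c dcx \<Rightarrow> ('c \<times> 'c) set" where
  "adj D = {(u, w). \<exists>e\<in>cells D. cdim D e = 1 \<and>
            ((cface D 1 e = u \<and> cface D 0 e = w) \<or> (cface D 1 e = w \<and> cface D 0 e = u))}"

lemma dconnected_adj: "dconnected D \<longleftrightarrow> zcells D \<noteq> {} \<and> (\<forall>a\<in>zcells D. \<forall>b\<in>zcells D. (a, b) \<in> (adj D)\<^sup>*)"
  unfolding dconnected_def adj_def by simp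

lemma sym_adj: "sym (adj D)"
  unfolding adj_def by (rule symI) auto

lemma dconnectedI:
  assumes "v \<in> zcells D" "\<And>a. a \<in> zcells D \<Longrightarrow> (v, a) \<in> (adj D)\<^sup>*"
  shows "dconnected D"
  unfolding dconnected_adj
proof (intro conjI ballI)
  show "zcells D \<noteq> {}" using assms(1) by blast
  fix a b assume "a \<in> zcells D" "b \<in> zcells D"
  then have "(v, a) \<in> (adj D)\<^sup>*" "(v, b) \<in> (adj D)\<^sup>*" using assms(2) by auto
  moreover have "(a, v) \<in> (adj D)\<^sup>*" using calculation(1) sym_rtrancl[OF sym_adj] by (meson symD)
  ultimately show "(a, b) \<in> (adj D)\<^sup>*" by (meson rtrancl_trans)
qed

context labeled_complex
begin

lemma step_adj: "step C lab v l w \<Longrightarrow> (v, w) \<in> (adj C)\<^sup>*"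
  by (cases l) (auto simp: step_def adj_def)

lemma acts_adj: "acts C lab v u w \<Longrightarrow> (v, w) \<in> (adj C)\<^sup>*"
proof (induction rule: acts.induct)
  case (cons v l w u x)
  then show ?case using step_adj rtrancl_trans by metis
qed simp

text \<open>A path in the 1-skeleton uses only letters from \<open>Xs B\<close> and their inverses.
  Therefore its inverse is \<open>allowed\<close> as well, although \<open>allowed\<close> is not
  closed under \<open>winv\<close> in general, and loops built from such paths lie within the scope
  of \<open>loop_words\<close>.\<close>

lemma adj_acts:
  assumes "(v, w) \<in> (adj C)\<^sup>*" "v \<in> zcells C"
  obtains p where "acts C lab v p w" "allowed B p" "allowed B (winv p)"
proof -
  have "\<exists>p. acts C lab v p w \<and> allowed B p \<and> allowed B (winv p)"
    using assms(1)
  proof (induction rule: rtrancl_induct)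
    case base
    then show ?case using assms(2) by (intro exI[of _ "[]"]) (simp add: allowed_def)
  next
    case (step y z)
    then obtain p where p: "acts C lab v p y" "allowed B p" "allowed B (winv p)" by blast
    from step(2) obtain e where e: "e \<in> cells C" "cdim C e = 1"
      and yz: "cface C 1 e = y \<and> cface C 0 e = z \<or> cface C 1 e = z \<and> cface C 0 e = y"
      unfolding adj_def by auto
    have X: "lab e \<in> Xs B" using lab_dim[OF e(1)] lab_cell[OF e(1)] e by (simp add: Xs_def)
    from yz step_edge[OF e] have "step C lab y (Gen (lab e)) z \<or> step C lab y (InvGen (lab e)) z" by auto
    then obtain l where l: "step C lab y l z" "l = Gen (lab e) \<or> l = InvGen (lab e)" by blast
    then have "acts C lab v (p @ [l]) z" using p(1) by (auto simp: acts_append)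
    moreover have "allowed B (p @ [l])" "allowed B (winv (p @ [l]))"
      using p l(2) X by (auto simp: allowed_def)
    ultimately show ?case by blast
  qed
  then show ?thesis using that by blast
qed

lemma connected_acts:
  assumes "dconnected C" "v \<in> zcells C" "w \<in> zcells C"
  obtains p where "acts C lab v p w" "allowed B p" "allowed B (winv p)"
  using assms adj_acts[of v w] unfolding dconnected_adj by blast

end

context coset_complex
begin

lemma CC_connected: "dconnected CC"
proof (rule dconnectedI[OF CC_base])
  fix a assume "a \<in> zcells CC"
  then obtain p where "a = (cls p, b0)" "vert p" unfolding CC_zcells by blast
  then show "((cls [], b0), a) \<in> (adj CC)\<^sup>*" using CC.acts_adj[OF CC_reach] by simp
qed

end

section \<open>Finiteness, simulations and isomorphisms\<close>

lemma vtx_sub [simp]: "vtx (C\<lparr>cells := S\<rparr>) n c j = vtx C n c j"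
  by (induction n arbitrary: c j) auto

lemma root_sub [simp]: "root (C\<lparr>cells := S\<rparr>) c = root C c"
  by (simp add: root_def vertex_def)

lemma step_sub_mono: "step (C\<lparr>cells := S\<rparr>) lab v l w \<Longrightarrow> S \<subseteq> T \<Longrightarrow> step (C\<lparr>cells := T\<rparr>) lab v l w"
  by (auto simp: step_def split: letter.splits)

lemma acts_sub_mono: "acts (C\<lparr>cells := S\<rparr>) lab v u w \<Longrightarrow> S \<subseteq> T \<Longrightarrow> acts (C\<lparr>cells := T\<rparr>) lab v u w"
proof (induction rule: acts.induct)
  case (cons v l w ls u)
  from step_sub_mono[OF cons.hyps(1) cons.prems] cons.IH[OF cons.prems] show ?case by (rule acts.cons)
qed (auto simp: zcells_def intro!: acts.nil)

definition face_closed :: "'c dcx \<Rightarrow> 'c set \<Rightarrow> bool" where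
  "face_closed C S \<longleftrightarrow> (\<forall>c\<in>S. 0 < cdim C c \<longrightarrow> (\<forall>i\<le>cdim C c. cface C i c \<in> S))"

lemma labeled_sub:
  assumes "labeled B C lab" "S \<subseteq> cells C" "face_closed C S"
  shows "labeled B (C\<lparr>cells := S\<rparr>) lab"
proof -
  have s: "cells (C\<lparr>cells := S\<rparr>) = S" "cdim (C\<lparr>cells := S\<rparr>) = cdim C"
    "cface (C\<lparr>cells := S\<rparr>) = cface C" by simp_all
  show ?thesis
    using assms unfolding labeled_def delta_complex_def face_closed_def vertex_def vtx_sub s
    by (intro conjI) blast+
qed

text \<open>Adding all faces \<open>n\<close> times suffices, because the cells that are new in each
  round have smaller and smaller dimension.\<close>

lemma ex_face_closed:
  assumes C: "delta_complex C" and T: "finite T" "T \<subseteq> cells C" and n: "\<forall>c\<in>cells C. cdim C c \<le> n"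
  obtains S where "T \<subseteq> S" "S \<subseteq> cells C" "finite S" "face_closed C S" "card S \<le> card T * (n + 2) ^ n"
proof -
  define F where "F S = S \<union> (\<Union>i\<in>{..n}. cface C i ` {c \<in> S. 0 < cdim C c \<and> i \<le> cdim C c})" for S
  have F1: "S \<subseteq> F S" for S unfolding F_def by blast
  have FE: "c \<in> S \<or> (\<exists>i d. c = cface C i d \<and> d \<in> S \<and> 0 < cdim C d \<and> i \<le> cdim C d)" if "c \<in> F S" for c S
    using that unfolding F_def by blast
  have F2: "F S \<subseteq> cells C" if "S \<subseteq> cells C" for S
    using that face_cell(1)[OF C] unfolding F_def by blast
  have F3: "finite (F S) \<and> card (F S) \<le> card S * (n + 2)" if S: "finite S" for S
  proof -
    let ?g = "\<lambda>i. cface C i ` {c \<in> S. 0 < cdim C c \<and> i \<le> cdim C c}"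
    have g: "card (?g i) \<le> card S" for i
      using card_image_le[of "{c \<in> S. 0 < cdim C c \<and> i \<le> cdim C c}" "cface C i"]
        card_mono[OF S, of "{c \<in> S. 0 < cdim C c \<and> i \<le> cdim C c}"] S by fastforce
    have "card (F S) \<le> card S + card (\<Union>i\<in>{..n}. ?g i)" unfolding F_def by (rule card_Un_le)
    also have "card (\<Union>i\<in>{..n}. ?g i) \<le> (\<Sum>i\<in>{..n}. card (?g i))" by (rule card_UN_le) simp
    also have "\<dots> \<le> card {..n} * card S" using sum_bounded_above[of "{..n}" "\<lambda>i. card (?g i)" "card S"] g by simp
    finally show ?thesis using S unfolding F_def by (simp add: algebra_simps)
  qed
  have K: "T \<subseteq> (F ^^ k) T \<and> (F ^^ k) T \<subseteq> cells C \<and> finite ((F ^^ k) T) \<and>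
      card ((F ^^ k) T) \<le> card T * (n + 2) ^ k" for k
  proof (induction k)
    case (Suc k)
    have "card ((F ^^ Suc k) T) \<le> card ((F ^^ k) T) * (n + 2)" using F3 Suc by simp
    also have "\<dots> \<le> (card T * (n + 2) ^ k) * (n + 2)" using Suc by (intro mult_right_mono) auto
    finally have "card ((F ^^ Suc k) T) \<le> card T * (n + 2) ^ Suc k" by (simp only: power_Suc ac_simps)
    moreover have "T \<subseteq> (F ^^ Suc k) T" using Suc F1[of "(F ^^ k) T"] by auto
    ultimately show ?case using Suc F2 F3 by simp
  qed (use T in auto)
  \<comment> \<open>Cells that first appear in round \<open>Suc k\<close> have dimension at most
    \<open>n - Suc k\<close>. In round \<open>n\<close> only 0-cells can be new, so every cell of
    positive dimension had its faces added in time.\<close>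
  have old: "c \<in> (F ^^ k) T \<or> cdim C c + Suc k \<le> n" if "c \<in> (F ^^ Suc k) T" for c k
    using that
  proof (induction k arbitrary: c)
    case 0
    then show ?case using face_cell(2)[OF C] T n unfolding F_def by fastforce
  next
    case (Suc k)
    then consider "c \<in> (F ^^ Suc k) T" | i d where "c = cface C i d" "d \<in> (F ^^ Suc k) T" "0 < cdim C d" "i \<le> cdim C d"
      using FE[of c "(F ^^ Suc k) T"] by auto
    then show ?case
    proof cases
      case (2 i d)
      have d: "d \<in> cells C" using K[of "Suc k"] 2 by blast
      from Suc.IH[OF 2(2)] show ?thesis
      proof
        assume "d \<in> (F ^^ k) T"
        then have "c \<in> F ((F ^^ k) T)" using 2 n d unfolding F_def by fastforce
        then show ?thesis by simp
      next
        assume "cdim C d + Suc k \<le> n"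
        then show ?thesis using face_cell(2)[OF C d 2(3,4)] 2 by simp
      qed
    qed simp
  qed
  have "face_closed C ((F ^^ n) T)"
    unfolding face_closed_def
  proof (intro ballI impI allI)
    fix c i assume c: "c \<in> (F ^^ n) T" "0 < cdim C c" "i \<le> cdim C c"
    then have cc: "c \<in> cells C" using K by blast
    have "n \<noteq> 0" using n cc c by auto
    then obtain m where m: "n = Suc m" by (cases n) auto
    then have "c \<in> (F ^^ m) T" using old[of c m] c by auto
    then have "cface C i c \<in> F ((F ^^ m) T)" using c n cc unfolding F_def by fastforce
    then show "cface C i c \<in> (F ^^ n) T" using m by simp
  qed
  then show ?thesis using that K[of n] by blast
qed

lemma card_UN_bound:
  assumes "finite I" "card I \<le> m" "\<And>i. i \<in> I \<Longrightarrow> card (A i) \<le> k"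
  shows "card (\<Union>i\<in>I. A i) \<le> m * k"
proof -
  have "card (\<Union>i\<in>I. A i) \<le> (\<Sum>i\<in>I. card (A i))" by (rule card_UN_le[OF assms(1)])
  also have "\<dots> \<le> card I * k" using sum_bounded_above[of I "\<lambda>i. card (A i)" k] assms(3) by simp
  also have "\<dots> \<le> m * k" using assms(2) by simp
  finally show ?thesis .
qed

context labeled_complex
begin

text \<open>One cell per letter witnesses the action; the additional one is the 0-cell at which the
  empty rest of the word is read.\<close>

lemma acts_trace:
  assumes "acts C lab v u w"
  shows "\<exists>T\<subseteq>cells C. finite T \<and> card T \<le> Suc (length u) \<and> (\<forall>S. T \<subseteq> S \<longrightarrow> acts (C\<lparr>cells := S\<rparr>) lab v u w)"
  using assms
proof (induction rule: acts.induct)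
  case (nil v)
  then show ?case by (intro exI[of _ "{v}"]) (auto simp: zcells_def intro!: acts.nil)
next
  case (cons v l w ls u)
  then obtain T where T: "T \<subseteq> cells C" "finite T" "card T \<le> Suc (length ls)"
    "\<And>S. T \<subseteq> S \<Longrightarrow> acts (C\<lparr>cells := S\<rparr>) lab w ls u" by blast
  obtain c where c: "c \<in> cells C" "step (C\<lparr>cells := {c}\<rparr>) lab v l w"
    using cons.hyps(1) by (cases l) (auto simp: step_def)
  show ?case
  proof (intro exI[of _ "insert c T"] conjI allI impI)
    fix S assume S: "insert c T \<subseteq> S"
    then have "step (C\<lparr>cells := S\<rparr>) lab v l w" using step_sub_mono[OF c(2), of S] by blast
    moreover have "acts (C\<lparr>cells := S\<rparr>) lab w ls u" using T(4) S by blast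
    ultimately show "acts (C\<lparr>cells := S\<rparr>) lab v (l # ls) u" by (rule acts.cons)
  qed (use c T card_insert_le_m1 in \<open>auto simp: card_insert_if\<close>)
qed

lemma acts_traces:
  assumes "v \<in> zcells C" and "\<And>w. w \<in> set ws \<Longrightarrow> acts C lab v w v"
    and m: "length ws \<le> m" "\<And>w. w \<in> set ws \<Longrightarrow> length w \<le> m"
  obtains T where "T \<subseteq> cells C" "finite T" "v \<in> T" "card T \<le> Suc (m * Suc m)"
    "\<And>S w. T \<subseteq> S \<Longrightarrow> w \<in> set ws \<Longrightarrow> acts (C\<lparr>cells := S\<rparr>) lab v w v"
proof -
  have "\<forall>w\<in>set ws. \<exists>T. T \<subseteq> cells C \<and> finite T \<and> card T \<le> Suc (length w) \<and> (\<forall>S. T \<subseteq> S \<longrightarrow> acts (C\<lparr>cells := S\<rparr>) lab v w v)"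
    by (intro ballI acts_trace assms(2))
  then obtain T where T: "\<And>w. w \<in> set ws \<Longrightarrow> T w \<subseteq> cells C \<and> finite (T w) \<and> card (T w) \<le> Suc (length w) \<and> (\<forall>S. T w \<subseteq> S \<longrightarrow> acts (C\<lparr>cells := S\<rparr>) lab v w v)"
    by metis
  have "card (\<Union>w\<in>set ws. T w) \<le> m * Suc m"
  proof (rule card_UN_bound)
    show "card (set ws) \<le> m" using m card_length[of ws] by simp
    show "card (T w) \<le> Suc m" if "w \<in> set ws" for w using T[OF that] m(2)[OF that] by simp
  qed simp
  then have "card (insert v (\<Union>w\<in>set ws. T w)) \<le> Suc (m * Suc m)"
    using T by (auto simp: card_insert_if)
  moreover have "insert v (\<Union>w\<in>set ws. T w) \<subseteq> cells C" using T assms(1) by (auto simp: zcells_def)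
  moreover have "acts (C\<lparr>cells := S\<rparr>) lab v w v" if "insert v (\<Union>w\<in>set ws. T w) \<subseteq> S" "w \<in> set ws" for S w
  proof -
    have "T w \<subseteq> S" using that by blast
    then show ?thesis using T[OF that(2)] by blast
  qed
  ultimately show ?thesis using that[of "insert v (\<Union>w\<in>set ws. T w)"] T by blast
qed

text \<open>Every cell of \<open>C\<close> is detected by a loop at \<open>v\<close>: go to its
  root, read its label, and return. This loop lies in H and so persists in the subcomplex, which
  must then contain a cell with that label and root; by local injectivity this is the given
  cell.\<close>

lemma size_bound:
  assumes conn: "dconnected C" and v: "v \<in> zcells C"
    and gens: "\<And>w. w \<in> set ws \<Longrightarrow> acts C lab v w v"
    and loops: "\<And>u. allowed B u \<Longrightarrow> acts C lab v u v \<Longrightarrow> u \<in> omega_closure B (gen_sub B ws)"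
    and n: "\<forall>b\<in>cells B. cdim B b \<le> n"
    and m: "length ws \<le> m" "\<And>w. w \<in> set ws \<Longrightarrow> length w \<le> m"
  shows "finite (cells C) \<and> card (cells C) \<le> Suc (m * Suc m) * (n + 2) ^ n"
proof -
  obtain T where T: "T \<subseteq> cells C" "finite T" "v \<in> T" "card T \<le> Suc (m * Suc m)"
    and Tacts: "\<And>S w. T \<subseteq> S \<Longrightarrow> w \<in> set ws \<Longrightarrow> acts (C\<lparr>cells := S\<rparr>) lab v w v"
    using acts_traces[OF v gens m] by blast
  have "\<forall>c\<in>cells C. cdim C c \<le> n" using n lab_cell lab_dim by metis
  then obtain S where S: "T \<subseteq> S" "S \<subseteq> cells C" "finite S" "face_closed C S" "card S \<le> card T * (n + 2) ^ n"
    using ex_face_closed[OF delta T(2,1)] by blast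
  interpret D: labeled_complex B "C\<lparr>cells := S\<rparr>" lab
    by unfold_locales (rule labeled_sub[OF lc S(2,4)])
  have vD: "v \<in> zcells (C\<lparr>cells := S\<rparr>)" using v T(3) S(1) by (auto simp: zcells_def)
  have up: "acts C lab a u b" if "acts (C\<lparr>cells := S\<rparr>) lab a u b" for a u b
    using acts_sub_mono[OF that S(2)] by simp
  \<comment> \<open>The generators are loops in the subcomplex by the choice of \<open>T\<close>, so
    \<open>acts_omega\<close> makes every loop of \<open>C\<close> a loop there.\<close>
  have loopD: "acts (C\<lparr>cells := S\<rparr>) lab v u v" if "allowed B u" "acts C lab v u v" for u
    using D.acts_omega[OF vD Tacts[OF S(1)] loops[OF that]] .
  have "c \<in> S" if c: "c \<in> cells C" for c
  proof -
    obtain p where p: "acts C lab v p (root C c)" "allowed B p" "allowed B (winv p)"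
      using connected_acts[OF conn v root_zcell[OF delta c]] .
    show ?thesis
    proof (cases "cdim C c = 0")
      case True
      \<comment> \<open>A 0-cell has no letter of its own; it is detected by going there and
        back.\<close>
      have "acts C lab v (p @ winv p) v" using p(1) by (auto simp: acts_append acts_winv)
      then have "acts (C\<lparr>cells := S\<rparr>) lab v (p @ winv p) v"
        using loopD[of "p @ winv p"] p by (auto simp: allowed_def)
      then obtain x where x: "acts (C\<lparr>cells := S\<rparr>) lab v p x" by (auto simp: D.acts_append)
      then have "x = root C c" using up acts_det p(1) by blast
      then show ?thesis using D.acts_cells[OF x] True by (auto simp: zcells_def root_dim0)
    next
      case False
      then consider "cdim C c = 1" | "2 \<le> cdim C c" by linarith
      then obtain w where w: "step C lab (root C c) (Gen (lab c)) w"
        using step_edge(1)[OF c] step_root[OF c] root_dim1 by metis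
      obtain q where q: "acts C lab v q w" "allowed B q" "allowed B (winv q)"
        using connected_acts[OF conn v step_cells(2)[OF w]] .
      have "lab c \<in> Xs B \<union> Ps B" unfolding Xs_Ps_iff using False lab_cell[OF c] lab_dim[OF c] by simp
      then have "allowed B (p @ [Gen (lab c)] @ winv q)" using p q by (auto simp: allowed_def)
      moreover have "acts C lab v (p @ [Gen (lab c)] @ winv q) v"
        using p(1) q(1) w by (auto simp: acts_append acts_winv acts_Cons)
      ultimately have "acts (C\<lparr>cells := S\<rparr>) lab v (p @ [Gen (lab c)] @ winv q) v" by (rule loopD)
      then obtain x y where xy: "acts (C\<lparr>cells := S\<rparr>) lab v p x" "step (C\<lparr>cells := S\<rparr>) lab x (Gen (lab c)) y"
        by (auto simp: D.acts_append D.acts_Cons)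
      have "x = root C c" using up[OF xy(1)] acts_det p(1) by blast
      with xy(2) have "step (C\<lparr>cells := S\<rparr>) lab (root C c) (Gen (lab c)) y" by simp
      then obtain d where "d \<in> S" "lab d = lab c" "root C d = root C c"
        by (cases rule: D.step_Gen_cases) (auto simp: root_dim1)
      then show ?thesis using root_inj[OF c, of d] S(2) by auto
    qed
  qed
  then have "cells C = S" using S(2) by blast
  moreover have "card T * (n + 2) ^ n \<le> Suc (m * Suc m) * (n + 2) ^ n" using T(4) by (rule mult_right_mono) simp
  ultimately show ?thesis using S by simp
qed

end

section \<open>Simulations between labeled complexes\<close>

definition simulation :: "'c dcx \<Rightarrow> ('c \<Rightarrow> 'a) \<Rightarrow> 'd dcx \<Rightarrow> ('d \<Rightarrow> 'a) \<Rightarrow> ('c \<Rightarrow> 'd) \<Rightarrow> bool" where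
  "simulation D labD C lab h \<longleftrightarrow> (\<forall>a l b. step D labD a l b \<longrightarrow> step C lab (h a) l (h b))"

text \<open>A simulation carries loops to loops, so its existence compares two loop monoids without
  any statement about cells of positive dimension.\<close>

lemma (in labeled_complex) simulation_acts:
  assumes "simulation D labD C lab h" "acts D labD a u b" "h a \<in> zcells C"
  shows "acts C lab (h a) u (h b)"
  using assms(2,3)
proof (induction rule: acts.induct)
  case (cons v l w ls u)
  then have "step C lab (h v) l (h w)" using assms(1) unfolding simulation_def by blast
  then show ?case using cons.IH step_cells acts.cons by metis
qed (rule acts.nil)

text \<open>Choose a path from \<open>v\<close> to each 0-cell and follow the same word from
  \<open>w\<close>. A step of \<open>D\<close> closes two chosen paths to a loop at
  \<open>v\<close>; the corresponding loop at \<open>w\<close> shows that the step is preserved,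
  since the action is deterministic.\<close>

lemma ex_simulation:
  assumes D: "labeled B D labD" and conn: "dconnected D" and v: "v \<in> zcells D"
    and C: "labeled B C lab"
    and loops: "\<And>u. acts D labD v u v \<Longrightarrow> acts C lab w u w"
  obtains h where "simulation D labD C lab h" "h v = w" "\<And>a. a \<in> zcells D \<Longrightarrow> h a \<in> zcells C"
proof -
  interpret D: labeled_complex B D labD by unfold_locales (rule D)
  interpret C: labeled_complex B C lab by unfold_locales (rule C)
  have "\<forall>a\<in>zcells D. \<exists>p. acts D labD v p a" using D.connected_acts[OF conn v] by metis
  then obtain p where p: "\<And>a. a \<in> zcells D \<Longrightarrow> acts D labD v (p a) a" by metis
  have "\<exists>x. acts C lab w (p a) x" if "a \<in> zcells D" for a
    using loops[of "p a @ winv (p a)"] p[OF that] by (auto simp: D.acts_append D.acts_winv C.acts_append)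
  then obtain h where h: "\<And>a. a \<in> zcells D \<Longrightarrow> acts C lab w (p a) (h a)" by metis
  have "simulation D labD C lab h"
    unfolding simulation_def
  proof (intro allI impI)
    fix a l b assume s: "step D labD a l b"
    note ab = D.step_cells[OF s]
    have "acts D labD v (p a @ [l] @ winv (p b)) v"
      using p[OF ab(1)] p[OF ab(2)] s unfolding D.acts_append D.acts_winv D.acts_single by blast
    then have "acts C lab w (p a @ [l] @ winv (p b)) w" by (rule loops)
    then obtain x y where "acts C lab w (p a) x" "step C lab x l y" "acts C lab w (p b) y"
      unfolding C.acts_append C.acts_winv C.acts_single by blast
    then show "step C lab (h a) l (h b)" using C.acts_det h ab by metis
  qed
  moreover have "h v = w"
    using C.acts_det[OF h[OF v] loops[OF p[OF v]]] .
  moreover have "h a \<in> zcells C" if "a \<in> zcells D" for a using C.acts_cells[OF h[OF that]] by blast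
  ultimately show ?thesis using that by blast
qed

section \<open>Transport along isomorphisms\<close>

definition cx_iso :: "('c \<Rightarrow> 'd) \<Rightarrow> 'c dcx \<Rightarrow> ('c \<Rightarrow> 'a) \<Rightarrow> 'd dcx \<Rightarrow> ('d \<Rightarrow> 'a) \<Rightarrow> bool" where
  "cx_iso f D lab D' lab' \<longleftrightarrow> delta_complex D \<and> bij_betw f (cells D) (cells D') \<and>
     (\<forall>c\<in>cells D. cdim D' (f c) = cdim D c \<and> lab' (f c) = lab c \<and>
        (0 < cdim D c \<longrightarrow> (\<forall>i\<le>cdim D c. cface D' i (f c) = f (cface D i c))))"

lemma cx_isoD:
  assumes "cx_iso f D lab D' lab'" "c \<in> cells D"
  shows "f c \<in> cells D'" "cdim D' (f c) = cdim D c" "lab' (f c) = lab c"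
    "0 < cdim D c \<Longrightarrow> i \<le> cdim D c \<Longrightarrow> cface D' i (f c) = f (cface D i c)"
  using assms unfolding cx_iso_def by (auto simp: bij_betw_def)

lemma cx_iso_cells: "cx_iso f D lab D' lab' \<Longrightarrow> cells D' = f ` cells D"
  and cx_iso_inj: "cx_iso f D lab D' lab' \<Longrightarrow> inj_on f (cells D)"
  unfolding cx_iso_def by (auto simp: bij_betw_def)

lemma cx_iso_delta:
  assumes iso: "cx_iso f D lab D' lab'" shows "delta_complex D'"
proof -
  have D: "delta_complex D" using iso unfolding cx_iso_def by simp
  note ff = face_cell[OF D]
  show ?thesis
    unfolding delta_complex_def cx_iso_cells[OF iso]
  proof (intro conjI ballI impI allI; (elim imageE)?; (elim conjE)?)
    fix c' c i assume c: "c' = f c" "c \<in> cells D" "0 < cdim D' c'" "i \<le> cdim D' c'"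
    then have k: "0 < cdim D c" "i \<le> cdim D c" using cx_isoD(2)[OF iso c(2)] by auto
    show "cface D' i c' \<in> f ` cells D" "cdim D' (cface D' i c') = cdim D' c' - 1"
      using c k cx_isoD[OF iso c(2)] ff[OF c(2) k] cx_isoD(2)[OF iso, of "cface D i c"] by auto
  next
    fix c' c i j assume c: "c' = f c" "c \<in> cells D" "2 \<le> cdim D' c'" "i < j" "j \<le> cdim D' c'"
    then have k: "2 \<le> cdim D c" "0 < cdim D c" "i \<le> cdim D c" "j \<le> cdim D c" "i \<le> cdim D c - 1" "j - 1 \<le> cdim D c - 1"
       "0 < cdim D c - 1"
      using cx_isoD(2)[OF iso c(2)] by auto
    have "cface D' i (cface D' j c') = f (cface D i (cface D j c))"
      using c k cx_isoD(4)[OF iso c(2), of j] ff[OF c(2) k(2,4)] cx_isoD(4)[OF iso, of "cface D j c" i] by simp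
    also have "\<dots> = f (cface D (j - 1) (cface D i c))" using face_face[OF D c(2) k(1) c(4) k(4)] by simp
    also have "\<dots> = cface D' (j - 1) (cface D' i c')"
      using c k cx_isoD(4)[OF iso c(2), of i] ff[OF c(2) k(2,3)] cx_isoD(4)[OF iso, of "cface D i c" "j - 1"] by simp
    finally show "cface D' i (cface D' j c') = cface D' (j - 1) (cface D' i c')" .
  qed
qed

text \<open>Inverting the face equations requires that faces of cells of \<open>D\<close> are again
  cells; this is why \<open>cx_iso\<close> includes \<open>delta_complex D\<close>.\<close>

lemma cx_iso_sym:
  assumes iso: "cx_iso f D lab D' lab'" shows "cx_iso (the_inv_into (cells D) f) D' lab' D lab"
proof -
  have D: "delta_complex D" using iso unfolding cx_iso_def by simp
  let ?g = "the_inv_into (cells D) f"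
  have g: "?g (f c) = c" if "c \<in> cells D" for c using the_inv_into_f_f[OF cx_iso_inj[OF iso] that] .
  have "bij_betw ?g (cells D') (cells D)"
    using iso unfolding cx_iso_def by (auto intro: bij_betw_the_inv_into)
  then show ?thesis
    unfolding cx_iso_def using cx_iso_delta[OF iso]
    by (auto simp: cx_iso_cells[OF iso] g cx_isoD[OF iso] face_cell[OF D])
qed

lemma cx_iso_vtx:
  assumes iso: "cx_iso f D lab D' lab'" and "c \<in> cells D" "cdim D c = n" "j \<le> n"
  shows "vtx D n c j \<in> cells D \<and> vtx D' n (f c) j = f (vtx D n c j)"
  using assms(2-)
proof (induction n arbitrary: c j)
  case (Suc n)
  have D: "delta_complex D" using iso unfolding cx_iso_def by simp
  show ?case
    using Suc.IH[of "cface D (Suc n) c" j] Suc.IH[of "cface D 0 c" "j - 1"] Suc.prems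
      face_cell[OF D, of c 0] face_cell[OF D, of c "Suc n"] cx_isoD(4)[OF iso Suc.prems(1)]
    by auto
qed simp

lemma cx_iso_vertex:
  assumes "cx_iso f D lab D' lab'" "c \<in> cells D" "j \<le> cdim D c"
  shows "vertex D c j \<in> cells D" "vertex D' (f c) j = f (vertex D c j)"
  using cx_iso_vtx[OF assms(1,2) HOL.refl assms(3)] cx_isoD(2)[OF assms(1,2)] unfolding vertex_def by auto

lemma cx_iso_labeled:
  assumes iso: "cx_iso f D lab D' lab'" and L: "labeled B D lab"
  shows "labeled B D' lab'"
proof -
  interpret labeled_complex B D lab by unfold_locales (rule L)
  show ?thesis
    unfolding labeled_def cx_iso_cells[OF iso]
  proof (intro conjI ballI impI allI; (elim imageE)?; (elim conjE exE)?)
    show "delta_complex D'" by (rule cx_iso_delta[OF iso])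
  next
    fix c' c assume c: "c' = f c" "c \<in> cells D"
    show "lab' c' \<in> cells B" "cdim B (lab' c') = cdim D' c'"
      using cx_isoD[OF iso c(2)] lab_cell[OF c(2)] lab_dim[OF c(2)] c(1) by auto
  next
    fix c' c i assume c: "c' = f c" "c \<in> cells D" "0 < cdim D' c'" "i \<le> cdim D' c'"
    then show "lab' (cface D' i c') = cface B i (lab' c')"
      using cx_isoD[OF iso c(2)] lab_face[OF c(2)] face_cell(1)[OF delta c(2), of i]
        cx_isoD(3)[OF iso, of "cface D i c"] by simp
  next
    fix c' c d' d j
    assume c: "c' = f c" "c \<in> cells D" and d: "d' = f d" "d \<in> cells D"
      and e: "cdim D' c' = cdim D' d'" "lab' c' = lab' d'" "j \<le> cdim D' c'" "vertex D' c' j = vertex D' d' j"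
    have "c = d"
    proof (rule local_inj[OF c(2) d(2)])
      show j: "lab c = lab d" "j \<le> cdim D c" using c d e cx_isoD[OF iso] by auto
      then have "f (vertex D c j) = f (vertex D d j)"
        using cx_iso_vertex(2)[OF iso c(2), of j] cx_iso_vertex(2)[OF iso d(2), of j] c d e
          cx_isoD(2)[OF iso c(2)] cx_isoD(2)[OF iso d(2)] by simp
      then show "vertex D c j = vertex D d j"
        using inj_onD[OF cx_iso_inj[OF iso]] cx_iso_vertex(1)[OF iso] j c d e
          cx_isoD(2)[OF iso c(2)] cx_isoD(2)[OF iso d(2)] by metis
    qed
    then show "c' = d'" using c d by simp
  qed
qed

lemma cx_iso_zcells:
  assumes iso: "cx_iso f D lab D' lab'" shows "zcells D' = f ` zcells D"
  unfolding zcells_def cx_iso_cells[OF iso] using cx_isoD(2)[OF iso] by auto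

lemma cx_iso_step:
  assumes iso: "cx_iso f D lab D' lab'" and s: "step D lab v l w"
  shows "step D' lab' (f v) l (f w)"
proof -
  have r: "root D' (f c) = f (root D c)" if "c \<in> cells D" for c
    using cx_iso_vertex(2)[OF iso that, of 0] unfolding root_def by simp
  note i = cx_isoD[OF iso]
  have e: "f c \<in> cells D' \<and> cdim D' (f c) = 1 \<and> lab' (f c) = lab c \<and>
      cface D' 1 (f c) = f (cface D 1 c) \<and> cface D' 0 (f c) = f (cface D 0 c)"
    if "c \<in> cells D" "cdim D c = 1" for c using i[OF that(1)] that by simp
  have p: "f c \<in> cells D' \<and> 2 \<le> cdim D' (f c) \<and> lab' (f c) = lab c \<and> root D' (f c) = f (root D c)"
    if "c \<in> cells D" "2 \<le> cdim D c" for c using i[OF that(1)] that r by simp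
  show ?thesis using s e p unfolding step_def by (cases l) (simp_all, blast+)
qed

lemma cx_iso_acts:
  assumes iso: "cx_iso f D lab D' lab'" shows "acts D lab v u w \<Longrightarrow> acts D' lab' (f v) u (f w)"
proof (induction rule: acts.induct)
  case (nil v)
  then show ?case using cx_iso_zcells[OF iso] by (auto intro: acts.nil)
next
  case (cons v l w u x)
  then show ?case using cx_iso_step[OF iso] by (blast intro: acts.cons)
qed

lemma cx_iso_acts_iff:
  assumes iso: "cx_iso f D lab D' lab'" and vw: "v \<in> cells D" "w \<in> cells D"
  shows "acts D' lab' (f v) u (f w) \<longleftrightarrow> acts D lab v u w"
  using cx_iso_acts[OF iso] cx_iso_acts[OF cx_iso_sym[OF iso], of "f v" u "f w"]
    the_inv_into_f_f[OF cx_iso_inj[OF iso]] vw by auto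

lemma cx_iso_connected:
  assumes iso: "cx_iso f D lab D' lab'" and conn: "dconnected D" shows "dconnected D'"
proof -
  have adj: "(f a, f b) \<in> adj D'" if "(a, b) \<in> adj D" for a b
  proof -
    from that obtain e where e: "e \<in> cells D" "cdim D e = 1"
      and ab: "(cface D 1 e = a \<and> cface D 0 e = b) \<or> (cface D 1 e = b \<and> cface D 0 e = a)"
      unfolding adj_def by auto
    have "f e \<in> cells D'" "cdim D' (f e) = 1" "cface D' 1 (f e) = f (cface D 1 e)" "cface D' 0 (f e) = f (cface D 0 e)"
      using cx_isoD[OF iso e(1)] e by auto
    then show ?thesis using ab unfolding adj_def by blast
  qed
  have "(f a, f b) \<in> (adj D')\<^sup>*" if "(a, b) \<in> (adj D)\<^sup>*" for a b
    using that(1)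
  proof (induction rule: rtrancl_induct)
    case (step y z)
    then show ?case using adj by (meson rtrancl_into_rtrancl)
  qed simp
  then show ?thesis using conn unfolding dconnected_adj cx_iso_zcells[OF iso] by blast
qed

section \<open>Coded complexes\<close>

definition dimN :: "nat \<Rightarrow> nat \<Rightarrow> nat" where "dimN c i = pfst (lnth c i)"
definition labN :: "nat \<Rightarrow> nat \<Rightarrow> nat" where "labN c i = pfst (psnd (lnth c i))"
definition facesN :: "nat \<Rightarrow> nat \<Rightarrow> nat" where "facesN c i = psnd (psnd (lnth c i))"
definition faceN :: "nat \<Rightarrow> nat \<Rightarrow> nat \<Rightarrow> nat" where "faceN c k i = lnth (facesN c i) k"

definition cxN :: "nat \<Rightarrow> nat dcx" where
  "cxN c = \<lparr>cells = {..<llen c}, cdim = dimN c, cface = faceN c\<rparr>"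

lemma cxN_simps [simp]: "cells (cxN c) = {..<llen c}" "cdim (cxN c) = dimN c" "cface (cxN c) = faceN c"
  by (simp_all add: cxN_def)

lemma comp_dimN [comp_intro]: "computable1 f \<Longrightarrow> computable1 g \<Longrightarrow> computable1 (\<lambda>e. dimN (f e) (g e))"
  unfolding dimN_def by (intro comp_intro)

lemma comp_labN [comp_intro]: "computable1 f \<Longrightarrow> computable1 g \<Longrightarrow> computable1 (\<lambda>e. labN (f e) (g e))"
  unfolding labN_def by (intro comp_intro)

lemma comp_facesN [comp_intro]: "computable1 f \<Longrightarrow> computable1 g \<Longrightarrow> computable1 (\<lambda>e. facesN (f e) (g e))"
  unfolding facesN_def by (intro comp_intro)

lemma comp_faceN [comp_intro]:
  "computable1 f \<Longrightarrow> computable1 g \<Longrightarrow> computable1 h \<Longrightarrow> computable1 (\<lambda>e. faceN (f e) (g e) (h e))"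
  unfolding faceN_def by (intro comp_intro)

definition vertexN :: "nat \<Rightarrow> nat \<Rightarrow> nat \<Rightarrow> nat" where
  "vertexN c i j = vertex (cxN c) i j"

text \<open>\<open>vtx\<close> recurses with changing cell and position. Iterating on the pair of
  both, with \<open>n - k\<close> as the dimension reached after \<open>k\<close> rounds, makes it a
  primitive recursion.\<close>

lemma vtx_iterate:
  defines "s \<equiv> \<lambda>c n i j. rec_nat (prod_encode (i, j))
      (\<lambda>k s. if psnd s \<le> n - Suc k then prod_encode (faceN c (n - k) (pfst s), psnd s)
              else prod_encode (faceN c 0 (pfst s), psnd s - 1))"
  shows "vtx (cxN c) n i j = pfst (s c n i j n)"
proof -
  have "vtx (cxN c) (n - k) (pfst (s c n i j k)) (psnd (s c n i j k)) = vtx (cxN c) n i j" if "k \<le> n" for k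
    using that
  proof (induction k)
    case 0
    then show ?case by (simp add: s_def)
  next
    case (Suc k)
    then have "n - k = Suc (n - Suc k)" by simp
    with Suc show ?case by (simp add: s_def Let_def split: if_splits)
  qed
  from this[of n] show ?thesis by simp
qed

lemma comp_vertexN [comp_intro]:
  assumes "computable1 f" "computable1 g" "computable1 h"
  shows "computable1 (\<lambda>e. vertexN (f e) (g e) (h e))"
proof -
  have "computable1 (\<lambda>e. vertexN (pfst e) (pfst (psnd e)) (psnd (psnd e)))"
    unfolding vertexN_def vertex_def vtx_iterate cxN_simps by (intro comp_intro dec_intro)
  from comp_comp[OF this, of "\<lambda>e. prod_encode (f e, prod_encode (g e, h e))"]
  show ?thesis by (simp add: assms comp_intro)
qed

definition stepN :: "nat \<Rightarrow> nat \<Rightarrow> nat \<Rightarrow> nat \<Rightarrow> bool" where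
  "stepN c v l w \<longleftrightarrow> (\<exists>e<llen c.
     (dimN c e = 1 \<and> (l = 2 * labN c e \<and> faceN c 1 e = v \<and> faceN c 0 e = w \<or>
                        l = 2 * labN c e + 1 \<and> faceN c 1 e = w \<and> faceN c 0 e = v)) \<or>
     (2 \<le> dimN c e \<and> (l = 2 * labN c e \<or> l = 2 * labN c e + 1) \<and> vertexN c e 0 = v \<and> w = v))"

lemma dec_stepN [dec_intro]:
  assumes "computable1 f" "computable1 g" "computable1 h" "computable1 k"
  shows "dec (\<lambda>e. stepN (f e) (g e) (h e) (k e))"
proof -
  have "dec (\<lambda>e. stepN (pfst e) (pfst (psnd e)) (pfst (psnd (psnd e))) (psnd (psnd (psnd e))))"
    unfolding stepN_def by (intro comp_intro dec_intro)
  from dec_comp[OF this, of "\<lambda>e. prod_encode (f e, prod_encode (g e, prod_encode (h e, k e)))"]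
  show ?thesis by (simp add: assms comp_intro)
qed

text \<open>The whole path is guessed as a list \<open>t\<close> of the 0-cells visited, one more
  than there are letters, so the inductive \<open>acts\<close> becomes a bounded search.\<close>

definition actsN :: "nat \<Rightarrow> nat \<Rightarrow> nat \<Rightarrow> nat \<Rightarrow> bool" where
  "actsN c v u w \<longleftrightarrow> v < llen c \<and> dimN c v = 0 \<and> (\<exists>t\<le>lrep (Suc (llen u)) (llen c).
     lnth t 0 = v \<and> lnth t (llen u) = w \<and>
     (\<forall>i<llen u. stepN c (lnth t i) (lnth u i) (lnth t (Suc i))))"

lemma dec_actsN [dec_intro]:
  assumes "computable1 f" "computable1 g" "computable1 h" "computable1 k"
  shows "dec (\<lambda>e. actsN (f e) (g e) (h e) (k e))"
proof -
  have "dec (\<lambda>e. actsN (pfst e) (pfst (psnd e)) (pfst (psnd (psnd e))) (psnd (psnd (psnd e))))"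
    unfolding actsN_def by (intro comp_intro dec_intro)
  from dec_comp[OF this, of "\<lambda>e. prod_encode (f e, prod_encode (g e, prod_encode (h e, k e)))"]
  show ?thesis by (simp add: assms comp_intro)
qed

text \<open>Connectedness dually: every set of cells that contains \<open>v\<close> and is closed
  along edges contains all 0-cells. Membership is the value 1 in the list \<open>s\<close>, and
  characteristic lists have codes below the bound, so no bound on path lengths enters.\<close>

definition connN :: "nat \<Rightarrow> nat \<Rightarrow> bool" where
  "connN c v \<longleftrightarrow> (\<forall>s\<le>lrep (llen c) 1.
     lnth s v = 1 \<and> (\<forall>e<llen c. dimN c e = 1 \<longrightarrow> (lnth s (faceN c 1 e) = 1 \<longleftrightarrow> lnth s (faceN c 0 e) = 1))
     \<longrightarrow> (\<forall>a<llen c. dimN c a = 0 \<longrightarrow> lnth s a = 1))"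

lemma dec_connN [dec_intro]:
  assumes "computable1 f" "computable1 g" shows "dec (\<lambda>e. connN (f e) (g e))"
proof -
  have "dec (\<lambda>e. connN (pfst e) (psnd e))"
    unfolding connN_def by (intro comp_intro dec_intro)
  from dec_comp[OF this, of "\<lambda>e. prod_encode (f e, g e)"]
  show ?thesis by (simp add: assms comp_intro)
qed

lemma connN_iff:
  assumes D: "delta_complex (cxN c)" and v: "v \<in> zcells (cxN c)"
  shows "connN c v \<longleftrightarrow> dconnected (cxN c)"
proof
  assume conn: "dconnected (cxN c)"
  show "connN c v"
    unfolding connN_def
  proof (intro allI impI, elim conjE)
    fix s a assume s: "lnth s v = 1"
      "\<forall>e<llen c. dimN c e = 1 \<longrightarrow> (lnth s (faceN c 1 e) = 1) = (lnth s (faceN c 0 e) = 1)"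
      and a: "a < llen c" "dimN c a = 0"
    then have "(v, a) \<in> (adj (cxN c))\<^sup>*"
      using conn v unfolding dconnected_adj by (auto simp: zcells_def)
    then show "lnth s a = 1"
    proof (induction rule: rtrancl_induct)
      case (step y z)
      then show ?case using s(2) by (auto simp: adj_def)
    qed (rule s(1))
  qed
next
  assume conn: "connN c v"
  define R where "R = (adj (cxN c))\<^sup>*"
  define s where "s = list_encode (map (\<lambda>i. of_bool ((v, i) \<in> R)) [0..<llen c])"
  have s: "lnth s i = of_bool ((v, i) \<in> R)" if "i < llen c" for i
    unfolding s_def using that by (simp add: lnth_encode)
  have "s \<le> lrep (llen c) 1" unfolding s_def by (intro list_encode_le_lrep) auto
  moreover have "lnth s v = 1" using s[of v] v by (auto simp: zcells_def R_def)
  moreover have "lnth s (faceN c 1 e) = 1 \<longleftrightarrow> lnth s (faceN c 0 e) = 1" if e: "e < llen c" "dimN c e = 1" for e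
  proof -
    have f: "faceN c 1 e < llen c" "faceN c 0 e < llen c"
      using face_cell(1)[OF D, of e 0] face_cell(1)[OF D, of e 1] e by auto
    have "(faceN c 1 e, faceN c 0 e) \<in> adj (cxN c)" "(faceN c 0 e, faceN c 1 e) \<in> adj (cxN c)"
      using e unfolding adj_def by auto
    then have "(v, faceN c 1 e) \<in> R \<longleftrightarrow> (v, faceN c 0 e) \<in> R"
      unfolding R_def by (blast intro: rtrancl_into_rtrancl)
    then show ?thesis using s f by simp
  qed
  ultimately have *: "\<forall>a<llen c. dimN c a = 0 \<longrightarrow> lnth s a = 1" using conn unfolding connN_def by blast
  have "(v, a) \<in> R" if "a \<in> zcells (cxN c)" for a
  proof -
    have "a < llen c" "lnth s a = 1" using * that by (auto simp: zcells_def)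
    then show ?thesis using s[of a] by (cases "(v, a) \<in> R") auto
  qed
  then show "dconnected (cxN c)" unfolding R_def by (rule dconnectedI[OF v])
qed

section \<open>Recognizing codes of complexes labeled over a finite B\<close>

locale finite_B =
  fixes B :: "'a dcx" and enc :: "'a \<Rightarrow> nat"
  assumes Bc: "B_complex B" and finX: "finite (Xs B)" and finP: "finite (Ps B)"
    and inj: "inj_on enc (cells B)"
begin

lemma Bdelta: "delta_complex B"
  using Bc unfolding B_complex_def by simp

lemma finite_cells: "finite (cells B)"
proof -
  have "finite (zcells B)" using Bc unfolding B_complex_def by (metis card.infinite zero_neq_one)
  moreover have "cells B \<subseteq> zcells B \<union> Xs B \<union> Ps B" by (auto simp: zcells_def Xs_def Ps_def)
  ultimately show ?thesis using finX finP by (meson finite_UnI finite_subset)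
qed

definition dB :: nat where "dB = (SOME n. \<forall>c\<in>cells B. cdim B c \<le> n)"
definition unenc :: "nat \<Rightarrow> 'a" where "unenc = the_inv_into (cells B) enc"
definition codes :: "nat set" where "codes = enc ` cells B"
definition labD :: "nat \<Rightarrow> nat \<Rightarrow> 'a" where "labD c i = unenc (labN c i)"

lemma dB: "\<forall>c\<in>cells B. cdim B c \<le> dB"
  using someI_ex[of "\<lambda>n. \<forall>c\<in>cells B. cdim B c \<le> n"] Bc unfolding dB_def B_complex_def by blast

lemma unenc_enc [simp]: "b \<in> cells B \<Longrightarrow> unenc (enc b) = b"
  unfolding unenc_def by (rule the_inv_into_f_f[OF inj])

lemma codesE: "n \<in> codes \<Longrightarrow> unenc n \<in> cells B \<and> enc (unenc n) = n"
  unfolding codes_def by auto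

lemma finite_codes: "finite codes"
  unfolding codes_def using finite_cells by simp

definition bdim :: "nat \<Rightarrow> nat" where
  "bdim n = (if n \<in> codes then cdim B (unenc n) else 0)"

text \<open>Cutting off at \<open>dB\<close> gives finite support, so the face table of
  \<open>B\<close> can be hard-wired.\<close>

definition bface :: "nat \<Rightarrow> nat \<Rightarrow> nat" where
  "bface k n = (if n \<in> codes \<and> k \<le> dB then enc (cface B k (unenc n)) else 0)"

lemma comp_bdim [comp_intro]:
  assumes "computable1 f" shows "computable1 (\<lambda>e. bdim (f e))"
proof -
  have "computable1 bdim" by (rule comp_finite_support[OF finite_codes]) (simp add: bdim_def)
  from comp_comp[OF this assms] show ?thesis .
qed

lemma comp_bface [comp_intro]:
  assumes "computable1 f" "computable1 g" shows "computable1 (\<lambda>e. bface (f e) (g e))"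
proof -
  have "computable1 (\<lambda>e. bface (pfst e) (psnd e))"
  proof (rule comp_finite_support)
    show "finite (prod_encode ` ({..dB} \<times> codes))" using finite_codes by simp
    fix x assume "x \<notin> prod_encode ` ({..dB} \<times> codes)"
    then have "\<not> (psnd x \<in> codes \<and> pfst x \<le> dB)"
      by (metis SigmaI atMost_iff image_eqI prod_encode_pfst_psnd)
    then show "bface (pfst x) (psnd x) = 0" by (auto simp: bface_def)
  qed
  from comp_comp[OF this, of "\<lambda>e. prod_encode (f e, g e)"] show ?thesis by (simp add: assms comp_intro)
qed

lemma dec_codes [dec_intro]: "computable1 f \<Longrightarrow> dec (\<lambda>e. f e \<in> codes)"
  using dec_comp[OF dec_finite[OF finite_codes]] .

text \<open>Besides being labeled over \<open>B\<close>, a code must use genuine labels and list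
  enough faces: labels outside \<open>codes\<close> could not be decoded, and beyond the end of a
  face list \<open>lnth\<close> need not agree with list lookup.\<close>

definition okN :: "nat \<Rightarrow> bool" where
  "okN c \<longleftrightarrow> (\<forall>i<llen c. labN c i \<in> codes \<and> bdim (labN c i) = dimN c i \<and>
      (0 < dimN c i \<longrightarrow> dimN c i < llen (facesN c i) \<and> (\<forall>k\<le>dimN c i. faceN c k i < llen c \<and>
          dimN c (faceN c k i) = dimN c i - 1 \<and> labN c (faceN c k i) = bface k (labN c i))) \<and>
      (2 \<le> dimN c i \<longrightarrow> (\<forall>m\<le>dimN c i. \<forall>k<m. faceN c k (faceN c m i) = faceN c (m - 1) (faceN c k i)))) \<and>
   (\<forall>i<llen c. \<forall>i'<llen c. dimN c i = dimN c i' \<and> labN c i = labN c i' \<and>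
      (\<exists>j\<le>dimN c i. vertexN c i j = vertexN c i' j) \<longrightarrow> i = i')"

lemma dec_okN [dec_intro]:
  assumes "computable1 f" shows "dec (\<lambda>e. okN (f e))"
proof -
  have "dec (\<lambda>e. okN e)" unfolding okN_def by (intro comp_intro dec_intro)
  from dec_comp[OF this assms] show ?thesis .
qed

lemma okN_iff:
  "okN c \<longleftrightarrow> labeled B (cxN c) (labD c) \<and>
     (\<forall>i<llen c. labN c i \<in> codes \<and> (0 < dimN c i \<longrightarrow> dimN c i < llen (facesN c i)))"
  (is "_ \<longleftrightarrow> ?R")
proof -
  have lab_eq: "labN c i = labN c j \<longleftrightarrow> labD c i = labD c j" if "labN c i \<in> codes" "labN c j \<in> codes" for i j
    unfolding labD_def using that codesE by metis
  have face_eq: "labN c j = bface k (labN c i) \<longleftrightarrow> labD c j = cface B k (labD c i)"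
    if "labN c i \<in> codes" "labN c j \<in> codes" "bdim (labN c i) = dimN c i" "0 < dimN c i" "k \<le> dimN c i" for i j k
  proof -
    have u: "unenc (labN c i) \<in> cells B" "cdim B (unenc (labN c i)) = dimN c i"
      using that codesE by (auto simp: bdim_def)
    then have "k \<le> dB" "cface B k (unenc (labN c i)) \<in> cells B"
      using dB that face_cell(1)[OF Bdelta u(1)] by fastforce+
    then show ?thesis unfolding labD_def using that codesE[of "labN c j"] by (auto simp: bface_def)
  qed
  show ?thesis
  proof
    assume ok: "okN c"
    have 1: "labN c i \<in> codes" "bdim (labN c i) = dimN c i"
      "0 < dimN c i \<Longrightarrow> dimN c i < llen (facesN c i)" if "i < llen c" for i
      using ok that unfolding okN_def by auto
    have 2: "faceN c k i < llen c" "dimN c (faceN c k i) = dimN c i - 1" "labN c (faceN c k i) = bface k (labN c i)"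
      if "i < llen c" "0 < dimN c i" "k \<le> dimN c i" for i k
      using ok that unfolding okN_def by auto
    have 3: "faceN c k (faceN c m i) = faceN c (m - 1) (faceN c k i)"
      if "i < llen c" "2 \<le> dimN c i" "m \<le> dimN c i" "k < m" for i m k
      using ok that unfolding okN_def by auto
    have 4: "i = i'" if "i < llen c" "i' < llen c" "dimN c i = dimN c i'" "labN c i = labN c i'"
      "j \<le> dimN c i" "vertexN c i j = vertexN c i' j" for i i' j
      using ok that unfolding okN_def by blast
    have "labeled B (cxN c) (labD c)"
      unfolding labeled_def delta_complex_def cxN_simps
    proof (intro conjI ballI allI impI; (elim conjE exE)?)
      fix i assume "i \<in> {..<llen c}"
      then have i: "i < llen c" by simp
      show "labD c i \<in> cells B" "cdim B (labD c i) = dimN c i"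
        using 1[OF i] codesE unfolding labD_def by (auto simp: bdim_def)
    next
      fix i k assume "i \<in> {..<llen c}" "0 < dimN c i" "k \<le> dimN c i"
      then have i: "i < llen c" "0 < dimN c i" "k \<le> dimN c i" by simp_all
      show "faceN c k i \<in> {..<llen c}" "dimN c (faceN c k i) = dimN c i - 1" using 2[OF i] by simp_all
      show "labD c (faceN c k i) = cface B k (labD c i)"
        using face_eq[OF 1(1)[OF i(1)] 1(1)[OF 2(1)[OF i]] 1(2)[OF i(1)] i(2,3)] 2(3)[OF i] by blast
    next
      fix i i' j assume *: "i \<in> {..<llen c}" "i' \<in> {..<llen c}" "dimN c i = dimN c i'" "labD c i = labD c i'"
        "j \<le> dimN c i" "vertex (cxN c) i j = vertex (cxN c) i' j"
      then show "i = i'" using 4[of i i' j] lab_eq 1 by (simp add: vertexN_def)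
    qed (use 3 in simp)
    then show ?R using 1 by simp
  next
    assume R: ?R
    interpret labeled_complex B "cxN c" "labD c" by unfold_locales (use R in simp)
    have 1: "labN c i \<in> codes" "bdim (labN c i) = dimN c i"
      "0 < dimN c i \<Longrightarrow> dimN c i < llen (facesN c i)" if "i < llen c" for i
      using R that lab_dim[of i] by (auto simp: bdim_def labD_def)
    have 2: "faceN c k i < llen c" "dimN c (faceN c k i) = dimN c i - 1"
      "labD c (faceN c k i) = cface B k (labD c i)" if "i < llen c" "0 < dimN c i" "k \<le> dimN c i" for i k
      using face_cell[OF delta, of i k] lab_face[of i k] that by auto
    have 3: "labN c (faceN c k i) = bface k (labN c i)" if "i < llen c" "0 < dimN c i" "k \<le> dimN c i" for i k
      using face_eq[OF 1(1)[OF that(1)] 1(1)[OF 2(1)[OF that]] 1(2)[OF that(1)] that(2,3)] 2(3)[OF that]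
      by blast
    show "okN c"
      unfolding okN_def
    proof (intro conjI allI impI; (elim conjE exE)?)
      fix i m k assume "i < llen c" "2 \<le> dimN c i" "m \<le> dimN c i" "k < m"
      then show "faceN c k (faceN c m i) = faceN c (m - 1) (faceN c k i)"
        using face_face[OF delta, of i k m] by simp
    next
      fix i i' j assume *: "i < llen c" "i' < llen c" "dimN c i = dimN c i'" "labN c i = labN c i'"
        "j \<le> dimN c i" "vertexN c i j = vertexN c i' j"
      then show "i = i'" using local_inj[of i i' j] by (simp add: labD_def vertexN_def)
    qed (use 1 2 3 in simp_all)
  qed
qed

lemma code_letter_simps [simp]: "code_letter enc (Gen a) = 2 * enc a" "code_letter enc (InvGen a) = 2 * enc a + 1"
  by (simp_all add: code_letter_def)

lemma stepN_iff:
  assumes ok: "okN c" and l: "good B [l]"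
  shows "stepN c v (code_letter enc l) w \<longleftrightarrow> step (cxN c) (labD c) v l w"
proof -
  have lab: "enc a = labN c e \<longleftrightarrow> labD c e = a" if "e < llen c" "a \<in> cells B" for e a
  proof -
    have "labN c e \<in> codes" using ok that unfolding okN_iff by blast
    then show ?thesis unfolding labD_def using codesE unenc_enc[OF that(2)] by metis
  qed
  have odd: "2 * m \<noteq> Suc (2 * n)" for m n :: nat by presburger
  show ?thesis
  proof (cases l)
    case (Gen a)
    then have "a \<in> cells B" using l by (auto simp: Xs_def Ps_def)
    then show ?thesis using Gen lab odd by (auto simp: stepN_def step_def root_def vertexN_def)
  next
    case (InvGen a)
    then have "a \<in> cells B" using l by (auto simp: Xs_def Ps_def)
    then show ?thesis using InvGen lab odd[symmetric] by (auto simp: stepN_def step_def root_def vertexN_def)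
  qed
qed

text \<open>Conversely to coding letters, every number that labels a step is the code of a letter;
  this is needed because \<open>simN\<close> ranges over numbers.\<close>

lemma stepN_letter:
  assumes ok: "okN c" and s: "stepN c v n w"
  obtains l where "n = code_letter enc l" "good B [l]"
proof -
  obtain e where e: "e < llen c" "0 < dimN c e" "n = 2 * labN c e \<or> n = 2 * labN c e + 1"
    using s unfolding stepN_def by fastforce
  interpret labeled_complex B "cxN c" "labD c" by unfold_locales (use ok okN_iff in blast)
  have "labD c e \<in> Xs B \<union> Ps B" using lab_cell[of e] lab_dim[of e] e unfolding Xs_Ps_iff by simp
  moreover have "labN c e = enc (labD c e)" using ok e codesE unfolding okN_iff labD_def by auto
  ultimately show ?thesis using e(3) that[of "Gen (labD c e)"] that[of "InvGen (labD c e)"] by auto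
qed

text \<open>The auxiliary facts \<open>1\<close> and \<open>2\<close> translate between a list of
  visited 0-cells and a derivation of \<open>acts\<close>; all entries are below
  \<open>llen c\<close>, so the list lies within the search bound of \<open>actsN\<close>.\<close>

lemma actsN_iff:
  assumes ok: "okN c" and u: "good B u"
  shows "actsN c v (code_word enc u) w \<longleftrightarrow> acts (cxN c) (labD c) v u w"
proof -
  interpret labeled_complex B "cxN c" "labD c" by unfold_locales (use ok okN_iff in blast)
  have len: "llen (code_word enc u) = length u" unfolding code_word_def by simp
  have nth: "lnth (code_word enc u) i = code_letter enc (u ! i)" if "i < length u" for i
    unfolding code_word_def using that by (simp add: lnth_encode)
  have good: "good B [u ! i]" if "i < length u" for i
    using u that nth_mem unfolding good_def by fastforce
  have 1: "acts (cxN c) (labD c) (f 0) q (f (length q))"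
    if "f 0 \<in> zcells (cxN c)" "\<And>i. i < length q \<Longrightarrow> step (cxN c) (labD c) (f i) (q ! i) (f (Suc i))" for f q
    using that
  proof (induction q arbitrary: f)
    case (Cons l q)
    have s: "step (cxN c) (labD c) (f 0) l (f (Suc 0))" using Cons.prems(2)[of 0] by simp
    have "acts (cxN c) (labD c) ((f \<circ> Suc) 0) q ((f \<circ> Suc) (length q))"
    proof (rule Cons.IH)
      show "(f \<circ> Suc) 0 \<in> zcells (cxN c)" using step_cells[OF s] by simp
      show "step (cxN c) (labD c) ((f \<circ> Suc) i) (q ! i) ((f \<circ> Suc) (Suc i))" if "i < length q" for i
        using Cons.prems(2)[of "Suc i"] that by simp
    qed
    then show ?case using s by (auto intro: acts.cons)
  qed simp
  have 2: "\<exists>ts. length ts = Suc (length q) \<and> ts ! 0 = x \<and> ts ! length q = w \<and> (\<forall>y\<in>set ts. y \<le> llen c) \<and>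
      (\<forall>i<length q. step (cxN c) (labD c) (ts ! i) (q ! i) (ts ! Suc i))"
    if "acts (cxN c) (labD c) x q w" for x q
    using that
  proof (induction rule: acts.induct)
    case (nil v)
    then show ?case by (intro exI[of _ "[v]"]) (auto simp: zcells_def)
  next
    case (cons v l y ls u)
    then obtain ts where ts: "length ts = Suc (length ls)" "ts ! 0 = y" "ts ! length ls = u" "\<forall>y\<in>set ts. y \<le> llen c"
      "\<forall>i<length ls. step (cxN c) (labD c) (ts ! i) (ls ! i) (ts ! Suc i)" by blast
    show ?case
    proof (intro exI[of _ "v # ts"] conjI allI impI)
      show "\<forall>y\<in>set (v # ts). y \<le> llen c" using ts step_cells[OF cons.hyps(1)] by (auto simp: zcells_def)
      fix i assume "i < length (l # ls)"
      then show "step (cxN c) (labD c) ((v # ts) ! i) ((l # ls) ! i) ((v # ts) ! Suc i)"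
        using ts cons.hyps(1) by (cases i) auto
    qed (use ts in auto)
  qed
  show ?thesis
  proof
    assume "actsN c v (code_word enc u) w"
    then obtain t where t: "v < llen c" "dimN c v = 0" "lnth t 0 = v" "lnth t (length u) = w"
      "\<forall>i<length u. stepN c (lnth t i) (lnth (code_word enc u) i) (lnth t (Suc i))"
      unfolding actsN_def len by blast
    have "step (cxN c) (labD c) (lnth t i) (u ! i) (lnth t (Suc i))" if "i < length u" for i
      using t(5)[rule_format, OF that] unfolding nth[OF that] stepN_iff[OF ok good[OF that]] .
    then show "acts (cxN c) (labD c) v u w"
      using 1[of "lnth t" u] t by (auto simp: zcells_def)
  next
    assume a: "acts (cxN c) (labD c) v u w"
    obtain ts where ts: "length ts = Suc (length u)" "ts ! 0 = v" "ts ! length u = w" "\<forall>y\<in>set ts. y \<le> llen c"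
      "\<forall>i<length u. step (cxN c) (labD c) (ts ! i) (u ! i) (ts ! Suc i)" using 2[OF a] by blast
    show "actsN c v (code_word enc u) w"
      unfolding actsN_def len
    proof (intro conjI exI[of _ "list_encode ts"] allI impI)
      show "v < llen c" "dimN c v = 0" using acts_cells[OF a] by (auto simp: zcells_def)
      show "list_encode ts \<le> lrep (Suc (length u)) (llen c)"
        using ts by (intro list_encode_le_lrep) auto
      show "stepN c (lnth (list_encode ts) i) (lnth (code_word enc u) i) (lnth (list_encode ts) (Suc i))"
        if "i < length u" for i
        using ts nth[OF that] stepN_iff[OF ok good[OF that]] that by (simp add: lnth_encode)
    qed (use ts in \<open>simp_all add: lnth_encode\<close>)
  qed
qed

end

section \<open>Effective procedures\<close>

context finite_B
begin

text \<open>A constant above the codes of all letters over \<open>B\<close>, so that quantification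
  over letters is bounded.\<close>

definition Lmax :: nat where "Lmax = Suc (2 * Max (insert 0 codes))"

lemma good_letter_le:
  assumes "good B [l]" shows "code_letter enc l \<le> Lmax"
proof -
  have "2 * enc a \<le> Lmax \<and> Suc (2 * enc a) \<le> Lmax" if "a \<in> Xs B \<union> Ps B" for a
  proof -
    have "enc a \<le> Max (insert 0 codes)"
      using that finite_codes Xs_Ps_iff[of a B] by (intro Max_ge) (auto simp: codes_def)
    then show ?thesis by (simp add: Lmax_def)
  qed
  then show ?thesis using assms by (cases l) auto
qed

text \<open>The map is guessed as its list of values on the cells of \<open>c\<close>.\<close>

definition simN :: "nat \<Rightarrow> nat \<Rightarrow> nat \<Rightarrow> nat \<Rightarrow> bool" where
  "simN c v c' v' \<longleftrightarrow> (\<exists>h\<le>lrep (llen c) (llen c'). lnth h v = v' \<and>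
     (\<forall>a<llen c. \<forall>b<llen c. \<forall>l\<le>Lmax. stepN c a l b \<longrightarrow> stepN c' (lnth h a) l (lnth h b)))"

lemma dec_simN [dec_intro]:
  assumes "computable1 f" "computable1 g" "computable1 h" "computable1 k"
  shows "dec (\<lambda>e. simN (f e) (g e) (h e) (k e))"
proof -
  have "dec (\<lambda>e. simN (pfst e) (pfst (psnd e)) (pfst (psnd (psnd e))) (psnd (psnd (psnd e))))"
    unfolding simN_def by (intro comp_intro dec_intro)
  from dec_comp[OF this, of "\<lambda>e. prod_encode (f e, prod_encode (g e, prod_encode (h e, k e)))"]
  show ?thesis by (simp add: assms comp_intro)
qed

lemma okN_labeled: "okN c \<Longrightarrow> labeled B (cxN c) (labD c)"
  unfolding okN_iff by blast

lemma simN_acts: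
  assumes ok: "okN c" "okN c'" and sim: "simN c v c' v'" and v': "v' \<in> zcells (cxN c')"
    and acts: "acts (cxN c) (labD c) v u v"
  shows "acts (cxN c') (labD c') v' u v'"
proof -
  interpret D: labeled_complex B "cxN c" "labD c" by unfold_locales (rule okN_labeled[OF ok(1)])
  interpret C: labeled_complex B "cxN c'" "labD c'" by unfold_locales (rule okN_labeled[OF ok(2)])
  obtain h where h: "lnth h v = v'"
    "\<And>a b l. a < llen c \<Longrightarrow> b < llen c \<Longrightarrow> l \<le> Lmax \<Longrightarrow> stepN c a l b \<Longrightarrow> stepN c' (lnth h a) l (lnth h b)"
    using sim unfolding simN_def by blast
  have "simulation (cxN c) (labD c) (cxN c') (labD c') (lnth h)"
    unfolding simulation_def
  proof (intro allI impI)
    fix a l b assume s: "step (cxN c) (labD c) a l b"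
    then have l: "good B [l]" using D.acts_good[of a "[l]" b] by simp
    have "a < llen c" "b < llen c" using D.step_cells[OF s] by (auto simp: zcells_def)
    then have "stepN c' (lnth h a) (code_letter enc l) (lnth h b)"
      using h(2) good_letter_le[OF l] s stepN_iff[OF ok(1) l] by blast
    then show "step (cxN c') (labD c') (lnth h a) l (lnth h b)" using stepN_iff[OF ok(2) l] by blast
  qed
  from C.simulation_acts[OF this acts] show ?thesis using h(1) v' by simp
qed

lemma simN_exists:
  assumes ok: "okN c" "okN c'" and v: "v \<in> zcells (cxN c)" and conn: "dconnected (cxN c)"
    and loops: "\<And>u. acts (cxN c) (labD c) v u v \<Longrightarrow> acts (cxN c') (labD c') v' u v'"
  shows "simN c v c' v'"
proof -
  interpret D: labeled_complex B "cxN c" "labD c" by unfold_locales (rule okN_labeled[OF ok(1)])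
  obtain h where h: "simulation (cxN c) (labD c) (cxN c') (labD c') h" "h v = v'"
    "\<And>a. a \<in> zcells (cxN c) \<Longrightarrow> h a \<in> zcells (cxN c')"
    using ex_simulation[OF okN_labeled[OF ok(1)] conn v okN_labeled[OF ok(2)] loops] by blast
  \<comment> \<open>Only 0-cells take part in steps; the value 0 at the other cells just keeps the
    list below the bound.\<close>
  define t where "t = list_encode (map (\<lambda>a. if a \<in> zcells (cxN c) then h a else 0) [0..<llen c])"
  have t: "lnth t a = h a" if "a \<in> zcells (cxN c)" for a
    using that unfolding t_def by (subst lnth_encode) (auto simp: zcells_def)
  show ?thesis
    unfolding simN_def
  proof (intro exI[of _ t] conjI allI impI)
    show "t \<le> lrep (llen c) (llen c')"
      unfolding t_def using h(3) by (intro list_encode_le_lrep) (auto simp: zcells_def less_imp_le)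
    show "lnth t v = v'" using t[OF v] h(2) by simp
    fix a b l assume s: "stepN c a l b"
    obtain x where x: "l = code_letter enc x" "good B [x]" using stepN_letter[OF ok(1) s] .
    have st: "step (cxN c) (labD c) a x b" using s stepN_iff[OF ok(1) x(2)] x(1) by simp
    then have "step (cxN c') (labD c') (h a) x (h b)" using h(1) unfolding simulation_def by blast
    then show "stepN c' (lnth t a) l (lnth t b)"
      using stepN_iff[OF ok(2) x(2)] x(1) t D.step_cells[OF st] by simp
  qed
qed

definition size_bd :: "nat \<Rightarrow> nat" where
  "size_bd m = Suc (m * Suc m) * (dB + 2) ^ dB"

text \<open>The four ceilings are those of a code: base point and number of cells by
  \<open>size_bd m\<close>, dimensions by \<open>dB\<close>, labels by \<open>Lmax\<close>, and face
  lists by at most \<open>Suc dB\<close> indices of cells.\<close>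

definition code_bd :: "nat \<Rightarrow> nat" where
  "code_bd m = prod_encode (size_bd m, lrep (size_bd m)
     (prod_encode (dB, prod_encode (Lmax, lrep (Suc dB) (size_bd m)))))"

lemma comp_code_bd [comp_intro]:
  assumes "computable1 f" shows "computable1 (\<lambda>e. code_bd (f e))"
  unfolding code_bd_def size_bd_def by (intro comp_intro assms)

text \<open>\<open>size_bound\<close> applies to the coset complex itself, whose loops at the coset
  of \<open>[]\<close> are H. Being finite, it can be renumbered by an initial segment of the
  natural numbers and written down as a code below \<open>code_bd m\<close>.\<close>

lemma coded_coset_complex:
  assumes good: "\<And>w. w \<in> set ws \<Longrightarrow> good B w"
    and m: "length ws \<le> m" "\<And>w. w \<in> set ws \<Longrightarrow> length w \<le> m"
  obtains c v where "okN c" "v \<in> zcells (cxN c)" "dconnected (cxN c)"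
    "\<And>u. good B u \<Longrightarrow> acts (cxN c) (labD c) v u v \<longleftrightarrow> u \<in> omega_closure B (gen_sub B ws)"
    "prod_encode (v, c) \<le> code_bd m"
proof -
  interpret closed_submonoid B "omega_closure B (gen_sub B ws)" by (rule closed_submonoid_omega)
  interpret coset_complex B "omega_closure B (gen_sub B ws)" by unfold_locales (rule Bc)
  define K where "K = card (cells CC)"
  have "finite (cells CC) \<and> card (cells CC) \<le> Suc (m * Suc m) * (dB + 2) ^ dB"
    by (rule CC.size_bound[OF CC_connected CC_base _ _ dB m])
      (use good CC_loop generator_in_omega allowed_good in blast)+
  then have fin: "finite (cells CC)" and K: "K \<le> size_bd m" unfolding K_def size_bd_def by auto
  obtain f where f: "bij_betw f (cells CC) {0..<K}"
    using ex_bij_betw_finite_nat[OF fin] unfolding K_def by blast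
  define g where "g = the_inv_into (cells CC) f"
  have g: "g (f x) = x" "f x < K" if "x \<in> cells CC" for x
    using f that the_inv_into_f_f[of f "cells CC" x] unfolding g_def bij_betw_def by auto
  have gi: "g i \<in> cells CC" if "i < K" for i
    using bij_betw_the_inv_into[OF f] that unfolding g_def bij_betw_def by auto
  \<comment> \<open>Faces of a 0-cell are meaningless and their numbers under \<open>f\<close>
    uncontrolled, so such a cell gets the empty list.\<close>
  define fs where "fs x = list_encode (map (\<lambda>k. f (cface CC k x)) [0..<if cdim CC x = 0 then 0 else Suc (cdim CC x)])" for x
  define cell where "cell x = prod_encode (cdim CC x, prod_encode (enc (snd x), fs x))" for x
  define c where "c = list_encode (map (\<lambda>i. cell (g i)) [0..<K])"
  have len: "llen c = K" unfolding c_def by simp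
  have nth: "lnth c (f x) = cell x" if "x \<in> cells CC" for x
    unfolding c_def using g[OF that] by (simp add: lnth_encode)
  have dim: "dimN c (f x) = cdim CC x" and lab: "labN c (f x) = enc (snd x)"
    and faces: "facesN c (f x) = fs x" if "x \<in> cells CC" for x
    unfolding dimN_def labN_def facesN_def nth[OF that] cell_def by simp_all
  have iso: "cx_iso f CC snd (cxN c) (labD c)"
    unfolding cx_iso_def
  proof (intro conjI ballI impI allI)
    show "delta_complex CC" by (rule CC_delta)
    show "bij_betw f (cells CC) (cells (cxN c))" using f len by (simp add: atLeast0LessThan)
    fix x assume x: "x \<in> cells CC"
    show "cdim (cxN c) (f x) = cdim CC x" using dim[OF x] by simp
    show "labD c (f x) = snd x" using lab[OF x] CC.lab_cell[OF x] by (simp add: labD_def)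
    fix i assume "0 < cdim CC x" "i \<le> cdim CC x"
    then show "cface (cxN c) i (f x) = f (cface CC i x)"
      unfolding cxN_simps faceN_def faces[OF x] fs_def by (subst lnth_encode) (auto simp del: upt_Suc)
  qed
  have "okN c"
    unfolding okN_iff
  proof (intro conjI allI impI)
    show "labeled B (cxN c) (labD c)" by (rule cx_iso_labeled[OF iso CC_labeled])
    fix i assume "i < llen c"
    then have "i < K" using len by simp
    then obtain x where x: "x \<in> cells CC" "i = f x"
      using f unfolding bij_betw_def by (metis atLeastLessThan_iff imageE zero_le)
    show "labN c i \<in> codes" using lab[OF x(1)] CC.lab_cell[OF x(1)] x(2) by (simp add: codes_def)
    show "dimN c i < llen (facesN c i)" if "0 < dimN c i"
      using that dim[OF x(1)] faces[OF x(1)] x(2) by (simp add: fs_def)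
  qed
  moreover have base: "f (cls [], b0) \<in> zcells (cxN c)"
    unfolding cx_iso_zcells[OF iso] using CC_base by blast
  moreover have "dconnected (cxN c)" by (rule cx_iso_connected[OF iso CC_connected])
  moreover have "acts (cxN c) (labD c) (f (cls [], b0)) u (f (cls [], b0)) \<longleftrightarrow>
      u \<in> omega_closure B (gen_sub B ws)" if "good B u" for u
    using cx_iso_acts_iff[OF iso, of "(cls [], b0)" "(cls [], b0)" u] CC_base CC_loop[OF that]
    by (simp add: zcells_def)
  moreover have "prod_encode (f (cls [], b0), c) \<le> code_bd m"
    unfolding code_bd_def
  proof (intro prod_encode_mono)
    show "f (cls [], b0) \<le> size_bd m" using base len K by (auto simp: zcells_def)
    have "cell x \<le> prod_encode (dB, prod_encode (Lmax, lrep (Suc dB) (size_bd m)))" if x: "x \<in> cells CC" for x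
      unfolding cell_def
    proof (intro prod_encode_mono)
      show d: "cdim CC x \<le> dB" using dB CC.lab_cell[OF x] CC.lab_dim[OF x] by auto
      have "enc (snd x) \<le> Max (insert 0 codes)"
        using finite_codes CC.lab_cell[OF x] by (intro Max_ge) (auto simp: codes_def)
      then show "enc (snd x) \<le> Lmax" by (simp add: Lmax_def)
      show "fs x \<le> lrep (Suc dB) (size_bd m)"
        unfolding fs_def
      proof (rule list_encode_le_lrep)
        fix y assume "y \<in> set (map (\<lambda>k. f (cface CC k x)) [0..<if cdim CC x = 0 then 0 else Suc (cdim CC x)])"
        then obtain k where k: "0 < cdim CC x" "k \<le> cdim CC x" "y = f (cface CC k x)"
          by (auto simp del: upt_Suc simp: less_Suc_eq_le split: if_splits)
        then show "y \<le> size_bd m" using g(2)[OF face_cell(1)[OF CC_delta x k(1,2)]] K by simp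
      qed (use d in simp)
    qed
    then have "cell (g i) \<le> prod_encode (dB, prod_encode (Lmax, lrep (Suc dB) (size_bd m)))" if "i < K" for i
      using gi[OF that] by blast
    then show "c \<le> lrep (size_bd m) (prod_encode (dB, prod_encode (Lmax, lrep (Suc dB) (size_bd m))))"
      unfolding c_def using K by (intro list_encode_le_lrep) auto
  qed
  ultimately show ?thesis using that by blast
qed

section \<open>The word problem\<close>

definition eqN :: "nat \<Rightarrow> nat \<Rightarrow> bool" where
  "eqN u v \<longleftrightarrow> (\<forall>y\<le>code_bd (Suc (2 * (u + v))). okN (psnd y) \<longrightarrow>
     (\<forall>w<llen (psnd y). actsN (psnd y) (pfst y) u w \<longleftrightarrow> actsN (psnd y) (pfst y) v w))"

lemma dec_eqN: "dec (\<lambda>e. eqN (pfst e) (psnd e))"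
  unfolding eqN_def by (intro comp_intro dec_intro)

lemma length_winv [simp]: "length (winv u) = length u"
  by (simp add: winv_def)

text \<open>If the test succeeds, consider the coset complex generated by \<open>s @ winv s\<close>.
  There \<open>s\<close> can be read from the base point, hence \<open>t\<close> can too and ends at
  the same 0-cell, so \<open>t @ winv s\<close> is a loop and \<open>s\<close> lies below
  \<open>t\<close>. Exchanging the two words and using antisymmetry gives equality.\<close>

lemma eqN_iff:
  assumes u: "good B u" and v: "good B v"
  shows "eqN (code_word enc u) (code_word enc v) \<longleftrightarrow> eqM B u v"
proof
  assume "eqM B u v"
  then show "eqN (code_word enc u) (code_word enc v)"
    unfolding eqN_def
    using actsN_iff[OF _ u] actsN_iff[OF _ v] labeled_complex.acts_eqM[OF labeled_complex.intro[OF okN_labeled]]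
    by blast
next
  assume eq: "eqN (code_word enc u) (code_word enc v)"
  \<comment> \<open>The single generator \<open>s @ winv s\<close> has twice the length of
    \<open>s\<close>, which is bounded by the code of \<open>s\<close>; the successor makes
    \<open>?m\<close> bound the number of generators, which is 1, as well.\<close>
  let ?m = "Suc (2 * (code_word enc u + code_word enc v))"
  have len: "length w \<le> code_word enc w" for w
    using length_le_list_encode[of "map (code_letter enc) w"] by (simp add: code_word_def)
  have le: "leqM B s t" if st: "s = u \<and> t = v \<or> s = v \<and> t = u" for s t
  proof (rule leqM_if_omega)
    have good: "good B s" "good B t" using st u v by auto
    have "\<And>w. w \<in> set [s @ winv s] \<Longrightarrow> good B w" using good by auto
    moreover have "length [s @ winv s] \<le> ?m" by simp
    moreover have "length w \<le> ?m" if "w \<in> set [s @ winv s]" for w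
      using that st len[of u] len[of v] by auto
    ultimately obtain c b where c: "okN c" "b \<in> zcells (cxN c)"
      and loop: "\<And>q. good B q \<Longrightarrow> acts (cxN c) (labD c) b q b \<longleftrightarrow> q \<in> omega_closure B (gen_sub B [s @ winv s])"
      and code: "prod_encode (b, c) \<le> code_bd ?m"
      using coded_coset_complex[of "[s @ winv s]" ?m] by metis
    interpret labeled_complex B "cxN c" "labD c" by unfold_locales (rule okN_labeled[OF c(1)])
    have "acts (cxN c) (labD c) b (s @ winv s) b"
      using loop[of "s @ winv s"] good generator_in_omega[of "s @ winv s" "[s @ winv s]"] by simp
    then obtain w where w: "acts (cxN c) (labD c) b s w" by (auto simp: acts_append)
    then have "w < llen c" using acts_cells by (auto simp: zcells_def)
    then have "actsN c b (code_word enc u) w \<longleftrightarrow> actsN c b (code_word enc v) w"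
      using eq c(1) code unfolding eqN_def by (metis pfst_encode psnd_encode)
    then have "acts (cxN c) (labD c) b t w"
      using w st actsN_iff[OF c(1) u] actsN_iff[OF c(1) v] by blast
    then have "acts (cxN c) (labD c) b (t @ winv s) b" using w by (auto simp: acts_append acts_winv)
    then show "t @ winv s \<in> omega_closure B (gen_sub B [s @ winv s])" using loop good by simp
  qed
  show "eqM B u v" by (rule leqM_antisym) (use le in auto)
qed

section \<open>Searching for the complex of a closed submonoid\<close>

definition gensN :: "nat \<Rightarrow> nat \<Rightarrow> nat \<Rightarrow> bool" where
  "gensN x c v \<longleftrightarrow> okN c \<and> v < llen c \<and> dimN c v = 0 \<and> (\<forall>j<llen x. actsN c v (lnth x j) v)"

lemma dec_gensN [dec_intro]:
  assumes "computable1 f" "computable1 g" "computable1 h"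
  shows "dec (\<lambda>e. gensN (f e) (g e) (h e))"
proof -
  have "dec (\<lambda>e. gensN (pfst e) (pfst (psnd e)) (psnd (psnd e)))"
    unfolding gensN_def by (intro comp_intro dec_intro)
  from dec_comp[OF this, of "\<lambda>e. prod_encode (f e, prod_encode (g e, h e))"]
  show ?thesis by (simp add: assms comp_intro)
qed

definition letters :: "nat set" where "letters = code_letter enc ` {l. good B [l]}"

lemma finite_letters: "finite letters"
  unfolding letters_def using good_letter_le by (intro finite_subset[OF _ finite_atMost[of Lmax]]) auto

definition wordsN :: "nat \<Rightarrow> bool" where
  "wordsN x \<longleftrightarrow> (\<forall>j<llen x. \<forall>i<llen (lnth x j). lnth (lnth x j) i \<in> letters)"

text \<open>The disjunct for codes \<open>x\<close> that are not codes of lists of words makes the search for \<open>y\<close> total.\<close>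

definition initialN :: "nat \<Rightarrow> nat \<Rightarrow> bool" where
  "initialN y x \<longleftrightarrow> \<not> wordsN x \<or> gensN x (psnd y) (pfst y) \<and> connN (psnd y) (pfst y) \<and>
     (\<forall>z\<le>code_bd x. gensN x (psnd z) (pfst z) \<longrightarrow> simN (psnd y) (pfst y) (psnd z) (pfst z))"

lemma dec_initialN: "dec (\<lambda>e. initialN (pfst e) (psnd e))"
  unfolding initialN_def wordsN_def
  by (intro comp_intro dec_intro dec_comp[OF dec_finite[OF finite_letters]])

text \<open>List coding is a bijection with the natural numbers, so every number is a list of lists
  and only its innermost entries have to be checked.\<close>

lemma wordsN_code:
  assumes "wordsN x" obtains ws where "\<And>w. w \<in> set ws \<Longrightarrow> good B w" "x = code_words enc ws"
proof -
  define dl where "dl n = (SOME l. good B [l] \<and> n = code_letter enc l)" for n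
  have dl: "good B [dl n] \<and> code_letter enc (dl n) = n" if "n \<in> letters" for n
  proof -
    have "\<exists>l. good B [l] \<and> n = code_letter enc l" using that unfolding letters_def by auto
    from someI_ex[OF this, folded dl_def] show ?thesis by metis
  qed
  define ws where "ws = map (\<lambda>w. map dl (list_decode w)) (list_decode x)"
  have el: "n \<in> letters" if w: "w \<in> set (list_decode x)" and n: "n \<in> set (list_decode w)" for w n
  proof -
    obtain j where j: "j < llen x" "lnth x j = w"
      using w lnth_decode[of _ x] unfolding in_set_conv_nth llen_def by auto
    obtain i where "i < llen w" "lnth w i = n"
      using n lnth_decode[of _ w] unfolding in_set_conv_nth llen_def by auto
    then show ?thesis using assms j unfolding wordsN_def by blast
  qed
  have "code_word enc (map dl (list_decode w)) = w" if "w \<in> set (list_decode x)" for w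
  proof -
    have "map (code_letter enc \<circ> dl) (list_decode w) = map id (list_decode w)"
      using dl el[OF that] by (intro map_cong) auto
    then show ?thesis unfolding code_word_def by simp
  qed
  then have "map (code_word enc) ws = list_decode x"
    unfolding ws_def by (simp add: map_idI)
  then have "x = code_words enc ws" unfolding code_words_def by simp
  moreover have "good B w" if "w \<in> set ws" for w
    using that dl el unfolding ws_def good_def by fastforce
  ultimately show ?thesis using that by blast
qed

lemma wordsN_code_words:
  assumes "\<And>w. w \<in> set ws \<Longrightarrow> good B w" shows "wordsN (code_words enc ws)"
proof -
  have "code_letter enc (w ! i) \<in> letters" if "w \<in> set ws" "i < length w" for w i
    using assms[OF that(1)] nth_mem[OF that(2)] unfolding good_def letters_def by fastforce
  then show ?thesis
    unfolding wordsN_def code_words_def code_word_def by (auto simp: lnth_encode)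
qed

lemma gensN_iff:
  assumes "\<And>w. w \<in> set ws \<Longrightarrow> good B w"
  shows "gensN (code_words enc ws) c v \<longleftrightarrow> okN c \<and> v \<in> zcells (cxN c) \<and>
     (\<forall>w\<in>set ws. acts (cxN c) (labD c) v w v)"
proof -
  have "lnth (code_words enc ws) j = code_word enc (ws ! j)" if "j < length ws" for j
    using that by (simp add: code_words_def lnth_encode)
  moreover have "llen (code_words enc ws) = length ws" by (simp add: code_words_def)
  ultimately show ?thesis
    using actsN_iff[of c] assms unfolding gensN_def zcells_def by (auto simp: all_set_conv_all_nth)
qed

lemma words_le_code:
  "length ws \<le> code_words enc ws" "w \<in> set ws \<Longrightarrow> length w \<le> code_words enc ws"
proof -
  show "length ws \<le> code_words enc ws"
    using length_le_list_encode[of "map (code_word enc) ws"] by (simp add: code_words_def)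
  assume "w \<in> set ws"
  then have "code_word enc w \<le> code_words enc ws"
    unfolding code_words_def by (intro elem_le_list_encode) simp
  moreover have "length w \<le> code_word enc w"
    using length_le_list_encode[of "map (code_letter enc) w"] by (simp add: code_word_def)
  ultimately show "length w \<le> code_words enc ws" by simp
qed

lemma gens_omega:
  assumes "\<And>w. w \<in> set ws \<Longrightarrow> good B w" "gensN (code_words enc ws) c v" "u \<in> omega_closure B (gen_sub B ws)"
  shows "acts (cxN c) (labD c) v u v"
proof -
  have c: "okN c" "v \<in> zcells (cxN c)" "\<And>w. w \<in> set ws \<Longrightarrow> acts (cxN c) (labD c) v w v"
    using gensN_iff[OF assms(1)] assms(2) by auto
  interpret labeled_complex B "cxN c" "labD c" by unfold_locales (rule okN_labeled[OF c(1)])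
  show ?thesis by (rule acts_omega[OF c(2,3) assms(3)])
qed

text \<open>The coset complex passes the test: its loops are exactly H, and H consists of loops in
  every complex in which the generators are loops, so a simulation exists.\<close>

lemma coset_initialN:
  assumes good: "\<And>w. w \<in> set ws \<Longrightarrow> good B w"
  obtains c v where "okN c" "v \<in> zcells (cxN c)" "gensN (code_words enc ws) c v"
    "\<And>u. good B u \<Longrightarrow> acts (cxN c) (labD c) v u v \<longleftrightarrow> u \<in> omega_closure B (gen_sub B ws)"
    "prod_encode (v, c) \<le> code_bd (code_words enc ws)"
    "initialN (prod_encode (v, c)) (code_words enc ws)"
proof -
  let ?x = "code_words enc ws"
  obtain c v where c: "okN c" "v \<in> zcells (cxN c)" "dconnected (cxN c)"
    and loop: "\<And>u. good B u \<Longrightarrow> acts (cxN c) (labD c) v u v \<longleftrightarrow> u \<in> omega_closure B (gen_sub B ws)"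
    and code: "prod_encode (v, c) \<le> code_bd ?x"
    using coded_coset_complex[OF good words_le_code] by metis
  interpret labeled_complex B "cxN c" "labD c" by unfold_locales (rule okN_labeled[OF c(1)])
  have gens: "gensN ?x c v"
    using gensN_iff[OF good] c loop good generator_in_omega by blast
  have "simN c v (psnd z) (pfst z)" if "gensN ?x (psnd z) (pfst z)" for z
  proof (rule simN_exists[OF c(1) _ c(2,3)])
    show "okN (psnd z)" using that unfolding gensN_def by simp
    fix u assume "acts (cxN c) (labD c) v u v"
    then have "u \<in> omega_closure B (gen_sub B ws)" using loop acts_good by blast
    then show "acts (cxN (psnd z)) (labD (psnd z)) (pfst z) u (pfst z)"
      using gens_omega[OF good that] by blast
  qed
  then have "initialN (prod_encode (v, c)) ?x"
    unfolding initialN_def using gens connN_iff[OF delta c(2)] c(3) by simp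
  then show ?thesis using that c(1,2) gens loop code by blast
qed

lemma initialN_exists: "\<exists>y. initialN y x"
proof (cases "wordsN x")
  case True
  then obtain ws where ws: "\<And>w. w \<in> set ws \<Longrightarrow> good B w" "x = code_words enc ws"
    using wordsN_code by metis
  then show ?thesis using coset_initialN[of ws] by metis
qed (simp add: initialN_def)

text \<open>Every solution has the loops H. The generators are loops, which gives one inclusion. For
  the other, the coset complex is among the complexes tested because its code is below the bound,
  and a simulation into it sends each loop to a loop there, that is, to a member of H.\<close>

lemma initialN_loops:
  assumes good: "\<And>w. w \<in> set ws \<Longrightarrow> good B w" and y: "initialN y (code_words enc ws)"
  shows "okN (psnd y)" "pfst y \<in> zcells (cxN (psnd y))" "dconnected (cxN (psnd y))"
    "good B u \<Longrightarrow> acts (cxN (psnd y)) (labD (psnd y)) (pfst y) u (pfst y) \<longleftrightarrow> u \<in> omega_closure B (gen_sub B ws)"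
proof -
  let ?x = "code_words enc ws"
  have gens: "gensN ?x (psnd y) (pfst y)" and conn: "connN (psnd y) (pfst y)"
    and sim: "\<And>z. z \<le> code_bd ?x \<Longrightarrow> gensN ?x (psnd z) (pfst z) \<Longrightarrow> simN (psnd y) (pfst y) (psnd z) (pfst z)"
    using y wordsN_code_words[OF good] unfolding initialN_def by auto
  show ok: "okN (psnd y)" and v: "pfst y \<in> zcells (cxN (psnd y))" using gens gensN_iff[OF good] by auto
  interpret labeled_complex B "cxN (psnd y)" "labD (psnd y)" by unfold_locales (rule okN_labeled[OF ok])
  show "dconnected (cxN (psnd y))" using connN_iff[OF delta v] conn by simp
  assume u: "good B u"
  show "acts (cxN (psnd y)) (labD (psnd y)) (pfst y) u (pfst y) \<longleftrightarrow> u \<in> omega_closure B (gen_sub B ws)"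
  proof
    assume a: "acts (cxN (psnd y)) (labD (psnd y)) (pfst y) u (pfst y)"
    obtain c v where c: "okN c" "v \<in> zcells (cxN c)" "gensN ?x c v"
      and loop: "acts (cxN c) (labD c) v u v \<longleftrightarrow> u \<in> omega_closure B (gen_sub B ws)"
      and code: "prod_encode (v, c) \<le> code_bd ?x"
      using coset_initialN[OF good] u by metis
    have "simN (psnd y) (pfst y) c v" using sim[OF code] c(3) by simp
    from simN_acts[OF ok c(1) this c(2) a] show "u \<in> omega_closure B (gen_sub B ws)" using loop by simp
  qed (rule gens_omega[OF good gens])
qed

section \<open>From numbers back to lists of cells\<close>

definition cell_list :: "nat \<Rightarrow> (nat \<times> nat \<times> nat list) list" where
  "cell_list c = map (\<lambda>z. (pfst z, pfst (psnd z), list_decode (psnd (psnd z)))) (list_decode c)"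

text \<open>Every number is the code of a base point with a list of cells, so the result of the
  search already has the required output format.\<close>

lemma code_cx_cell_list: "code_cx (pfst y) (cell_list (psnd y)) = y"
proof -
  have "map ((\<lambda>(d, l, fs). prod_encode (d, prod_encode (l, list_encode fs))) \<circ>
      (\<lambda>z. (pfst z, pfst (psnd z), list_decode (psnd (psnd z))))) (list_decode (psnd y)) = list_decode (psnd y)"
    by (rule map_idI) simp
  then show ?thesis unfolding code_cx_def cell_list_def by simp
qed

text \<open>The cells are the same numbers on both sides, so the identity serves as isomorphism. The
  two ways of looking up a face agree because \<open>okN\<close> makes the face lists long
  enough.\<close>

lemma cell_list_iso:
  assumes ok: "okN c" shows "cx_iso id (cxN c) (labD c) (cx_of (cell_list c)) (lab_of B enc (cell_list c))"
proof -
  interpret labeled_complex B "cxN c" "labD c" by unfold_locales (rule okN_labeled[OF ok])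
  have len: "length (cell_list c) = llen c" by (simp add: cell_list_def llen_def)
  have nth: "cell_list c ! i = (dimN c i, labN c i, list_decode (facesN c i))" if "i < llen c" for i
    using that by (simp add: cell_list_def dimN_def labN_def facesN_def lnth_decode llen_def)
  show ?thesis
    unfolding cx_iso_def
  proof (intro conjI ballI impI allI)
    fix i assume "i \<in> cells (cxN c)"
    then have i: "i < llen c" by simp
    show "cdim (cx_of (cell_list c)) (id i) = cdim (cxN c) i"
      "lab_of B enc (cell_list c) (id i) = labD c i"
      using nth[OF i] by (simp_all add: cx_of_def lab_of_def labD_def unenc_def)
    fix k assume k: "0 < cdim (cxN c) i" "k \<le> cdim (cxN c) i"
    then have "k < llen (facesN c i)" using ok i unfolding okN_iff by auto
    then show "cface (cx_of (cell_list c)) k (id i) = id (cface (cxN c) k i)"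
      using nth[OF i] by (simp add: cx_of_def faceN_def lnth_decode)
  qed (simp_all add: delta len cx_of_def)
qed

lemma word_problem:
  "\<exists>f. computable1 f \<and> (\<forall>u v. allowed B u \<and> allowed B v \<longrightarrow>
     f (prod_encode (code_word enc u, code_word enc v)) = (if eqM B u v then 1 else 0))"
proof (intro exI[of _ "\<lambda>e. of_bool (eqN (pfst e) (psnd e))"] conjI allI impI)
  show "computable1 (\<lambda>e. of_bool (eqN (pfst e) (psnd e)))"
    using dec_eqN unfolding dec_def .
  show "of_bool (eqN (pfst (prod_encode (code_word enc u, code_word enc v)))
       (psnd (prod_encode (code_word enc u, code_word enc v)))) = (if eqM B u v then 1 else (0::nat))"
    if "allowed B u \<and> allowed B v" for u v
    using eqN_iff[of u v] that allowed_good by auto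
qed

lemma effective_construction:
  "\<exists>F. computable1 F \<and>
    (\<forall>ws. (\<forall>w\<in>set ws. allowed B w) \<longrightarrow>
       (\<exists>w0 cl. F (code_words enc ws) = code_cx w0 cl \<and>
          (\<forall>i < length cl. fst (snd (cl ! i)) \<in> enc ` cells B) \<and>
          labeled B (cx_of cl) (lab_of B enc cl) \<and> dconnected (cx_of cl) \<and>
          w0 \<in> zcells (cx_of cl) \<and>
          loop_words B (cx_of cl) (lab_of B enc cl) w0 =
            {u. allowed B u \<and> u \<in> omega_closure B (gen_sub B ws)}))"
proof (intro exI[of _ "\<lambda>x. LEAST y. initialN y x"] conjI allI impI)
  show "computable1 (\<lambda>x. LEAST y. initialN y x)"
    by (rule comp_Least[OF dec_initialN initialN_exists])
  fix ws assume "\<forall>w\<in>set ws. allowed B w"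
  then have good: "good B w" if "w \<in> set ws" for w using that allowed_good by blast
  define y where "y = (LEAST y. initialN y (code_words enc ws))"
  define c where "c = psnd y"
  let ?cl = "cell_list c"
  have init: "initialN y (code_words enc ws)"
    unfolding y_def by (rule LeastI_ex[OF initialN_exists])
  have y: "okN c" "pfst y \<in> zcells (cxN c)" "dconnected (cxN c)"
    unfolding c_def by (rule initialN_loops[OF _ init]; fact good)+
  have loops: "acts (cxN c) (labD c) (pfst y) u (pfst y) \<longleftrightarrow> u \<in> omega_closure B (gen_sub B ws)"
    if "good B u" for u
    unfolding c_def by (rule initialN_loops(4)[OF _ init that]) (fact good)
  note iso = cell_list_iso[OF y(1)]
  have "fst (snd (?cl ! i)) \<in> enc ` cells B" if "i < length ?cl" for i
  proof -
    have "i < llen c" using that by (simp add: cell_list_def llen_def)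
    moreover from this have "fst (snd (?cl ! i)) = labN c i"
      by (simp add: cell_list_def labN_def lnth_decode llen_def)
    ultimately show ?thesis using y(1) unfolding okN_iff codes_def by simp
  qed
  moreover have "loop_words B (cx_of ?cl) (lab_of B enc ?cl) (pfst y) =
      {u. allowed B u \<and> u \<in> omega_closure B (gen_sub B ws)}"
    using loops cx_iso_acts_iff[OF iso, of "pfst y" "pfst y"] y(2) allowed_good
    unfolding loop_words_def by (auto simp: zcells_def)
  moreover have "pfst y \<in> zcells (cx_of ?cl)" using y(2) cx_iso_zcells[OF iso] by simp
  ultimately show "\<exists>w0 cl. (LEAST y. initialN y (code_words enc ws)) = code_cx w0 cl \<and>
      (\<forall>i < length cl. fst (snd (cl ! i)) \<in> enc ` cells B) \<and>
      labeled B (cx_of cl) (lab_of B enc cl) \<and> dconnected (cx_of cl) \<and>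
      w0 \<in> zcells (cx_of cl) \<and>
      loop_words B (cx_of cl) (lab_of B enc cl) w0 =
        {u. allowed B u \<and> u \<in> omega_closure B (gen_sub B ws)}"
    using code_cx_cell_list[of y] cx_iso_labeled[OF iso okN_labeled[OF y(1)]] cx_iso_connected[OF iso y(3)]
    unfolding y_def[symmetric] c_def[symmetric]
    by (intro exI[of _ "pfst y"] exI[of _ ?cl]) simp
qed

end

lemma finite_of_loops:
  assumes Bc: "B_complex B" and ws: "\<forall>w\<in>set ws. allowed B w" and C: "labeled B C lab" "dconnected C"
    and v: "v \<in> zcells C"
    and loops: "loop_words B C lab v = {u. allowed B u \<and> u \<in> omega_closure B (gen_sub B ws)}"
  shows "finite (cells C)"
proof -
  interpret labeled_complex B C lab by unfold_locales (rule C(1))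
  obtain n where n: "\<forall>c\<in>cells B. cdim B c \<le> n" using Bc unfolding B_complex_def by blast
  have lw: "acts C lab v u v \<longleftrightarrow> u \<in> omega_closure B (gen_sub B ws)" if "allowed B u" for u
    using loops that unfolding loop_words_def by blast
  \<comment> \<open>Any number above both the count and the lengths of the words will do.\<close>
  define m where "m = length ws + sum_list (map length ws)"
  have "length w \<le> m" if "w \<in> set ws" for w
    using that member_le_sum_list[of "length w" "map length ws"] unfolding m_def by auto
  moreover have "acts C lab v w v" if "w \<in> set ws" for w
    using that ws lw generator_in_omega by blast
  ultimately show ?thesis
    using size_bound[OF C(2) v _ _ n, of ws m] lw unfolding m_def by auto
qed

theorem mainTheorem14:
  fixes B :: "'a dcx"
  assumes B: "B_complex B"
    and finX: "finite (Xs B)" and finP: "finite (Ps B)"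
  shows
    \<comment> \<open>(a) decidability of the word problem\<close>
    "(\<forall>enc. inj_on enc (cells B) \<longrightarrow>
       (\<exists>f. computable1 f \<and>
          (\<forall>u v. allowed B u \<and> allowed B v \<longrightarrow>
             f (prod_encode (code_word enc u, code_word enc v)) = (if eqM B u v then 1 else 0))))
   \<and>
    \<comment> \<open>(b1) every connected complex labeled over B with loop monoid H = N^omega is finite\<close>
    (\<forall>ws (C :: 'c dcx) lab v. (\<forall>w\<in>set ws. allowed B w) \<and> labeled B C lab \<and> dconnected C \<and>
        v \<in> zcells C \<and>
        loop_words B C lab v = {u. allowed B u \<and> u \<in> omega_closure B (gen_sub B ws)}
        \<longrightarrow> finite (cells C))
   \<and>
    \<comment> \<open>(b2) it can be effectively constructed from a finite generating set\<close>
    (\<forall>enc. inj_on enc (cells B) \<longrightarrow>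
       (\<exists>F. computable1 F \<and>
          (\<forall>ws. (\<forall>w\<in>set ws. allowed B w) \<longrightarrow>
             (\<exists>w0 cl. F (code_words enc ws) = code_cx w0 cl \<and>
                (\<forall>i < length cl. fst (snd (cl ! i)) \<in> enc ` cells B) \<and>
                labeled B (cx_of cl) (lab_of B enc cl) \<and> dconnected (cx_of cl) \<and>
                w0 \<in> zcells (cx_of cl) \<and>
                loop_words B (cx_of cl) (lab_of B enc cl) w0 =
                  {u. allowed B u \<and> u \<in> omega_closure B (gen_sub B ws)}))))"
proof (rule conjI[OF _ conjI]; intro allI impI)
  fix enc :: "'a \<Rightarrow> nat" assume "inj_on enc (cells B)"
  then interpret finite_B B enc using B finX finP by unfold_locales
  show "\<exists>f. computable1 f \<and>
          (\<forall>u v. allowed B u \<and> allowed B v \<longrightarrow>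
             f (prod_encode (code_word enc u, code_word enc v)) = (if eqM B u v then 1 else 0))"
    by (rule word_problem)
next
  fix ws and C :: "'c dcx" and lab v
  assume "(\<forall>w\<in>set ws. allowed B w) \<and> labeled B C lab \<and> dconnected C \<and> v \<in> zcells C \<and>
      loop_words B C lab v = {u. allowed B u \<and> u \<in> omega_closure B (gen_sub B ws)}"
  then show "finite (cells C)" by (elim conjE) (rule finite_of_loops[OF B])
next
  fix enc :: "'a \<Rightarrow> nat" assume "inj_on enc (cells B)"
  then interpret finite_B B enc using B finX finP by unfold_locales
  show "\<exists>F. computable1 F \<and>
          (\<forall>ws. (\<forall>w\<in>set ws. allowed B w) \<longrightarrow>
             (\<exists>w0 cl. F (code_words enc ws) = code_cx w0 cl \<and>
                (\<forall>i < length cl. fst (snd (cl ! i)) \<in> enc ` cells B) \<and>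
                labeled B (cx_of cl) (lab_of B enc cl) \<and> dconnected (cx_of cl) \<and>
                w0 \<in> zcells (cx_of cl) \<and>
                loop_words B (cx_of cl) (lab_of B enc cl) w0 =
                  {u. allowed B u \<and> u \<in> omega_closure B (gen_sub B ws)}))"
    by (rule effective_construction)
qed

end
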